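(* Let $0<d<2$. Then $$\lim_{\ell\to\infty}\limsup_{n\to\infty}\ \mathbb E\left[\max_{\tau\in S(\boldsymbol\Phi_n)}\left|\mu_{\boldsymbol\Phi_n}\left(\boldsymbol\sigma_{x_1}=1\mid\boldsymbol\sigma_{\partial^{2\ell}x_1}=\tau_{\partial^{2\ell}x_1}\right)-\nu^{(\ell)}_{\boldsymbol\Phi_n,x_1}(1)\right|\ \Big|\ Z(\boldsymbol\Phi_n)>0\right]=0 .$$
   Context: Random formula: for $n\ge2$ and $d>0$ let $\boldsymbol m\sim\mathrm{Po}(dn/2)$ and let $\boldsymbol\Phi=\boldsymbol\Phi_n$ be a random 2-SAT formula with Boolean variables $x_1,\dots,x_n$ and clauses $a_1,\dots,a_{\boldsymbol m}$, drawn uniformly and independently from the set of all $4n(n-1)$ possible clauses with two distinct variables (a clause is an ordered pair of literals with distinct underlying variables). `True' and `false' are encoded by $+1$ and $-1$. $S(\boldsymbol\Phi)\subseteq\{\pm1\}^{\{x_1,\dots,x_n\}}$ is the set of satisfying assignments, $Z(\boldsymbol\Phi)=|S(\boldsymbol\Phi)|$; if $Z(\boldsymbol\Phi)>0$, $\mu_{\boldsymbol\Phi}$ is the uniform distribution on $S(\boldsymbol\Phi)$ and $\boldsymbol\sigma$ is a sample from $\mu_{\boldsymbol\Phi}$. Graph: $G(\boldsymbol\Phi)$ is the bipartite graph with vertex classes $\{x_1,\dots,x_n\}$ and $\{a_1,\dots,a_{\boldsymbol m}\}$ in which each clause is adjacent to the two variables that it contains. $\partial v$ is the set of neighbours of $v$,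 and $\partial^\ell v$ the set of vertices at distance exactly $\ell$ from $v$. For $\tau\in S(\boldsymbol\Phi)$ the conditioning $\boldsymbol\sigma_{\partial^{2\ell}x_1}=\tau_{\partial^{2\ell}x_1}$ means $\boldsymbol\sigma_y=\tau_y$ for all $y\in\partial^{2\ell}x_1$. Belief Propagation: for adjacent $a,x$ set $\nu^{(0)}_{\boldsymbol\Phi,a\to x}(\pm1)=\nu^{(0)}_{\boldsymbol\Phi,x\to a}(\pm1)=1/2$. For $\ell\ge1$, if clause $a$ contains the two variables $x,y$ and $r,s\in\{\pm1\}$ indicate whether $x,y$ respectively appear as positive ($+1$) or negative ($-1$) literals in $a$, then for $t=\pm1$ $$\nu^{(\ell)}_{\boldsymbol\Phi,a\to x}(t)=\frac{1-\mathbf 1\{r\ne t\}\,\nu^{(\ell-1)}_{\boldsymbol\Phi,y\to a}(-s)}{1+\nu^{(\ell-1)}_{\boldsymbol\Phi,y\to a}(s)},\qquad \nu^{(\ell)}_{\boldsymbol\Phi,x\to a}(t)=\frac{\prod_{b\in\partial x\setminus\{a\}}\nu^{(\ell)}_{\boldsymbol\Phi,b\to x}(t)}{\prod_{b\in\partial x\setminus\{a\}}\nu^{(\ell)}_{\boldsymbol\Phi,b\to x}(1)+\prod_{b\in\partial x\setminus\{a\}}\nu^{(\ell)}_{\boldsymbol\Phi,b\to x}(-1)},$$ and $$\nu^{(\ell)}_{\boldsymbol\Phi,x}(t)=\frac{\prod_{a\in\partial x}\nu^{(\ell)}_{\boldsymbol\Phi,a\to x}(t)}{\prod_{a\in\partial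 x}\nu^{(\ell)}_{\boldsymbol\Phi,a\to x}(1)+\prod_{a\in\partial x}\nu^{(\ell)}_{\boldsymbol\Phi,a\to x}(-1)};$$ the last two fractions are read as $1/2$ if the denominator vanishes. *)

theory Defs
  imports "HOL-Probability.Probability"
begin

text \<open>
  Truth values and signs of literals are the integers \<^term>\<open>1\<close> (true, positive) and
  \<^term>\<open>- 1\<close> (false, negated); the variables of a formula are \<^term>\<open>{1..n}\<close>.
\<close>

type_synonym literal = "nat \<times> int"
type_synonym clause = "literal \<times> literal"
type_synonym formula = "clause list"

definition all_clauses :: "nat \<Rightarrow> clause set" where
  "all_clauses n = {((x, r), (y, s)) | x r y s.
     x \<in> {1..n} \<and> y \<in> {1..n} \<and> x \<noteq> y \<and> r \<in> {1, -1} \<and> s \<in> {1, -1}}"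

definition random_formula :: "real \<Rightarrow> nat \<Rightarrow> formula pmf" where
  "random_formula d n =
     bind_pmf (poisson_pmf (d * real n / 2)) (\<lambda>m. replicate_pmf m (pmf_of_set (all_clauses n)))"

fun sat_clause :: "(nat \<Rightarrow> int) \<Rightarrow> clause \<Rightarrow> bool" where
  "sat_clause \<sigma> ((x, r), (y, s)) \<longleftrightarrow> \<sigma> x = r \<or> \<sigma> y = s"

definition sat_assignments :: "nat \<Rightarrow> formula \<Rightarrow> (nat \<Rightarrow> int) set" where
  "sat_assignments n \<Phi> = {\<sigma> \<in> {1..n} \<rightarrow>\<^sub>E {1, -1}. \<forall>c\<in>set \<Phi>. sat_clause \<sigma> c}"

definition num_sat :: "nat \<Rightarrow> formula \<Rightarrow> nat" where
  "num_sat n \<Phi> = card (sat_assignments n \<Phi>)"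

text \<open>Unspecified if \<^term>\<open>num_sat n \<Phi> = 0\<close>.\<close>

definition gibbs :: "nat \<Rightarrow> formula \<Rightarrow> (nat \<Rightarrow> int) pmf" where
  "gibbs n \<Phi> = pmf_of_set (sat_assignments n \<Phi>)"

text \<open>
  Clauses of a formula are identified with their positions in the list, so that repeated
  clauses are distinct vertices of the graph.
\<close>

datatype vertex = Variable nat | Clause nat

fun clause_vars :: "clause \<Rightarrow> nat set" where
  "clause_vars ((x, r), (y, s)) = {x, y}"

definition edges :: "formula \<Rightarrow> (vertex \<times> vertex) set" where
  "edges \<Phi> =
     {(Variable x, Clause a) | x a. a < length \<Phi> \<and> x \<in> clause_vars (\<Phi> ! a)} \<union>
     {(Clause a, Variable x) | x a. a < length \<Phi> \<and> x \<in> clause_vars (\<Phi> ! a)}"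

definition sphere :: "formula \<Rightarrow> nat \<Rightarrow> vertex \<Rightarrow> vertex set" where
  "sphere \<Phi> l v = {u. (v, u) \<in> edges \<Phi> ^^ l \<and> (\<forall>k<l. (v, u) \<notin> edges \<Phi> ^^ k)}"

definition var_nbrs :: "formula \<Rightarrow> nat \<Rightarrow> nat set" where
  "var_nbrs \<Phi> x = {a. (Variable x, Clause a) \<in> edges \<Phi>}"

text \<open>
  For a clause that contains the variable \<^term>\<open>x\<close>: the sign of \<^term>\<open>x\<close>, the other variable,
  and the sign of the other variable.
\<close>

fun own_sign :: "clause \<Rightarrow> nat \<Rightarrow> int" where
  "own_sign ((u, r), (v, s)) x = (if x = u then r else s)"

fun other_var :: "clause \<Rightarrow> nat \<Rightarrow> nat" where
  "other_var ((u, r), (v, s)) x = (if x = u then v else u)"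

fun other_sign :: "clause \<Rightarrow> nat \<Rightarrow> int" where
  "other_sign ((u, r), (v, s)) x = (if x = u then s else r)"

text \<open>\<open>normalized f t\<close> is \<open>f t / (f 1 + f (-1))\<close>, read as 1/2 if the denominator vanishes.\<close>

definition normalized :: "(int \<Rightarrow> real) \<Rightarrow> int \<Rightarrow> real" where
  "normalized f t = (if f 1 + f (-1) = 0 then 1 / 2 else f t / (f 1 + f (-1)))"

text \<open>
  \<open>msg_cv \<Phi> l a x t\<close> is the message from clause \<open>a\<close> to variable \<open>x\<close> and \<open>msg_vc \<Phi> l x a t\<close>
  the message from \<open>x\<close> to \<open>a\<close>, both after \<open>l\<close> rounds.  They are meaningful
  only for adjacent \<open>a\<close> and \<open>x\<close>.
\<close>

function (sequential)
  msg_cv :: "formula \<Rightarrow> nat \<Rightarrow> nat \<Rightarrow> nat \<Rightarrow> int \<Rightarrow> real" and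
  msg_vc :: "formula \<Rightarrow> nat \<Rightarrow> nat \<Rightarrow> nat \<Rightarrow> int \<Rightarrow> real" where
  "msg_cv \<Phi> 0 a x t = 1 / 2"
| "msg_cv \<Phi> (Suc l) a x t =
     (let r = own_sign (\<Phi> ! a) x; y = other_var (\<Phi> ! a) x; s = other_sign (\<Phi> ! a) x
      in (1 - of_bool (r \<noteq> t) * msg_vc \<Phi> l y a (- s)) / (1 + msg_vc \<Phi> l y a s))"
| "msg_vc \<Phi> 0 x a t = 1 / 2"
| "msg_vc \<Phi> (Suc l) x a t =
     normalized (\<lambda>t'. \<Prod>b\<in>var_nbrs \<Phi> x - {a}. msg_cv \<Phi> (Suc l) b x t') t"
  by pat_completeness auto
termination
  by (relation "Wellfounded.measure (\<lambda>p. case p of Inl (_, l, _) \<Rightarrow> 2 * l | Inr (_, l, _) \<Rightarrow> 2 * l + 1)") auto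

definition bp_marginal :: "formula \<Rightarrow> nat \<Rightarrow> nat \<Rightarrow> int \<Rightarrow> real" where
  "bp_marginal \<Phi> l x = normalized (\<lambda>t. \<Prod>a\<in>var_nbrs \<Phi> x. msg_cv \<Phi> l a x t)"

definition cond_marginal :: "nat \<Rightarrow> formula \<Rightarrow> nat \<Rightarrow> (nat \<Rightarrow> int) \<Rightarrow> real" where
  "cond_marginal n \<Phi> l \<tau> =
     \<P>(\<sigma> in measure_pmf (gibbs n \<Phi>). \<sigma> 1 = 1 \<bar>
        (\<forall>y. Variable y \<in> sphere \<Phi> (2 * l) (Variable 1) \<longrightarrow> \<sigma> y = \<tau> y))"

end

theory Submission
  imports Defs "HOL-Library.Sublist" "HOL-Library.Transitive_Closure_Table"
    "HOL-Real_Asymp.Real_Asymp"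
begin

text \<open>
  On a ball that is a tree, Belief Propagation and the marginals given a boundary condition obey
  the same recursion.  In terms of log-odds \<open>\<eta>\<close> it reads
  \<open>\<eta>\<^sub>x = \<Sum> r ln (1 + exp (- s \<eta>\<^sub>y))\<close>, summed over the clauses that contain \<open>x\<close> with sign \<open>r\<close> and
  another variable \<open>y\<close> with sign \<open>s\<close>.  Since \<open>ln (1 + exp (- \<eta>)) - ln (1 + exp \<eta>) = - \<eta>\<close>, an interval
  for \<open>\<eta>\<^sub>y\<close> contributes on average over \<open>s\<close> exactly half of its width to the interval for \<open>\<eta>\<^sub>x\<close>.
  As there are about \<open>d\<close> children per variable, widths contract by the factor \<open>d / 2 < 1\<close> per level.
  At the boundary the log-odds are infinite, but infinity travels upwards only along implication
  paths, of which there are few for the same reason: the expected number of those of length \<open>L\<close>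
  that start in a given variable is of order \<open>(d / 2) ^ L\<close>.  All expectations reduce to first
  moments of the number of walks, at most \<open>d ^ k\<close> for length \<open>k\<close> at every \<open>n\<close>, so no local limit is
  needed.  Likewise a first moment shows that the ball fails to be a tree with probability O(1/n), and unsatisfiability
  forces a bicycle in the implication digraph, which again has probability O(1/n).
\<close>

section \<open>Walks from the first variable\<close>

text \<open>The maximum over \<tau> lets an adversary choose the boundary values after seeing the
  formula, so no estimate may average over the boundary. Belief Propagation and the conditional
  marginals for all \<tau> are therefore trapped in one interval that depends on the formula alone;
  only its width is averaged. The depth is split as \<open>L + k\<close>: the lower \<open>L\<close>
  levels make the log-odds finite, the upper \<open>k\<close> levels shrink the interval. The lower
  part fails with probability of order at most \<open>d ^ k * (d / 2) ^ L\<close>, where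
  \<open>d ^ k\<close> may be large, while the width at the root is of order
  \<open>(d / 2) ^ k\<close> uniformly in \<open>L\<close>; hence \<open>k\<close> is fixed before
  \<open>L\<close> grows. Independence never appears as such. For a fixed number of clauses all
  formulas are equally likely, and averaging over one sign is an involution that flips it, which is
  legitimate because nothing below a walk in a tree looks at the clauses of the walk. The halving is
  thus an identity for sums over all tree-like formulas of a given length, and errors are compared
  as such sums before the length is averaged.\<close>

text \<open>
  A walk from variable 1 is the list of the clauses that it uses, the most recent one first;
  it never uses the same clause twice in a row.  Messages of Belief Propagation live on walks,
  and on a tree-like ball walks correspond to the variables of the ball.
\<close>

fun endv :: "formula \<Rightarrow> nat list \<Rightarrow> nat" where
  "endv \<Phi> [] = 1"
| "endv \<Phi> (b # w) = other_var (\<Phi> ! b) (endv \<Phi> w)"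

definition exts :: "formula \<Rightarrow> nat list \<Rightarrow> nat set" where
  "exts \<Phi> w = var_nbrs \<Phi> (endv \<Phi> w) - set (take 1 w)"

fun walk :: "formula \<Rightarrow> nat list \<Rightarrow> bool" where
  "walk \<Phi> [] \<longleftrightarrow> True"
| "walk \<Phi> (b # w) \<longleftrightarrow> b \<in> exts \<Phi> w \<and> walk \<Phi> w"

definition walks :: "formula \<Rightarrow> nat \<Rightarrow> nat list set" where
  "walks \<Phi> k = {w. walk \<Phi> w \<and> length w = k}"

text \<open>Injectivity of the end map stands in for acyclicity: the two ways round a cycle, or two
  clauses on the same pair of variables, give two walks with one end.\<close>

definition treelike :: "nat \<Rightarrow> formula \<Rightarrow> bool" where
  "treelike l \<Phi> \<longleftrightarrow> inj_on (endv \<Phi>) {w. walk \<Phi> w \<and> length w \<le> l}"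

lemma clause_cases:
  assumes "c \<in> all_clauses n"
  obtains x r y s where "c = ((x, r), (y, s))" "x \<in> {1..n}" "y \<in> {1..n}" "x \<noteq> y"
    "r \<in> {1, -1}" "s \<in> {1, -1}"
  using assms unfolding all_clauses_def by blast

lemma clause_facts:
  assumes "c \<in> all_clauses n" "x \<in> clause_vars c"
  shows "clause_vars c = {x, other_var c x}" "other_var c x \<noteq> x"
    "other_var c (other_var c x) = x" "own_sign c (other_var c x) = other_sign c x"
    "other_sign c (other_var c x) = own_sign c x"
    "own_sign c x \<in> {1, -1}" "other_sign c x \<in> {1, -1}" "x \<in> {1..n}" "other_var c x \<in> {1..n}"
    "sat_clause \<sigma> c \<longleftrightarrow> \<sigma> x = own_sign c x \<or> \<sigma> (other_var c x) = other_sign c x"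
  using assms by (auto elim!: clause_cases)

lemma var_nbrs_iff: "a \<in> var_nbrs \<Phi> x \<longleftrightarrow> a < length \<Phi> \<and> x \<in> clause_vars (\<Phi> ! a)"
  by (auto simp: var_nbrs_def edges_def)

lemma finite_var_nbrs [simp]: "finite (var_nbrs \<Phi> x)"
  by (rule finite_subset[of _ "{..<length \<Phi>}"]) (auto simp: var_nbrs_iff)

lemma finite_exts [simp]: "finite (exts \<Phi> w)"
  by (simp add: exts_def)

lemma walk_set: "walk \<Phi> w \<Longrightarrow> set w \<subseteq> {..<length \<Phi>}"
  by (induction w) (auto simp: exts_def var_nbrs_iff)

lemma walk_appendD: "walk \<Phi> (v @ w) \<Longrightarrow> walk \<Phi> w"
  by (induction v) auto

lemma finite_walks [simp]: "finite (walks \<Phi> k)"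
  by (rule finite_subset[OF _ finite_lists_length_eq[of "{..<length \<Phi>}" k]])
    (use walk_set in \<open>auto simp: walks_def\<close>)

lemma walks_0 [simp]: "walks \<Phi> 0 = {[]}"
  by (auto simp: walks_def)

lemma walks_Suc: "walks \<Phi> (Suc k) = (\<lambda>(w, b). b # w) ` (SIGMA w:walks \<Phi> k. exts \<Phi> w)"
  by (auto simp: walks_def length_Suc_conv image_iff)

lemma sum_walks_Suc:
  "(\<Sum>v\<in>walks \<Phi> (Suc k). g v) = (\<Sum>w\<in>walks \<Phi> k. \<Sum>b\<in>exts \<Phi> w. g (b # w))"
proof -
  have "inj_on (\<lambda>(w, b). b # w) (SIGMA w:walks \<Phi> k. exts \<Phi> w)"
    by (auto simp: inj_on_def)
  then show ?thesis
    by (simp add: walks_Suc sum.reindex sum.Sigma case_prod_unfold)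
qed

lemma prod_walks_Suc:
  "(\<Prod>v\<in>walks \<Phi> (Suc k). g v) = (\<Prod>w\<in>walks \<Phi> k. \<Prod>b\<in>exts \<Phi> w. g (b # w))"
proof -
  have "inj_on (\<lambda>(w, b). b # w) (SIGMA w:walks \<Phi> k. exts \<Phi> w)"
    by (auto simp: inj_on_def)
  then show ?thesis
    by (simp add: walks_Suc prod.reindex prod.Sigma case_prod_unfold)
qed

context
  fixes \<Phi> :: formula and n :: nat
  assumes valid: "set \<Phi> \<subseteq> all_clauses n"
begin

lemma nth_valid: "b < length \<Phi> \<Longrightarrow> \<Phi> ! b \<in> all_clauses n"
  using valid nth_mem by blast

lemma exts_facts:
  assumes "b \<in> exts \<Phi> w"
  shows "b < length \<Phi>" "\<Phi> ! b \<in> all_clauses n" "endv \<Phi> w \<in> clause_vars (\<Phi> ! b)"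
    "clause_vars (\<Phi> ! b) = {endv \<Phi> w, endv \<Phi> (b # w)}" "endv \<Phi> (b # w) \<noteq> endv \<Phi> w"
    "b \<notin> set (take 1 w)"
  using assms clause_facts[OF nth_valid] by (auto simp: exts_def var_nbrs_iff nth_valid)

lemma endv_range: "1 \<le> n \<Longrightarrow> walk \<Phi> w \<Longrightarrow> endv \<Phi> w \<in> {1..n}"
  using clause_facts(9)[OF exts_facts(2,3)] by (cases w) auto

text \<open>A clause has only two variables, and \<open>b # w\<close> in \<open>U\<close> accounts
  for both, so injectivity leaves no other walk in \<open>U\<close> that ends at either. A family
  closed under removal of the latest clause, in place of all short walks, also covers trees grown
  inside formulas that are not tree-like.\<close>

lemma clause_in_closed:
  assumes U: "U \<subseteq> Collect (walk \<Phi>)" "\<forall>b w. b # w \<in> U \<longrightarrow> w \<in> U" "inj_on (endv \<Phi>) U"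
    and "b # w \<in> U" "v \<in> U" "endv \<Phi> v \<in> clause_vars (\<Phi> ! b)"
  shows "v = w \<or> v = b # w"
proof -
  have "b \<in> exts \<Phi> w" using U(1) assms(4) by auto
  from exts_facts(4)[OF this] assms(6) have "endv \<Phi> v = endv \<Phi> w \<or> endv \<Phi> v = endv \<Phi> (b # w)"
    by auto
  moreover have "w \<in> U" using U(2) assms(4) by blast
  ultimately show ?thesis using assms(4,5) U(3)
    by (meson inj_onD)
qed

lemma clause_in_closed_eq:
  assumes U: "U \<subseteq> Collect (walk \<Phi>)" "\<forall>b w. b # w \<in> U \<longrightarrow> w \<in> U" "inj_on (endv \<Phi>) U"
    and "b # w \<in> U" "v \<in> U" "walk \<Phi> (b # v)"
  shows "v = w"
proof -
  have b: "b \<in> exts \<Phi> v" using assms(6) by simp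
  from clause_in_closed[OF U assms(4,5) exts_facts(3)[OF b]] exts_facts(6)[OF b]
  show ?thesis by auto
qed

text \<open>A clause used twice would be entered from two walks of different lengths, although
  \<open>clause_in_closed_eq\<close> leaves a single predecessor. Distinct positions are what
  factorial moments count, and they make a sign flip invisible further down.\<close>

lemma walk_distinct:
  assumes "treelike l \<Phi>" "walk \<Phi> w" "length w \<le> l"
  shows "distinct w"
  using assms(2,3)
proof (induction w)
  case (Cons b w)
  let ?U = "{w. walk \<Phi> w \<and> length w \<le> l}"
  have "b \<notin> set w"
  proof
    assume "b \<in> set w"
    then obtain xs u where w: "w = xs @ b # u" by (meson split_list)
    with Cons.prems have "walk \<Phi> (b # u)" by (auto dest: walk_appendD)
    have "w = u"
      by (rule clause_in_closed_eq[of ?U b u w])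
        (use assms(1) Cons.prems \<open>walk \<Phi> (b # u)\<close> w in \<open>auto simp: treelike_def\<close>)
    with w show False by simp
  qed
  with Cons show ?case by simp
qed simp

text \<open>Two colliding walks span a subgraph with a cycle. A maximal subtree \<open>W\<close> of
  it uses one clause fewer than it has variables, and one more walk, which ends in an old variable,
  supplies the missing clause. With as many clauses as variables, and variable 1 prescribed, the
  first moment loses a factor \<open>n\<close>.\<close>

lemma not_treelike_dense:
  assumes "1 \<le> n" "\<not> treelike l \<Phi>"
  obtains V bs where "V \<subseteq> {1..n}" "1 \<in> V" "card V \<le> 2 * l + 1" "distinct bs"
    "length bs = card V" "set bs \<subseteq> {..<length \<Phi>}" "\<forall>b\<in>set bs. clause_vars (\<Phi> ! b) \<subseteq> V"
proof -
  obtain w v where wv: "walk \<Phi> w" "walk \<Phi> v" "length w \<le> l" "length v \<le> l" "w \<noteq> v"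
      "endv \<Phi> w = endv \<Phi> v"
    using assms(2) by (auto simp: treelike_def inj_on_def)
  define U where "U = set (suffixes w) \<union> set (suffixes v)"
  have walkU: "walk \<Phi> u" if "u \<in> U" for u
    using that wv by (auto simp: U_def suffix_def dest: walk_appendD)
  have closedU: "u \<in> U" if "b # u \<in> U" for b u
    using that by (auto simp: U_def suffix_ConsD)
  have "card U \<le> card (set (suffixes w)) + card (set (suffixes v))"
    unfolding U_def by (rule card_Un_le)
  also have "\<dots> \<le> (length w + 1) + (length v + 1)"
    by (intro add_mono order.trans[OF card_length]) simp_all
  finally have cardU: "card U \<le> 2 * l + 2" using wv by simp
  have finU: "finite U" by (simp add: U_def)
  define P where "P = (\<lambda>W. W \<subseteq> U \<and> [] \<in> W \<and> (\<forall>b u. b # u \<in> W \<longrightarrow> u \<in> W) \<and> inj_on (endv \<Phi>) W)"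
  have "finite (Collect P)" by (rule finite_subset[of _ "Pow U"]) (auto simp: P_def finU)
  moreover have "P {[]}" by (auto simp: P_def U_def)
  ultimately obtain W where W: "P W" and max: "\<And>W'. P W' \<Longrightarrow> W \<subseteq> W' \<Longrightarrow> W' = W"
    using finite_has_maximal2[of "Collect P" "{[]}"] by auto
  have WU: "W \<subseteq> U" "[] \<in> W" "\<forall>b u. b # u \<in> W \<longrightarrow> u \<in> W" "inj_on (endv \<Phi>) W"
    using W unfolding P_def by blast+
  have finW: "finite W" using WU(1) finU finite_subset by blast
  have walkW: "W \<subseteq> Collect (walk \<Phi>)" using WU(1) walkU by blast
  have "W \<noteq> U"
  proof
    assume "W = U"
    then have "w \<in> W" "v \<in> W" by (auto simp: U_def)
    with WU(4) wv(5,6) show False by (auto dest: inj_onD)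
  qed
  then obtain x0 where "x0 \<in> U - W" using WU(1) by blast
  \<comment> \<open>A shortest walk outside \<open>W\<close> has its tail in \<open>W\<close>; by
    maximality of \<open>W\<close> its end repeats the end of a member of \<open>W\<close>.\<close>
  then obtain x where x: "x \<in> U - W" and xmin: "\<And>y. y \<in> U - W \<Longrightarrow> length x \<le> length y"
    using arg_min_nat_lemma[of "\<lambda>x. x \<in> U - W" x0 length] by blast
  from x WU(2) obtain b u where xbu: "x = b # u" by (cases x) auto
  with x closedU have "u \<in> U" by blast
  have uW: "u \<in> W" using xmin[of u] \<open>u \<in> U\<close> xbu by fastforce
  have "\<not> inj_on (endv \<Phi>) (insert x W)"
  proof
    assume "inj_on (endv \<Phi>) (insert x W)"
    then have "P (insert x W)" using WU x uW xbu unfolding P_def by auto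
    from max[OF this] x show False by blast
  qed
  then have endx: "endv \<Phi> x \<in> endv \<Phi> ` W" using WU(4) x by (auto simp: inj_on_insert)
  \<comment> \<open>The closing clause is not one of the tree: a tree clause has a unique
    predecessor, which would place \<open>x\<close> in \<open>W\<close>.\<close>
  have b_new: "b \<notin> hd ` (W - {[]})"
  proof
    assume "b \<in> hd ` (W - {[]})"
    then obtain u' where u': "b # u' \<in> W" by (metis DiffE hd_Cons_tl image_iff singletonI)
    have "walk \<Phi> (b # u)" using walkU x xbu by blast
    from clause_in_closed_eq[OF walkW WU(3,4) u' uW this] u' x xbu show False by auto
  qed
  have inj_hd: "inj_on hd (W - {[]})"
  proof (rule inj_onI)
    fix p q assume pq: "p \<in> W - {[]}" "q \<in> W - {[]}" "hd p = hd q"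
    then obtain c p' q' where "p = c # p'" "q = c # q'"
      by (metis DiffE hd_Cons_tl singletonI)
    moreover have "p' = q'"
      by (rule clause_in_closed_eq[OF walkW WU(3,4), of c])
        (use pq calculation WU(3) walkW in auto)
    ultimately show "p = q" using pq(3) by simp
  qed
  define B where "B = insert b (hd ` (W - {[]}))"
  define V where "V = endv \<Phi> ` W"
  have "card W \<ge> 1" using WU(2) finW by (metis One_nat_def Suc_leI card_gt_0_iff empty_iff)
  then have cardB: "card B = card W"
    using b_new finW WU(2) by (simp add: B_def card_image[OF inj_hd])
  \<comment> \<open>Each of the two walks has at most \<open>l + 1\<close> suffixes, so
    \<open>U\<close> has at most \<open>2 * l + 2\<close> members; strictness here gives the bound
    \<open>2 * l + 1\<close>.\<close>
  have "card W < card U" using WU(1) \<open>W \<noteq> U\<close> finU by (simp add: psubset_card_mono psubsetI)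
  have cv: "clause_vars (\<Phi> ! a) \<subseteq> V \<and> a < length \<Phi>" if "a \<in> B" for a
  proof -
    have "a \<in> exts \<Phi> q \<Longrightarrow> q \<in> W \<Longrightarrow> endv \<Phi> (a # q) \<in> V \<Longrightarrow> ?thesis" for q
      using exts_facts(1,4)[of a q] by (auto simp: V_def)
    moreover have "\<exists>q\<in>W. a \<in> exts \<Phi> q \<and> endv \<Phi> (a # q) \<in> V"
    proof (cases "a = b")
      case True
      with endx xbu uW walkU[of x] x show ?thesis unfolding V_def by auto
    next
      case False
      with that obtain q where q: "a # q \<in> W" unfolding B_def
        by (metis DiffE hd_Cons_tl image_iff insertE singletonI)
      then have "q \<in> W" "walk \<Phi> (a # q)" using WU(3) walkW by blast+
      moreover from q have "endv \<Phi> (a # q) \<in> V" unfolding V_def by (rule imageI)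
      ultimately show ?thesis by auto
    qed
    ultimately show ?thesis by blast
  qed
  have finB: "finite B" by (simp add: B_def finW)
  obtain bs where bs: "set bs = B" "distinct bs" using finite_distinct_list[OF finB] by blast
  show thesis
  proof (rule that)
    show "V \<subseteq> {1..n}" using endv_range[OF assms(1)] walkW unfolding V_def by blast
    show "1 \<in> V" using WU(2) unfolding V_def by (metis endv.simps(1) image_eqI)
    have "card V = card W" unfolding V_def by (rule card_image[OF WU(4)])
    then show "card V \<le> 2 * l + 1" "length bs = card V"
      using cardU \<open>card W < card U\<close> cardB bs distinct_card[OF bs(2)] by auto
    show "distinct bs" "set bs \<subseteq> {..<length \<Phi>}"
      "\<forall>a\<in>set bs. clause_vars (\<Phi> ! a) \<subseteq> V" using bs cv by auto
  qed
qed

section \<open>Distances in the factor graph in terms of walks\<close>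

lemma walk_reaches:
  "walk \<Phi> w \<Longrightarrow> (Variable 1, Variable (endv \<Phi> w)) \<in> edges \<Phi> ^^ (2 * length w)"
proof (induction w)
  case (Cons b w)
  then have b: "b \<in> exts \<Phi> w" by simp
  have "(Variable (endv \<Phi> w), Clause b) \<in> edges \<Phi>"
    "(Clause b, Variable (endv \<Phi> (b # w))) \<in> edges \<Phi>"
    using exts_facts[OF b] by (auto simp: edges_def)
  with Cons show ?case by auto
qed simp

text \<open>A path in the factor graph may turn back at a clause, which a walk may not. Dropping
  such turns only shortens it, hence an inequality for the length. The induction carries both kinds
  of vertices, variables after an even and clauses after an odd number of steps.\<close>

lemma reaches_walk:
  assumes "(Variable 1, u) \<in> edges \<Phi> ^^ k"
  shows "(\<forall>y. u = Variable y \<longrightarrow> (\<exists>w. walk \<Phi> w \<and> 2 * length w \<le> k \<and> even k \<and> endv \<Phi> w = y)) \<and>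
    (\<forall>b. u = Clause b \<longrightarrow> (\<exists>w. walk \<Phi> w \<and> 2 * length w < k \<and> odd k \<and> b < length \<Phi> \<and>
        endv \<Phi> w \<in> clause_vars (\<Phi> ! b)))"
  using assms
proof (induction k arbitrary: u)
  case 0
  then show ?case by (auto intro: exI[of _ "[]"])
next
  case (Suc k)
  then obtain z where z: "(Variable 1, z) \<in> edges \<Phi> ^^ k" "(z, u) \<in> edges \<Phi>" by auto
  show ?case
  proof (cases z)
    case (Variable y)
    with Suc.IH[OF z(1)] obtain w where "walk \<Phi> w \<and> 2 * length w \<le> k \<and> even k \<and> endv \<Phi> w = y"
      by blast
    with z(2) Variable show ?thesis by (auto simp: edges_def intro!: exI[of _ w])
  next
    case (Clause b)
    with Suc.IH[OF z(1)] obtain w where w: "walk \<Phi> w" "2 * length w < k" "odd k" "b < length \<Phi>"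
        "endv \<Phi> w \<in> clause_vars (\<Phi> ! b)" by blast
    from z(2) Clause obtain y where y: "u = Variable y" "y \<in> clause_vars (\<Phi> ! b)"
      by (auto simp: edges_def)
    have "\<exists>w'. walk \<Phi> w' \<and> length w' \<le> Suc (length w) \<and> endv \<Phi> w' = y"
    proof (cases "b \<in> set (take 1 w)")
      case True
      then obtain w0 where w0: "w = b # w0" by (cases w) auto
      then have "b \<in> exts \<Phi> w0" using w(1) by simp
      from exts_facts(4)[OF this] y(2) w0 have "y = endv \<Phi> w0 \<or> y = endv \<Phi> w" by auto
      with w(1) w0 show ?thesis by (metis Suc_n_not_le_n le_SucI length_Cons nat_le_linear walk.simps(2))
    next
      case False
      with w have b: "b \<in> exts \<Phi> w" by (simp add: exts_def var_nbrs_iff)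
      from exts_facts(4)[OF this] y(2) have "y = endv \<Phi> w \<or> y = endv \<Phi> (b # w)" by auto
      moreover have "walk \<Phi> (b # w)" using b w(1) by simp
      ultimately show ?thesis using w(1) by (metis le_SucI length_Cons order_refl)
    qed
    then obtain w' where "walk \<Phi> w'" "length w' \<le> Suc (length w)" "endv \<Phi> w' = y" by blast
    with w(2,3) y show ?thesis by (intro conjI) (auto intro!: exI[of _ w'])
  qed
qed

lemma sphere_treelike:
  assumes "treelike l \<Phi>"
  shows "{y. Variable y \<in> sphere \<Phi> (2 * l) (Variable 1)} = endv \<Phi> ` walks \<Phi> l"
proof (intro equalityI subsetI)
  fix y assume "y \<in> {y. Variable y \<in> sphere \<Phi> (2 * l) (Variable 1)}"
  then have y: "(Variable 1, Variable y) \<in> edges \<Phi> ^^ (2 * l)"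
    "\<And>k. k < 2 * l \<Longrightarrow> (Variable 1, Variable y) \<notin> edges \<Phi> ^^ k"
    by (auto simp: sphere_def)
  from reaches_walk[OF y(1)] obtain w where w: "walk \<Phi> w" "2 * length w \<le> 2 * l" "endv \<Phi> w = y"
    by blast
  have "\<not> 2 * length w < 2 * l"
    using walk_reaches[OF w(1)] w(3) y(2) by blast
  with w(2) have "length w = l" by linarith
  with w show "y \<in> endv \<Phi> ` walks \<Phi> l" by (auto simp: walks_def)
next
  fix y assume "y \<in> endv \<Phi> ` walks \<Phi> l"
  then obtain w where w: "walk \<Phi> w" "length w = l" "endv \<Phi> w = y" by (auto simp: walks_def)
  have "(Variable 1, Variable y) \<notin> edges \<Phi> ^^ k" if "k < 2 * l" for k
  proof
    assume "(Variable 1, Variable y) \<in> edges \<Phi> ^^ k"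
    from reaches_walk[OF this] obtain v where v: "walk \<Phi> v" "2 * length v \<le> k" "endv \<Phi> v = y"
      by blast
    then have "v = w" using assms w that by (auto simp: treelike_def inj_on_def)
    with v w that show False by simp
  qed
  with walk_reaches[OF w(1)] w show "y \<in> {y. Variable y \<in> sphere \<Phi> (2 * l) (Variable 1)}"
    by (auto simp: sphere_def)
qed

end

section \<open>Belief Propagation as a weight recursion\<close>

text \<open>
  \<open>wt \<Phi> \<theta> j w t\<close> counts the satisfying assignments of the \<open>j\<close> levels below the end of \<open>w\<close> that give
  this end the value \<open>t\<close>, where \<open>\<theta>\<close> weighs the values at the bottom.  Constant \<open>\<theta>\<close> yields Belief
  Propagation, and \<open>\<theta> = pin \<Phi> \<tau>\<close> the marginals given the boundary values of \<open>\<tau>\<close>.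
\<close>

fun wt :: "formula \<Rightarrow> (nat list \<Rightarrow> int \<Rightarrow> real) \<Rightarrow> nat \<Rightarrow> nat list \<Rightarrow> int \<Rightarrow> real" where
  "wt \<Phi> \<theta> 0 w t = \<theta> w t"
| "wt \<Phi> \<theta> (Suc j) w t =
     (\<Prod>b\<in>exts \<Phi> w.
        if own_sign (\<Phi> ! b) (endv \<Phi> w) = t then wt \<Phi> \<theta> j (b # w) 1 + wt \<Phi> \<theta> j (b # w) (-1)
        else wt \<Phi> \<theta> j (b # w) (other_sign (\<Phi> ! b) (endv \<Phi> w)))"

lemma wt_nonneg: "(\<And>w t. \<theta> w t \<ge> 0) \<Longrightarrow> wt \<Phi> \<theta> j w t \<ge> 0"
  by (induction j arbitrary: w t) (auto intro!: prod_nonneg)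

lemma wt_pos: "(\<And>w t. \<theta> w t > 0) \<Longrightarrow> wt \<Phi> \<theta> j w t > 0"
  by (induction j arbitrary: w t) (auto intro!: prod_pos add_pos_pos)

text \<open>The definition peels off the root; here the lowest level is absorbed into \<theta>,
  which is the order in which leaves are summed out.\<close>

lemma wt_Suc_inner: "wt \<Phi> \<theta> (Suc j) w t = wt \<Phi> (wt \<Phi> \<theta> 1) j w t"
proof (induction j arbitrary: w t)
  case (Suc j)
  show ?case by (subst (1 2) wt.simps(2)) (simp only: Suc.IH)
qed simp

lemma normalized_scale:
  assumes "f 1 = c * g 1" "f (-1) = c * g (-1)" "t \<in> {1, -1}" "c \<noteq> 0" "g 1 + g (-1) \<noteq> 0"
  shows "normalized f t = g t / (g 1 + g (-1))"
proof -
  have "f 1 + f (-1) = c * (g 1 + g (-1))" using assms by (simp add: algebra_simps)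
  then show ?thesis using assms by (auto simp: normalized_def)
qed

context
  fixes \<Phi> :: formula and n :: nat
  assumes valid: "set \<Phi> \<subseteq> all_clauses n"
begin

abbreviation "free \<equiv> wt \<Phi> (\<lambda>_ _. 1)"

lemma free_pos: "free j w t > 0"
  by (rule wt_pos) simp

text \<open>The numerator is the factor of \<open>b\<close> in the weight recursion. The denominator
  does not depend on \<open>t\<close>, so it cancels when the product over the clauses is
  normalized.\<close>

lemma msg_cv_free:
  assumes "b \<in> exts \<Phi> w" "t \<in> {1, -1}"
    and "\<And>s. s \<in> {1, -1} \<Longrightarrow> msg_vc \<Phi> j (endv \<Phi> (b # w)) b s = 
      free j (b # w) s / (free j (b # w) 1 + free j (b # w) (-1))"
  shows "msg_cv \<Phi> (Suc j) b (endv \<Phi> w) t =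
    (if own_sign (\<Phi> ! b) (endv \<Phi> w) = t then free j (b # w) 1 + free j (b # w) (-1)
        else free j (b # w) (other_sign (\<Phi> ! b) (endv \<Phi> w))) / 
    (free j (b # w) 1 + free j (b # w) (-1) + free j (b # w) (other_sign (\<Phi> ! b) (endv \<Phi> w)))"
proof -
  define s where "s = other_sign (\<Phi> ! b) (endv \<Phi> w)"
  have s: "s \<in> {1, -1}"
    using clause_facts(7) exts_facts[OF valid assms(1)] unfolding s_def by blast
  then have s': "- s \<in> {1, -1}" by auto
  define T where "T = free j (b # w) 1 + free j (b # w) (-1)"
  have T: "T > 0" using free_pos unfolding T_def by (simp add: add_pos_pos)
  have sum: "free j (b # w) s + free j (b # w) (- s) = T" using s by (auto simp: T_def)
  have ms: "msg_vc \<Phi> j (other_var (\<Phi> ! b) (endv \<Phi> w)) b s = free j (b # w) s / T"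
     "msg_vc \<Phi> j (other_var (\<Phi> ! b) (endv \<Phi> w)) b (- s) = free j (b # w) (- s) / T"
    using assms(3)[OF s] assms(3)[OF s'] by (simp_all add: T_def)
  \<comment> \<open>One minus the message at \<open>- s\<close> is the message at \<open>s\<close>,
    and the total \<open>T\<close> clears both fractions.\<close>
  have den: "1 + free j (b # w) s / T = (T + free j (b # w) s) / T"
    "1 - free j (b # w) (- s) / T = free j (b # w) s / T"
    using T sum by (simp_all add: field_simps)
  have "msg_cv \<Phi> (Suc j) b (endv \<Phi> w) t = 
     (1 - of_bool (own_sign (\<Phi> ! b) (endv \<Phi> w) \<noteq> t) * (free j (b # w) (- s) / T)) / (1 + free j (b # w) s / T)"
    by (simp add: Let_def ms flip: s_def)
  also have "\<dots> = (if own_sign (\<Phi> ! b) (endv \<Phi> w) = t then T else free j (b # w) s) / (T + free j (b # w) s)"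
    using T by (simp add: den)
  finally show ?thesis by (simp add: s_def T_def)
qed

lemma prod_msg_cv_free:
  assumes "t \<in> {1, -1}" 
    and "\<And>b s. b \<in> exts \<Phi> w \<Longrightarrow> s \<in> {1, -1} \<Longrightarrow> msg_vc \<Phi> j (endv \<Phi> (b # w)) b s = 
      free j (b # w) s / (free j (b # w) 1 + free j (b # w) (-1))"
  shows "normalized (\<lambda>t. \<Prod>b\<in>exts \<Phi> w. msg_cv \<Phi> (Suc j) b (endv \<Phi> w) t) t =
    free (Suc j) w t / (free (Suc j) w 1 + free (Suc j) w (-1))"
proof -
  define c where "c = (\<Prod>b\<in>exts \<Phi> w. 1 / (free j (b # w) 1 + free j (b # w) (-1) + 
     free j (b # w) (other_sign (\<Phi> ! b) (endv \<Phi> w))))"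
  have "c > 0" unfolding c_def by (intro prod_pos) (simp add: free_pos add_pos_pos)
  have "(\<Prod>b\<in>exts \<Phi> w. msg_cv \<Phi> (Suc j) b (endv \<Phi> w) t) = c * free (Suc j) w t" if "t \<in> {1, -1}" for t
    unfolding c_def wt.simps prod.distrib[symmetric]
  proof (rule prod.cong[OF refl])
    fix b assume "b \<in> exts \<Phi> w"
    from msg_cv_free[OF this that assms(2)[OF this]]
    show "msg_cv \<Phi> (Suc j) b (endv \<Phi> w) t = 1 / (free j (b # w) 1 + free j (b # w) (-1) + 
     free j (b # w) (other_sign (\<Phi> ! b) (endv \<Phi> w))) * 
      (if own_sign (\<Phi> ! b) (endv \<Phi> w) = t then free j (b # w) 1 + free j (b # w) (-1)
        else free j (b # w) (other_sign (\<Phi> ! b) (endv \<Phi> w)))" by simp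
  qed
  with \<open>c > 0\<close> assms(1) free_pos[of "Suc j" w] show ?thesis
    by (intro normalized_scale[where c = c]) (auto simp: add_pos_pos less_imp_neq[symmetric] simp del: wt.simps)
qed

lemma msg_vc_free:
  assumes "t \<in> {1, -1}"
  shows "msg_vc \<Phi> j (endv \<Phi> (a # w)) a t =
    free j (a # w) t / (free j (a # w) 1 + free j (a # w) (-1))"
  using assms
proof (induction j arbitrary: a w t)
  case (Suc j)
  have "var_nbrs \<Phi> (endv \<Phi> (a # w)) - {a} = exts \<Phi> (a # w)" by (simp add: exts_def)
  with prod_msg_cv_free[OF Suc.prems Suc.IH, of "a # w"] show ?case
    by (simp only: msg_vc.simps)
qed simp

lemma bp_marginal_free:
  assumes "t \<in> {1, -1}"
  shows "bp_marginal \<Phi> (Suc j) 1 t = free (Suc j) [] t / (free (Suc j) [] 1 + free (Suc j) [] (-1))"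
proof -
  have "var_nbrs \<Phi> 1 = exts \<Phi> []" by (simp add: exts_def)
  with prod_msg_cv_free[OF assms msg_vc_free, of "[]"] show ?thesis
    by (simp only: bp_marginal_def endv.simps)
qed

end

definition pin :: "formula \<Rightarrow> (nat \<Rightarrow> int) \<Rightarrow> nat list \<Rightarrow> int \<Rightarrow> real" where
  "pin \<Phi> \<tau> w t = of_bool (\<tau> (endv \<Phi> w) = t)"

lemma pin_nonneg: "pin \<Phi> \<tau> w t \<ge> 0" by (simp add: pin_def)

text \<open>Reading \<tau> along the walks below \<open>w\<close> gives one of the assignments
  counted. The opposite value may have weight zero, since a boundary condition can force a
  value.\<close>

lemma wt_pin_pos:
  assumes valid: "set \<Phi> \<subseteq> all_clauses n" and "\<tau> \<in> sat_assignments n \<Phi>" "1 \<le> n"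
  shows "walk \<Phi> w \<Longrightarrow> wt \<Phi> (pin \<Phi> \<tau>) j w (\<tau> (endv \<Phi> w)) > 0"
proof (induction j arbitrary: w)
  case (Suc j)
  show ?case
  proof (simp only: wt.simps, intro prod_pos)
    fix b assume b: "b \<in> exts \<Phi> w"
    let ?v = "b # w"
    have IH: "wt \<Phi> (pin \<Phi> \<tau>) j ?v (\<tau> (endv \<Phi> ?v)) > 0" using Suc.prems b by (intro Suc.IH) simp
    have "endv \<Phi> ?v \<in> {1..n}" by (rule endv_range[OF valid]) (use assms b Suc.prems in auto)
    then have "\<tau> (endv \<Phi> ?v) \<in> {1, -1}" using assms(2) by (auto simp: sat_assignments_def)
    with IH wt_nonneg[of "pin \<Phi> \<tau>" \<Phi> j ?v] pin_nonneg
    have sum: "wt \<Phi> (pin \<Phi> \<tau>) j ?v 1 + wt \<Phi> (pin \<Phi> \<tau>) j ?v (-1) > 0"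
      by (auto intro: add_pos_nonneg add_nonneg_pos)
    have "sat_clause \<tau> (\<Phi> ! b)" using assms(2) exts_facts(1)[OF valid b] by (simp add: sat_assignments_def)
    then have "\<tau> (endv \<Phi> w) = own_sign (\<Phi> ! b) (endv \<Phi> w) \<or> \<tau> (endv \<Phi> ?v) = other_sign (\<Phi> ! b) (endv \<Phi> w)"
      using clause_facts(10)[OF exts_facts(2,3)[OF valid b]] by simp
    with sum IH show "0 < (if own_sign (\<Phi> ! b) (endv \<Phi> w) = \<tau> (endv \<Phi> w)
                then wt \<Phi> (pin \<Phi> \<tau>) j (b # w) 1 + wt \<Phi> (pin \<Phi> \<tau>) j (b # w) (- 1)
                else wt \<Phi> (pin \<Phi> \<tau>) j (b # w) (other_sign (\<Phi> ! b) (endv \<Phi> w)))" by auto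
  qed
qed (simp add: pin_def)

lemma bij_PiE_Un:
  assumes "A \<inter> B = {}"
  shows "bij_betw (\<lambda>(\<sigma>, \<rho>) x. if x \<in> A then \<sigma> x else \<rho> x)
     ((A \<rightarrow>\<^sub>E C) \<times> (B \<rightarrow>\<^sub>E C)) (A \<union> B \<rightarrow>\<^sub>E C)"
proof (rule bij_betwI[where g = "\<lambda>f. (restrict f A, restrict f B)"])
  show "(\<lambda>(\<sigma>, \<rho>) x. if x \<in> A then \<sigma> x else \<rho> x) \<in> (A \<rightarrow>\<^sub>E C) \<times> (B \<rightarrow>\<^sub>E C) \<rightarrow> (A \<union> B \<rightarrow>\<^sub>E C)"
    by (auto simp: PiE_iff extensional_def)
  show "(\<lambda>f. (restrict f A, restrict f B)) \<in> (A \<union> B \<rightarrow>\<^sub>E C) \<rightarrow> (A \<rightarrow>\<^sub>E C) \<times> (B \<rightarrow>\<^sub>E C)"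
    by (auto simp: PiE_iff)
  show "(\<lambda>f. (restrict f A, restrict f B)) ((\<lambda>(\<sigma>, \<rho>) x. if x \<in> A then \<sigma> x else \<rho> x) p) = p"
    if "p \<in> (A \<rightarrow>\<^sub>E C) \<times> (B \<rightarrow>\<^sub>E C)" for p
    using that assms by (fastforce simp: PiE_iff extensional_def restrict_def fun_eq_iff)
  show "(\<lambda>(\<sigma>, \<rho>) x. if x \<in> A then \<sigma> x else \<rho> x) ((\<lambda>f. (restrict f A, restrict f B)) f) = f"
    if "f \<in> (A \<union> B \<rightarrow>\<^sub>E C)" for f
    using that by (auto simp: PiE_iff extensional_def restrict_def fun_eq_iff)
qed

lemma sum_PiE_Un:
  assumes "A \<inter> B = {}"
  shows "(\<Sum>f\<in>A \<union> B \<rightarrow>\<^sub>E C. g f) =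
    (\<Sum>\<sigma>\<in>A \<rightarrow>\<^sub>E C. \<Sum>\<rho>\<in>B \<rightarrow>\<^sub>E C. g (\<lambda>x. if x \<in> A then \<sigma> x else \<rho> x))"
  unfolding sum.cartesian_product
  using sum.reindex_bij_betw[OF bij_PiE_Un[OF assms], of g C] by (simp add: case_prod_unfold)

section \<open>Conditional marginals on tree-like balls\<close>

lemma prod_of_bool: "finite A \<Longrightarrow> (\<Prod>a\<in>A. of_bool (P a) :: real) = of_bool (\<forall>a\<in>A. P a)"
  by (induction A rule: finite_induct) auto

text \<open>Injectivity of \<open>e\<close> lets the variables of one level be indexed by walks, so
  that the sum over their values factorizes walk by walk.\<close>

lemma sum_PiE_prod_inj:
  assumes "finite W" "inj_on e W" "finite C"
  shows "(\<Sum>\<rho>\<in>e ` W \<rightarrow>\<^sub>E C. \<Prod>v\<in>W. g v (\<rho> (e v))) = (\<Prod>v\<in>W. \<Sum>s\<in>C. g v s :: real)"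
proof -
  have "(\<Prod>v\<in>W. \<Sum>s\<in>C. g v s) = (\<Prod>x\<in>e ` W. \<Sum>s\<in>C. g (inv_into W e x) s)"
    by (simp add: prod.reindex[OF assms(2)] inv_into_f_f[OF assms(2)])
  also have "\<dots> = (\<Sum>\<rho>\<in>e ` W \<rightarrow>\<^sub>E C. \<Prod>x\<in>e ` W. g (inv_into W e x) (\<rho> x))"
    using assms by (intro prod_sum_PiE) auto
  also have "\<dots> = (\<Sum>\<rho>\<in>e ` W \<rightarrow>\<^sub>E C. \<Prod>v\<in>W. g v (\<rho> (e v)))"
    by (simp add: prod.reindex[OF assms(2)] inv_into_f_f[OF assms(2)])
  finally show ?thesis by simp
qed

lemma finite_sat_assignments: "finite (sat_assignments n \<Phi>)"
  by (rule finite_subset[of _ "{1..n} \<rightarrow>\<^sub>E {1, -1}"]) (auto simp: sat_assignments_def intro!: finite_PiE)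

definition ball_vars :: "formula \<Rightarrow> nat \<Rightarrow> nat set" where
  "ball_vars \<Phi> i = endv \<Phi> ` {w. walk \<Phi> w \<and> length w \<le> i}"

lemma ball_vars_Suc: "ball_vars \<Phi> (Suc i) = ball_vars \<Phi> i \<union> endv \<Phi> ` walks \<Phi> (Suc i)"
  by (auto simp: ball_vars_def walks_def le_Suc_eq)

lemma ball_varsI: "walk \<Phi> w \<Longrightarrow> length w \<le> i \<Longrightarrow> endv \<Phi> w \<in> ball_vars \<Phi> i"
  by (auto simp: ball_vars_def)

lemma one_in_ball_vars: "1 \<in> ball_vars \<Phi> i"
  using ball_varsI[of \<Phi> "[]"] by simp

context
  fixes \<Phi> :: formula and n l :: nat
  assumes valid: "set \<Phi> \<subseteq> all_clauses n" and n: "1 \<le> n" and tree: "treelike l \<Phi>"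
begin

lemma inj_endv_walks: "i \<le> l \<Longrightarrow> inj_on (endv \<Phi>) (walks \<Phi> i)"
  using tree unfolding treelike_def by (rule inj_on_subset) (auto simp: walks_def)

lemma ball_vars_disjoint: "i < l \<Longrightarrow> ball_vars \<Phi> i \<inter> endv \<Phi> ` walks \<Phi> (Suc i) = {}"
  using tree unfolding treelike_def inj_on_def ball_vars_def walks_def by fastforce

lemma sat_clause_cong:
  assumes "b \<in> exts \<Phi> w" "\<sigma> (endv \<Phi> w) = \<sigma>' (endv \<Phi> w)" "\<sigma> (endv \<Phi> (b # w)) = \<sigma>' (endv \<Phi> (b # w))"
  shows "sat_clause \<sigma> (\<Phi> ! b) \<longleftrightarrow> sat_clause \<sigma>' (\<Phi> ! b)"
  using clause_facts(10)[OF exts_facts(2,3)[OF valid assms(1)]] assms by simp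

text \<open>
  The leaves of the tree are summed out one level at a time, from the bottom to the root.
\<close>

lemma level_elimination:
  assumes "i \<le> l" "t \<in> {1, -1}"
  shows "(\<Sum>\<sigma>\<in>ball_vars \<Phi> i \<rightarrow>\<^sub>E {1, -1}. of_bool (\<sigma> 1 = t) *
      (\<Prod>j\<in>{1..i}. \<Prod>v\<in>walks \<Phi> j. of_bool (sat_clause \<sigma> (\<Phi> ! hd v))) *
      (\<Prod>v\<in>walks \<Phi> i. \<theta> v (\<sigma> (endv \<Phi> v)))) = wt \<Phi> \<theta> i [] t"
  using assms(1)
proof (induction i arbitrary: \<theta>)
  case 0
  have b0: "ball_vars \<Phi> 0 = {1}" by (auto simp: ball_vars_def image_iff intro!: exI[of _ "[]"])
  have "(\<Sum>\<sigma>\<in>endv \<Phi> ` {[]} \<rightarrow>\<^sub>E {1, -1}. \<Prod>v\<in>{[]}. of_bool (\<sigma> (endv \<Phi> v) = t) * \<theta> v (\<sigma> (endv \<Phi> v))) =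
      (\<Prod>v\<in>{[]}. \<Sum>s\<in>{1, -1}. of_bool (s = t) * \<theta> v s)"
    by (rule sum_PiE_prod_inj[where g = "\<lambda>v s. of_bool (s = t) * \<theta> v s"]) auto
  then show ?case using assms(2) unfolding b0 by auto
next
  case (Suc i)
  let ?C = "{1, -1} :: int set"
  let ?P = "\<lambda>\<sigma>. of_bool (\<sigma> 1 = t) *
      (\<Prod>j\<in>{1..i}. \<Prod>v\<in>walks \<Phi> j. of_bool (sat_clause \<sigma> (\<Phi> ! hd v))) :: real"
  let ?h = "\<lambda>\<sigma> v s. of_bool (\<sigma> (endv \<Phi> (tl v)) = own_sign (\<Phi> ! hd v) (endv \<Phi> (tl v)) \<or>
      s = other_sign (\<Phi> ! hd v) (endv \<Phi> (tl v))) * \<theta> v s"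
  \<comment> \<open>Clauses of upper levels see only \<sigma>. A clause of the lowest level sees
    \<sigma> at its upper and \<rho> at its lower variable, because the new variables are disjoint
    from the ball above.\<close>
  have key: "?P (\<lambda>x. if x \<in> ball_vars \<Phi> i then \<sigma> x else \<rho> x) *
      (\<Prod>v\<in>walks \<Phi> (Suc i). of_bool (sat_clause (\<lambda>x. if x \<in> ball_vars \<Phi> i then \<sigma> x else \<rho> x) (\<Phi> ! hd v))
         * \<theta> v (if endv \<Phi> v \<in> ball_vars \<Phi> i then \<sigma> (endv \<Phi> v) else \<rho> (endv \<Phi> v))) =
     ?P \<sigma> * (\<Prod>v\<in>walks \<Phi> (Suc i). ?h \<sigma> v (\<rho> (endv \<Phi> v)))" for \<sigma> \<rho>
  proof (intro arg_cong2[where f = "(*)"] prod.cong refl)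
    show "of_bool ((if 1 \<in> ball_vars \<Phi> i then \<sigma> 1 else \<rho> 1) = t) = (of_bool (\<sigma> 1 = t) :: real)"
      using one_in_ball_vars by simp
  next
    fix j v assume j: "j \<in> {1..i}" "v \<in> walks \<Phi> j"
    then obtain b w where v: "v = b # w" by (cases v) (auto simp: walks_def)
    with j have b: "b \<in> exts \<Phi> w" "walk \<Phi> w" "length w \<le> i" by (auto simp: walks_def)
    have "endv \<Phi> w \<in> ball_vars \<Phi> i" "endv \<Phi> (b # w) \<in> ball_vars \<Phi> i"
      by (rule ball_varsI; use b j v in \<open>auto simp: walks_def\<close>)+
    then show "of_bool (sat_clause (\<lambda>x. if x \<in> ball_vars \<Phi> i then \<sigma> x else \<rho> x) (\<Phi> ! hd v)) =
        (of_bool (sat_clause \<sigma> (\<Phi> ! hd v)) :: real)"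
      using sat_clause_cong[OF b(1), of "\<lambda>x. if x \<in> ball_vars \<Phi> i then \<sigma> x else \<rho> x" \<sigma>] v by simp
  next
    fix v assume vS: "v \<in> walks \<Phi> (Suc i)"
    then obtain b w where v: "v = b # w" by (cases v) (auto simp: walks_def)
    with vS have b: "b \<in> exts \<Phi> w" "walk \<Phi> w" "length w = i" by (auto simp: walks_def)
    have e: "endv \<Phi> w \<in> ball_vars \<Phi> i" by (rule ball_varsI) (use b in auto)
    have e': "endv \<Phi> v \<notin> ball_vars \<Phi> i" using ball_vars_disjoint[of i] Suc.prems vS by auto
    from e' v have e'': "other_var (\<Phi> ! b) (endv \<Phi> w) \<notin> ball_vars \<Phi> i" by simp
    show "of_bool (sat_clause (\<lambda>x. if x \<in> ball_vars \<Phi> i then \<sigma> x else \<rho> x) (\<Phi> ! hd v)) =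
        (of_bool (\<sigma> (endv \<Phi> (tl v)) = own_sign (\<Phi> ! hd v) (endv \<Phi> (tl v)) \<or>
         \<rho> (endv \<Phi> v) = other_sign (\<Phi> ! hd v) (endv \<Phi> (tl v))) :: real)"
      using clause_facts(10)[OF exts_facts(2,3)[OF valid b(1)]] v e e'' by simp
    show "\<theta> v (if endv \<Phi> v \<in> ball_vars \<Phi> i then \<sigma> (endv \<Phi> v) else \<rho> (endv \<Phi> v)) = \<theta> v (\<rho> (endv \<Phi> v))"
      using e' by simp
  qed
  \<comment> \<open>If the parent satisfies the clause then the leaf is free, otherwise it must take
    its sign: this is one step of \<open>wt\<close>.\<close>
  have leaf: "(\<Sum>s\<in>?C. ?h \<sigma> (b # w) s) = 
     (if own_sign (\<Phi> ! b) (endv \<Phi> w) = \<sigma> (endv \<Phi> w) then \<theta> (b # w) 1 + \<theta> (b # w) (-1)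
        else \<theta> (b # w) (other_sign (\<Phi> ! b) (endv \<Phi> w)))" if "b \<in> exts \<Phi> w" for \<sigma> b w
    using clause_facts(7)[OF exts_facts(2,3)[OF valid that]] by auto
  have "(\<Sum>\<sigma>\<in>ball_vars \<Phi> (Suc i) \<rightarrow>\<^sub>E ?C. of_bool (\<sigma> 1 = t) *
      (\<Prod>j\<in>{1..Suc i}. \<Prod>v\<in>walks \<Phi> j. of_bool (sat_clause \<sigma> (\<Phi> ! hd v))) *
      (\<Prod>v\<in>walks \<Phi> (Suc i). \<theta> v (\<sigma> (endv \<Phi> v)))) = 
    (\<Sum>\<sigma>\<in>ball_vars \<Phi> (Suc i) \<rightarrow>\<^sub>E ?C. ?P \<sigma> *
      (\<Prod>v\<in>walks \<Phi> (Suc i). of_bool (sat_clause \<sigma> (\<Phi> ! hd v)) * \<theta> v (\<sigma> (endv \<Phi> v))))"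
    by (simp add: prod.distrib mult_ac)
  also have "\<dots> = (\<Sum>\<sigma>\<in>ball_vars \<Phi> i \<rightarrow>\<^sub>E ?C. \<Sum>\<rho>\<in>endv \<Phi> ` walks \<Phi> (Suc i) \<rightarrow>\<^sub>E ?C. 
      ?P \<sigma> * (\<Prod>v\<in>walks \<Phi> (Suc i). ?h \<sigma> v (\<rho> (endv \<Phi> v))))"
    unfolding ball_vars_Suc sum_PiE_Un[OF ball_vars_disjoint[OF Suc_le_lessD[OF Suc.prems]]] key ..
  also have "\<dots> = (\<Sum>\<sigma>\<in>ball_vars \<Phi> i \<rightarrow>\<^sub>E ?C. ?P \<sigma> * (\<Prod>v\<in>walks \<Phi> (Suc i). \<Sum>s\<in>?C. ?h \<sigma> v s))"
    unfolding sum_distrib_left[symmetric]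
    by (subst sum_PiE_prod_inj[OF finite_walks inj_endv_walks[OF Suc.prems]]) simp_all
  also have "\<dots> = (\<Sum>\<sigma>\<in>ball_vars \<Phi> i \<rightarrow>\<^sub>E ?C. ?P \<sigma> * (\<Prod>w\<in>walks \<Phi> i. wt \<Phi> \<theta> 1 w (\<sigma> (endv \<Phi> w))))"
    unfolding prod_walks_Suc
    by (intro sum.cong refl arg_cong2[where f = "(*)"] prod.cong)
      (simp only: leaf One_nat_def wt.simps cong: prod.cong)
  also have "\<dots> = wt \<Phi> \<theta> (Suc i) [] t"
    unfolding wt_Suc_inner by (rule Suc.IH) (use Suc.prems in simp)
  finally show ?case .
qed

text \<open>A clause outside the tree meets the ball only in boundary variables, and these carry the
  values of \<tau>. The count therefore splits into a factor \<open>K\<close> for the outside, the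
  same for both values at the root, and the weight of the tree.\<close>

lemma card_pinned:
  assumes \<tau>: "\<tau> \<in> sat_assignments n \<Phi>"
  shows "\<exists>K. \<forall>t\<in>{1, -1}.
    real (card {\<sigma> \<in> sat_assignments n \<Phi>. (\<forall>y\<in>endv \<Phi> ` walks \<Phi> l. \<sigma> y = \<tau> y) \<and> \<sigma> 1 = t}) =
    K * wt \<Phi> (pin \<Phi> \<tau>) l [] t"
proof -
  let ?C = "{1, -1} :: int set"
  let ?U = "ball_vars \<Phi> l"
  define R where "R = {1..n} - ?U"
  have U: "?U \<subseteq> {1..n}" using endv_range[OF valid n] by (auto simp: ball_vars_def)
  \<comment> \<open>Clauses not crossed inside the ball, a crossed clause being one that extends
    some walk of length below \<open>l\<close>.\<close>
  define rest where "rest = {b. b < length \<Phi> \<and> (\<forall>w. walk \<Phi> (b # w) \<longrightarrow> l \<le> length w)}"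
  define ok where "ok = (\<lambda>\<rho>. \<forall>b\<in>rest. sat_clause (\<lambda>x. if x \<in> ?U then \<tau> x else \<rho> x) (\<Phi> ! b))"
  let ?m = "\<lambda>\<sigma> \<rho> x. if x \<in> ?U then \<sigma> x else \<rho> x :: int"
  have split: "(\<forall>b<length \<Phi>. sat_clause (?m \<sigma> \<rho>) (\<Phi> ! b)) \<and> (\<forall>y\<in>endv \<Phi> ` walks \<Phi> l. ?m \<sigma> \<rho> y = \<tau> y) \<longleftrightarrow>
     (\<forall>j\<in>{1..l}. \<forall>v\<in>walks \<Phi> j. sat_clause \<sigma> (\<Phi> ! hd v)) \<and> (\<forall>v\<in>walks \<Phi> l. \<tau> (endv \<Phi> v) = \<sigma> (endv \<Phi> v)) \<and> ok \<rho>"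
    (is "?A \<and> ?B \<longleftrightarrow> ?D \<and> ?E \<and> ?F") for \<sigma> \<rho>
  proof -
    have BE: "?B \<longleftrightarrow> ?E"
      using ball_varsI[of \<Phi> _ l] by (auto simp: walks_def)
    have inner: "sat_clause (?m \<sigma> \<rho>) (\<Phi> ! b) \<longleftrightarrow> sat_clause \<sigma> (\<Phi> ! b)" if "walk \<Phi> (b # w)" "length w < l" for b w
    proof (rule sat_clause_cong)
      show "b \<in> exts \<Phi> w" using that by simp
      have "endv \<Phi> w \<in> ?U" "endv \<Phi> (b # w) \<in> ?U" by (rule ball_varsI; use that in auto)+
      then show "?m \<sigma> \<rho> (endv \<Phi> w) = \<sigma> (endv \<Phi> w)" "?m \<sigma> \<rho> (endv \<Phi> (b # w)) = \<sigma> (endv \<Phi> (b # w))"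
        by simp_all
    qed
    have outer: "sat_clause (?m \<sigma> \<rho>) (\<Phi> ! b) \<longleftrightarrow> sat_clause (?m \<tau> \<rho>) (\<Phi> ! b)" if b: "b \<in> rest" and ?E for b
    proof -
      have "?m \<sigma> \<rho> x = ?m \<tau> \<rho> x" if x: "x \<in> clause_vars (\<Phi> ! b)" for x
      proof (cases "x \<in> ?U")
        case True
        then obtain w where w: "walk \<Phi> w" "length w \<le> l" "x = endv \<Phi> w" by (auto simp: ball_vars_def)
        \<comment> \<open>If \<open>w\<close> were shorter, \<open>b\<close> would extend
          \<open>w\<close> or be its latest clause; in both cases it is crossed inside the
          ball.\<close>
        have "length w = l"
        proof (rule ccontr)
          assume "length w \<noteq> l"
          with w have "length w < l" by simp
          have "walk \<Phi> (b # w) \<or> (\<exists>u. w = b # u)"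
            using b x w(1,3) by (cases w) (auto simp: exts_def var_nbrs_iff rest_def)
          then show False
          proof
            assume "walk \<Phi> (b # w)"
            with \<open>length w < l\<close> b show False by (auto simp: rest_def)
          next
            assume "\<exists>u. w = b # u"
            then obtain u where "w = b # u" by blast
            with w(1) \<open>length w < l\<close> b show False unfolding rest_def by fastforce
          qed
        qed
        with w \<open>?E\<close> True show ?thesis by (simp add: walks_def)
      qed simp
      moreover have "\<Phi> ! b \<in> all_clauses n" using b valid by (auto simp: rest_def)
      ultimately show ?thesis by (auto elim!: clause_cases)
    qed
    have "?A \<longleftrightarrow> ?D \<and> ?F" if ?E
    proof
      assume A: ?A
      have ?D
      proof (intro ballI)
        fix j v assume "j \<in> {1..l}" "v \<in> walks \<Phi> j"
        then obtain b w where "v = b # w" "walk \<Phi> (b # w)" "length w < l"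
          by (cases v) (auto simp: walks_def)
        with A inner show "sat_clause \<sigma> (\<Phi> ! hd v)"
          using exts_facts(1)[OF valid, of b w] by (metis list.sel(1) walk.simps(2))
      qed
      moreover have ?F using A outer \<open>?E\<close> unfolding ok_def rest_def by blast
      ultimately show "?D \<and> ?F" ..
    next
      assume DF: "?D \<and> ?F"
      show ?A
      proof (intro allI impI)
        fix b assume b: "b < length \<Phi>"
        show "sat_clause (?m \<sigma> \<rho>) (\<Phi> ! b)"
        proof (cases "b \<in> rest")
          case True
          with DF outer \<open>?E\<close> show ?thesis unfolding ok_def by blast
        next
          case False
          with b obtain w where w: "walk \<Phi> (b # w)" "length w < l" by (auto simp: rest_def simp del: walk.simps)
          then have "Suc (length w) \<in> {1..l}" "b # w \<in> walks \<Phi> (Suc (length w))" by (auto simp: walks_def)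
          with DF have "sat_clause \<sigma> (\<Phi> ! hd (b # w))" by blast
          with inner[OF w] show ?thesis by simp
        qed
      qed
    qed
    with BE show ?thesis by blast
  qed
  have fin: "finite ({1..n} \<rightarrow>\<^sub>E ?C)" by (intro finite_PiE) auto
  have "real (card {\<sigma> \<in> sat_assignments n \<Phi>. (\<forall>y\<in>endv \<Phi> ` walks \<Phi> l. \<sigma> y = \<tau> y) \<and> \<sigma> 1 = t}) =
    (\<Sum>\<rho>\<in>R \<rightarrow>\<^sub>E ?C. of_bool (ok \<rho>)) * wt \<Phi> (pin \<Phi> \<tau>) l [] t" if t: "t \<in> {1, -1}" for t
  proof -
    let ?Q = "\<lambda>\<sigma>. (\<forall>b<length \<Phi>. sat_clause \<sigma> (\<Phi> ! b)) \<and> (\<forall>y\<in>endv \<Phi> ` walks \<Phi> l. \<sigma> y = \<tau> y) \<and> \<sigma> 1 = t"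
    have "{\<sigma> \<in> sat_assignments n \<Phi>. (\<forall>y\<in>endv \<Phi> ` walks \<Phi> l. \<sigma> y = \<tau> y) \<and> \<sigma> 1 = t} = 
      ({1..n} \<rightarrow>\<^sub>E ?C) \<inter> {\<sigma>. ?Q \<sigma>}"
      by (auto simp: sat_assignments_def all_set_conv_all_nth)
    then have "real (card {\<sigma> \<in> sat_assignments n \<Phi>. (\<forall>y\<in>endv \<Phi> ` walks \<Phi> l. \<sigma> y = \<tau> y) \<and> \<sigma> 1 = t}) =
      (\<Sum>\<sigma>\<in>{1..n} \<rightarrow>\<^sub>E ?C. of_bool (?Q \<sigma>))"
      using fin by (simp only: sum_of_bool_eq)
    also have "{1..n} = ?U \<union> R" using U by (auto simp: R_def)
    also have "(\<Sum>\<sigma>\<in>?U \<union> R \<rightarrow>\<^sub>E ?C. of_bool (?Q \<sigma>) :: real) =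
       (\<Sum>\<sigma>\<in>?U \<rightarrow>\<^sub>E ?C. \<Sum>\<rho>\<in>R \<rightarrow>\<^sub>E ?C. of_bool (?Q (?m \<sigma> \<rho>)))"
      by (rule sum_PiE_Un) (auto simp: R_def)
    also have "\<dots> = (\<Sum>\<sigma>\<in>?U \<rightarrow>\<^sub>E ?C. \<Sum>\<rho>\<in>R \<rightarrow>\<^sub>E ?C. (of_bool (\<sigma> 1 = t) *
      (\<Prod>j\<in>{1..l}. \<Prod>v\<in>walks \<Phi> j. of_bool (sat_clause \<sigma> (\<Phi> ! hd v))) *
      (\<Prod>v\<in>walks \<Phi> l. pin \<Phi> \<tau> v (\<sigma> (endv \<Phi> v)))) * of_bool (ok \<rho>))"
    proof (intro sum.cong refl)
      fix \<sigma> \<rho>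
      have "?Q (?m \<sigma> \<rho>) \<longleftrightarrow> ((\<forall>j\<in>{1..l}. \<forall>v\<in>walks \<Phi> j. sat_clause \<sigma> (\<Phi> ! hd v)) \<and> 
           (\<forall>v\<in>walks \<Phi> l. \<tau> (endv \<Phi> v) = \<sigma> (endv \<Phi> v)) \<and> ok \<rho>) \<and> \<sigma> 1 = t"
        unfolding split[symmetric] using one_in_ball_vars by auto
      then show "of_bool (?Q (?m \<sigma> \<rho>)) = (of_bool (\<sigma> 1 = t) *
        (\<Prod>j\<in>{1..l}. \<Prod>v\<in>walks \<Phi> j. of_bool (sat_clause \<sigma> (\<Phi> ! hd v))) *
        (\<Prod>v\<in>walks \<Phi> l. pin \<Phi> \<tau> v (\<sigma> (endv \<Phi> v)))) * (of_bool (ok \<rho>) :: real)"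
        unfolding pin_def by (simp only: prod_of_bool finite_walks finite_atLeastAtMost of_bool_conj mult_ac)
    qed
    also have "\<dots> = (\<Sum>\<rho>\<in>R \<rightarrow>\<^sub>E ?C. of_bool (ok \<rho>)) * wt \<Phi> (pin \<Phi> \<tau>) l [] t"
      unfolding level_elimination[OF order_refl t, symmetric] sum_distrib_left sum_distrib_right
      by (simp only: mult_ac)
    finally show ?thesis .
  qed
  then show ?thesis by blast
qed

text \<open>\<open>K\<close> cancels in the conditional probability; it is nonzero because \<tau>
  meets its own boundary condition.\<close>

lemma cond_marginal_pinned:
  assumes \<tau>: "\<tau> \<in> sat_assignments n \<Phi>"
  shows "cond_marginal n \<Phi> l \<tau> =
    wt \<Phi> (pin \<Phi> \<tau>) l [] 1 / (wt \<Phi> (pin \<Phi> \<tau>) l [] 1 + wt \<Phi> (pin \<Phi> \<tau>) l [] (-1))"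
proof -
  let ?S = "sat_assignments n \<Phi>"
  let ?B = "\<lambda>\<sigma>. \<forall>y\<in>endv \<Phi> ` walks \<Phi> l. \<sigma> y = \<tau> y"
  let ?W = "wt \<Phi> (pin \<Phi> \<tau>) l []"
  obtain K :: real where K: "\<And>t. t \<in> {1, -1} \<Longrightarrow> real (card {\<sigma> \<in> ?S. ?B \<sigma> \<and> \<sigma> 1 = t}) = K * ?W t"
    using card_pinned[OF \<tau>] by blast
  have one: "1 \<in> {1..n}" using n by simp
  have "{\<sigma> \<in> ?S. ?B \<sigma>} = {\<sigma> \<in> ?S. ?B \<sigma> \<and> \<sigma> 1 = 1} \<union> {\<sigma> \<in> ?S. ?B \<sigma> \<and> \<sigma> 1 = -1}"
    using one unfolding sat_assignments_def by fastforce
  then have "card {\<sigma> \<in> ?S. ?B \<sigma>} = card {\<sigma> \<in> ?S. ?B \<sigma> \<and> \<sigma> 1 = 1} + card {\<sigma> \<in> ?S. ?B \<sigma> \<and> \<sigma> 1 = -1}"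
    using finite_sat_assignments by (simp only:) (rule card_Un_disjoint; auto)
  then have tot: "real (card {\<sigma> \<in> ?S. ?B \<sigma>}) = K * (?W 1 + ?W (-1))"
    using K[of 1] K[of "-1"] by (simp add: algebra_simps)
  have "card {\<sigma> \<in> ?S. ?B \<sigma>} > 0"
    using \<tau> finite_sat_assignments by (subst card_gt_0_iff) auto
  with tot have "K \<noteq> 0" by auto
  have S: "?S \<noteq> {}" using \<tau> by auto
  have bd: "(\<forall>y. Variable y \<in> sphere \<Phi> (2 * l) (Variable 1) \<longrightarrow> \<sigma> y = \<tau> y) \<longleftrightarrow> ?B \<sigma>" for \<sigma>
    using sphere_treelike[OF valid tree] by blast
  have "cond_marginal n \<Phi> l \<tau> = real (card {\<sigma> \<in> ?S. ?B \<sigma> \<and> \<sigma> 1 = 1}) / real (card {\<sigma> \<in> ?S. ?B \<sigma>})"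
  proof -
    have "?S \<inter> {\<sigma>. \<sigma> 1 = 1 \<and> ?B \<sigma>} = {\<sigma> \<in> ?S. ?B \<sigma> \<and> \<sigma> 1 = 1}" "?S \<inter> {\<sigma>. ?B \<sigma>} = {\<sigma> \<in> ?S. ?B \<sigma>}"
      by auto
    then show ?thesis
      unfolding cond_marginal_def bd cond_prob_def gibbs_def
      using S finite_sat_assignments by (simp add: measure_pmf_of_set card_gt_0_iff)
  qed
  also have "\<dots> = ?W 1 / (?W 1 + ?W (-1))" using K[of 1] tot \<open>K \<noteq> 0\<close> by simp
  finally show ?thesis .
qed

end

section \<open>Alternating walks and log-odds bounds\<close>

text \<open>
  \<open>alt \<Phi> j w t\<close> is the number of ways to continue \<open>w\<close> by \<open>j\<close> clauses along which the value \<open>t\<close> of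
  the end of \<open>w\<close> may be forced by unit propagation from the far end.  If no such continuation
  reaches the boundary, then the odds of \<open>t\<close> are at most 2 to the number of shorter ones.
\<close>

fun alt :: "formula \<Rightarrow> nat \<Rightarrow> nat list \<Rightarrow> int \<Rightarrow> real" where
  "alt \<Phi> 0 w t = 1"
| "alt \<Phi> (Suc j) w t =
     (\<Sum>b\<in>exts \<Phi> w. if own_sign (\<Phi> ! b) (endv \<Phi> w) = t
        then alt \<Phi> j (b # w) (- other_sign (\<Phi> ! b) (endv \<Phi> w)) else 0)"

text \<open>If \<open>z\<close> is the log-odds for the other literal of a clause to be false, the
  clause multiplies the odds for its own literal to be true by \<open>1 + exp z\<close>.\<close>

definition softplus :: "real \<Rightarrow> real" where
  "softplus z = ln (1 + exp z)"

text \<open>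
  An upper bound for the log-odds of the value \<open>t\<close> at the end of \<open>w\<close>, valid for every boundary
  condition, so that \<open>bnd \<Phi> L j w 1 + bnd \<Phi> L j w (-1)\<close> is the width of an interval that contains
  all these log-odds.  The recursion starts \<open>L\<close> levels above the boundary, where the bounds are
  finite.
\<close>

fun bnd :: "formula \<Rightarrow> nat \<Rightarrow> nat \<Rightarrow> nat list \<Rightarrow> int \<Rightarrow> real" where
  "bnd \<Phi> L 0 w t = ln 2 * (\<Sum>j = 1..L. alt \<Phi> j w t)"
| "bnd \<Phi> L (Suc j) w t =
     (\<Sum>b\<in>exts \<Phi> w. if own_sign (\<Phi> ! b) (endv \<Phi> w) = t
        then softplus (bnd \<Phi> L j (b # w) (- other_sign (\<Phi> ! b) (endv \<Phi> w)))
        else - softplus (- bnd \<Phi> L j (b # w) (other_sign (\<Phi> ! b) (endv \<Phi> w))))"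

lemma softplus_mono: "x \<le> y \<Longrightarrow> softplus x \<le> softplus y"
  by (simp add: softplus_def add_pos_pos)

lemma softplus_minus: "softplus x - softplus (- x) = x"
proof -
  have "1 + exp x = exp x * (1 + exp (- x))" by (simp add: exp_minus field_simps)
  moreover have "1 + exp (-x) \<noteq> 0" by (metis add_pos_pos exp_gt_zero less_irrefl zero_less_one)
  ultimately show ?thesis by (simp add: softplus_def ln_mult)
qed

lemma alt_nonneg: "alt \<Phi> j w t \<ge> 0"
  by (induction j arbitrary: w t) (auto intro!: sum_nonneg)

text \<open>The summand 1 is \<open>alt\<close> at depth 0. It pays for the factor 2 that every
  clause with sign \<open>t\<close> costs in \<open>wt_ratio_alt\<close>.\<close>

lemma sum_alt_Suc:
  "(\<Sum>j = 1..Suc L. alt \<Phi> j w t) = (\<Sum>b\<in>exts \<Phi> w. if own_sign (\<Phi> ! b) (endv \<Phi> w) = t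
      then 1 + (\<Sum>j = 1..L. alt \<Phi> j (b # w) (- other_sign (\<Phi> ! b) (endv \<Phi> w))) else 0)"
proof -
  have "(\<Sum>j = 1..Suc L. alt \<Phi> j w t) = (\<Sum>j = 0..L. alt \<Phi> (Suc j) w t)"
    unfolding One_nat_def sum.atLeast_Suc_atMost_Suc_shift by simp
  also have "\<dots> = (\<Sum>b\<in>exts \<Phi> w. \<Sum>j = 0..L. if own_sign (\<Phi> ! b) (endv \<Phi> w) = t
        then alt \<Phi> j (b # w) (- other_sign (\<Phi> ! b) (endv \<Phi> w)) else 0)"
    unfolding alt.simps by (rule sum.swap)
  also have "\<dots> = (\<Sum>b\<in>exts \<Phi> w. if own_sign (\<Phi> ! b) (endv \<Phi> w) = t
      then 1 + (\<Sum>j = 1..L. alt \<Phi> j (b # w) (- other_sign (\<Phi> ! b) (endv \<Phi> w))) else 0)"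
    by (intro sum.cong refl) (simp add: sum.atLeast_Suc_atMost)
  finally show ?thesis .
qed

text \<open>For an odds ratio \<open>p / q\<close> of at least 1, the difference of the
  probabilities is at most \<open>1 - q / p \<le> ln (p / q)\<close>; the map from log-odds to
  probabilities is 1-Lipschitz. The one log-odds is at most \<open>u\<close>, the other at least
  \<open>- v\<close>.\<close>

lemma odds_diff:
  fixes a b a' b' :: real
  assumes "a > 0" "b > 0" "a' > 0" "b' > 0" "ln a - ln b \<le> u" "ln b' - ln a' \<le> v"
    and "a' * b \<le> a * b'"
  shows "a / (a + b) - a' / (a' + b') \<le> u + v"
proof -
  define p q where "p = a * b'" and "q = a' * b"
  have pq: "p > 0" "q > 0" "q \<le> p" using assms by (auto simp: p_def q_def)
  have den: "0 < (a + b) * (a' + b')" using assms by (simp add: add_pos_pos)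
  have "a / (a + b) - a' / (a' + b') = (p - q) / ((a + b) * (a' + b'))"
    using assms by (simp add: p_def q_def field_simps)
  \<comment> \<open>\<open>p = a * b'\<close> is one of the four products in the expanded
    denominator.\<close>
  also have "\<dots> \<le> (p - q) / p"
  proof (rule divide_left_mono)
    show "p \<le> (a + b) * (a' + b')" using assms by (simp add: p_def algebra_simps)
    show "0 < (a + b) * (a' + b') * p" using mult_pos_pos[OF den pq(1)] .
  qed (use pq in simp)
  also have "\<dots> = 1 - q / p" using pq by (simp add: field_simps)
  also have "\<dots> \<le> - ln (q / p)" using ln_le_minus_one[of "q / p"] pq by simp
  also have "\<dots> = (ln a - ln b) + (ln b' - ln a')"
    using assms by (simp add: p_def q_def ln_div ln_mult)
  also have "\<dots> \<le> u + v" using assms by simp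
  finally show ?thesis .
qed

lemma odds_abs_diff:
  fixes a b a' b' :: real
  assumes "a > 0" "b > 0" "a' > 0" "b' > 0" "ln a - ln b \<le> u" "ln b - ln a \<le> v"
     "ln a' - ln b' \<le> u" "ln b' - ln a' \<le> v"
  shows "\<bar>a / (a + b) - a' / (a' + b')\<bar> \<le> u + v"
proof -
  have pos: "a + b > 0" "a' + b' > 0" using assms by simp_all
  have le: "a / (a + b) \<le> a' / (a' + b')" if "a * b' \<le> a' * b"
    using pos that by (simp add: divide_le_eq le_divide_eq algebra_simps)
  have ge: "a' / (a' + b') \<le> a / (a + b)" if "a' * b \<le> a * b'"
    using pos that by (simp add: divide_le_eq le_divide_eq algebra_simps)
  show ?thesis
    using odds_diff[OF assms(1-5,8)] odds_diff[OF assms(3,4,1,2,7,6)] le ge by linarith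
qed

context
  fixes \<Phi> :: formula and n :: nat
  assumes valid: "set \<Phi> \<subseteq> all_clauses n"
begin

lemma signs:
  assumes "b \<in> exts \<Phi> w"
  shows "own_sign (\<Phi> ! b) (endv \<Phi> w) \<in> {1, -1}" "other_sign (\<Phi> ! b) (endv \<Phi> w) \<in> {1, -1}"
  using clause_facts(6,7)[OF exts_facts(2,3)[OF valid assms]] by auto

lemma alt_sum_Suc:
  "alt \<Phi> (Suc j) w 1 + alt \<Phi> (Suc j) w (-1) =
     (\<Sum>b\<in>exts \<Phi> w. alt \<Phi> j (b # w) (- other_sign (\<Phi> ! b) (endv \<Phi> w)))"
  unfolding alt.simps sum.distrib[symmetric]
  using signs(1) by (intro sum.cong refl) fastforce

lemma bnd_sum_Suc:
  "bnd \<Phi> L (Suc j) w 1 + bnd \<Phi> L (Suc j) w (-1) =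
     (\<Sum>b\<in>exts \<Phi> w. softplus (bnd \<Phi> L j (b # w) (- other_sign (\<Phi> ! b) (endv \<Phi> w)))
        - softplus (- bnd \<Phi> L j (b # w) (other_sign (\<Phi> ! b) (endv \<Phi> w))))"
  unfolding bnd.simps sum.distrib[symmetric]
  using signs(1) by (intro sum.cong refl) fastforce

lemma bnd_sum_nonneg: "bnd \<Phi> L j w 1 + bnd \<Phi> L j w (-1) \<ge> 0"
proof (induction j arbitrary: w)
  case 0
  show ?case by (simp add: alt_nonneg sum_nonneg)
next
  case (Suc j)
  show ?case unfolding bnd_sum_Suc
  proof (intro sum_nonneg)
    fix b assume "b \<in> exts \<Phi> w"
    with signs(2)[OF this] Suc[of "b # w"]
    have "- bnd \<Phi> L j (b # w) (other_sign (\<Phi> ! b) (endv \<Phi> w)) \<le> bnd \<Phi> L j (b # w) (- other_sign (\<Phi> ! b) (endv \<Phi> w))"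
      by auto
    from softplus_mono[OF this] 
    show "0 \<le> softplus (bnd \<Phi> L j (b # w) (- other_sign (\<Phi> ! b) (endv \<Phi> w)))
        - softplus (- bnd \<Phi> L j (b # w) (other_sign (\<Phi> ! b) (endv \<Phi> w)))" by simp
  qed
qed

text \<open>Depth 0 cannot occur, as \<open>alt\<close> is 1 there. For a clause with own sign
  \<open>t\<close> and other sign \<open>s\<close>, the induction bounds the child's weight at
  \<open>- s\<close> by \<open>2 powr c\<close> times that at \<open>s\<close>, so leaving the child
  free costs at most twice \<open>2 powr c\<close>. A clause with own sign \<open>- t\<close> can
  only favour \<open>- t\<close>.\<close>

lemma wt_ratio_alt:
  assumes \<theta>: "\<And>w t. \<theta> w t \<ge> 0" and "t \<in> {1, -1}" "alt \<Phi> L w t = 0"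
  shows "wt \<Phi> \<theta> L w t \<le> 2 powr (\<Sum>j = 1..L. alt \<Phi> j w t) * wt \<Phi> \<theta> L w (- t)"
  using assms(2,3)
proof (induction L arbitrary: w t)
  case (Suc L)
  let ?r = "\<lambda>b. own_sign (\<Phi> ! b) (endv \<Phi> w)" and ?s = "\<lambda>b. other_sign (\<Phi> ! b) (endv \<Phi> w)"
  let ?W = "\<lambda>b. wt \<Phi> \<theta> L (b # w)"
  let ?c = "\<lambda>b. \<Sum>j = 1..L. alt \<Phi> j (b # w) (- ?s b)"
  let ?f = "\<lambda>t b. if ?r b = t then ?W b 1 + ?W b (-1) else ?W b (?s b)"
  have W0: "?W b s \<ge> 0" for b s by (rule wt_nonneg[OF \<theta>])
  have factor: "0 \<le> ?f t b \<and> ?f t b \<le> 2 powr (if ?r b = t then 1 + ?c b else 0) * ?f (- t) b"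
    if b: "b \<in> exts \<Phi> w" for b
  proof (cases "?r b = t")
    case True
    then have ne: "?r b \<noteq> - t" using Suc.prems(1) by auto
    have "alt \<Phi> (Suc L) w t = 0" by fact
    then have "\<forall>b\<in>exts \<Phi> w. (if ?r b = t then alt \<Phi> L (b # w) (- ?s b) else 0) = 0"
      unfolding alt.simps by (subst (asm) sum_nonneg_eq_0_iff) (auto simp: alt_nonneg)
    with b True have "alt \<Phi> L (b # w) (- ?s b) = 0" by auto
    moreover have "- ?s b \<in> {1, -1}" using signs(2)[OF b] by auto
    ultimately have IH: "?W b (- ?s b) \<le> 2 powr ?c b * ?W b (?s b)"
      using Suc.IH[of "- ?s b" "b # w"] by simp
    have "?c b \<ge> 0" by (simp add: sum_nonneg alt_nonneg)
    then have "1 \<le> 2 powr ?c b" by (simp add: ge_one_powr_ge_zero)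
    then have "?W b (?s b) \<le> 2 powr ?c b * ?W b (?s b)"
      using W0[of b "?s b"] by (simp add: mult_le_cancel_right1)
    moreover have "?W b 1 + ?W b (-1) = ?W b (?s b) + ?W b (- ?s b)" using signs(2)[OF b] by auto
    ultimately show ?thesis using True ne IH W0 by (simp add: powr_add)
  next
    case False
    then have "?r b = - t" using signs(1)[OF b] Suc.prems(1) by auto
    moreover have "?W b (?s b) \<le> ?W b 1 + ?W b (-1)" using signs(2)[OF b] W0 by auto
    ultimately show ?thesis using False W0 by auto
  qed
  have "wt \<Phi> \<theta> (Suc L) w t \<le> (\<Prod>b\<in>exts \<Phi> w. 2 powr (if ?r b = t then 1 + ?c b else 0) * ?f (- t) b)"
    unfolding wt.simps by (intro prod_mono factor)
  also have "\<dots> = 2 powr (\<Sum>j = 1..Suc L. alt \<Phi> j w t) * wt \<Phi> \<theta> (Suc L) w (- t)"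
    unfolding prod.distrib sum_alt_Suc by (subst powr_sum) simp_all
  finally show ?case .
qed simp

text \<open>General \<theta> puts constant weights and pinned boundaries into the same interval. The
  hypothesis \<open>alt0\<close> makes the log-odds finite at level \<open>k\<close>; above it,
  monotonicity of \<open>softplus\<close> pushes the interval upwards.\<close>

lemma wt_log_ratio:
  assumes \<theta>: "\<And>w t. \<theta> w t \<ge> 0" 
    and pos: "\<And>w j. walk \<Phi> w \<Longrightarrow> wt \<Phi> \<theta> j w 1 + wt \<Phi> \<theta> j w (-1) > 0"
    and alt0: "\<And>w t. w \<in> walks \<Phi> k \<Longrightarrow> t \<in> {1, -1} \<Longrightarrow> alt \<Phi> L w t = 0"
    and "walk \<Phi> w" "length w + i = k" "t \<in> {1, -1}"
  shows "wt \<Phi> \<theta> (L + i) w t > 0 \<and>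
    ln (wt \<Phi> \<theta> (L + i) w t) - ln (wt \<Phi> \<theta> (L + i) w (- t)) \<le> bnd \<Phi> L i w t"
  using assms(4-6)
proof (induction i arbitrary: w t)
  case 0
  let ?W = "wt \<Phi> \<theta> L w"
  have w: "w \<in> walks \<Phi> k" using 0 by (simp add: walks_def)
  have t': "- t \<in> {1, -1}" using 0 by auto
  have le: "?W t \<le> 2 powr (\<Sum>j = 1..L. alt \<Phi> j w t) * ?W (- t)"
    by (rule wt_ratio_alt[OF \<theta> 0(3) alt0[OF w 0(3)]])
  have le': "?W (- t) \<le> 2 powr (\<Sum>j = 1..L. alt \<Phi> j w (- t)) * ?W t"
    using wt_ratio_alt[OF \<theta> t' alt0[OF w t']] by simp
  have "?W t + ?W (- t) > 0" using pos[OF 0(1), of L] 0(3) by auto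
  moreover have "?W t \<ge> 0" "?W (- t) \<ge> 0" by (rule wt_nonneg[OF \<theta>])+
  ultimately have p: "?W t > 0" "?W (- t) > 0"
    using le le' by (auto simp: less_le)
  have "ln (?W t) \<le> ln (2 powr (\<Sum>j = 1..L. alt \<Phi> j w t) * ?W (- t))" using p le by simp
  also have "\<dots> = bnd \<Phi> L 0 w t + ln (?W (- t))" using p by (simp add: ln_mult ln_powr)
  finally show ?case using p by simp
next
  case (Suc i)
  let ?r = "\<lambda>b. own_sign (\<Phi> ! b) (endv \<Phi> w)" and ?s = "\<lambda>b. other_sign (\<Phi> ! b) (endv \<Phi> w)"
  let ?W = "\<lambda>b. wt \<Phi> \<theta> (L + i) (b # w)"
  let ?B = "\<lambda>b. bnd \<Phi> L i (b # w)"
  let ?f = "\<lambda>t b. if ?r b = t then ?W b 1 + ?W b (-1) else ?W b (?s b)"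
  have IH: "?W b s > 0 \<and> ln (?W b s) - ln (?W b (- s)) \<le> ?B b s" if "b \<in> exts \<Phi> w" "s \<in> {1, -1}" for b s
    using Suc.prems that by (intro Suc.IH) auto
  have fpos: "?f t b > 0" if "b \<in> exts \<Phi> w" for b t
    using IH[OF that] signs(2)[OF that] by (auto intro: add_pos_pos)
  have factor: "ln (?f t b) - ln (?f (- t) b) \<le>
      (if ?r b = t then softplus (?B b (- ?s b)) else - softplus (- ?B b (?s b)))"
    if b: "b \<in> exts \<Phi> w" for b
  proof -
    have s: "?s b \<in> {1, -1}" "- ?s b \<in> {1, -1}" using signs(2)[OF b] by auto
    define p q where "p = ?W b (?s b)" and "q = ?W b (- ?s b)"
    have pq: "p > 0" "q > 0" using IH[OF b s(1)] IH[OF b s(2)] by (auto simp: p_def q_def)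
    have lq: "ln q - ln p \<le> ?B b (- ?s b)" "ln p - ln q \<le> ?B b (?s b)"
      using IH[OF b s(1)] IH[OF b s(2)] by (auto simp: p_def q_def)
    have tot: "?W b 1 + ?W b (-1) = p + q" using s by (auto simp: p_def q_def)
    have ratio: "ln (p + q) - ln p = softplus (ln q - ln p)"
    proof -
      have "exp (ln q - ln p) = q / p" using pq by (simp add: exp_diff)
      then have "softplus (ln q - ln p) = ln ((p + q) / p)" using pq
        by (simp add: softplus_def add_divide_distrib)
      then show ?thesis using pq by (simp add: ln_div)
    qed
    show ?thesis
    proof (cases "?r b = t")
      case True
      then have "?r b \<noteq> - t" using Suc.prems(3) by auto
      with True ratio softplus_mono[OF lq(1)] show ?thesis by (simp add: tot flip: p_def)
    next
      case False
      then have "?r b = - t" using signs(1)[OF b] Suc.prems(3) by auto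
      moreover have "- ?B b (?s b) \<le> ln q - ln p" using lq(2) by simp
      ultimately show ?thesis using False ratio softplus_mono[of "- ?B b (?s b)" "ln q - ln p"]
        by (simp add: tot flip: p_def)
    qed
  qed
  have "wt \<Phi> \<theta> (L + Suc i) w t > 0"
    unfolding add_Suc_right wt.simps by (intro prod_pos fpos)
  moreover have "ln (wt \<Phi> \<theta> (L + Suc i) w t) = (\<Sum>b\<in>exts \<Phi> w. ln (?f t b))" for t
    unfolding add_Suc_right wt.simps by (rule ln_prod[OF finite_exts less_imp_neq[OF fpos, symmetric]])
  then have "ln (wt \<Phi> \<theta> (L + Suc i) w t) - ln (wt \<Phi> \<theta> (L + Suc i) w (- t)) =
      (\<Sum>b\<in>exts \<Phi> w. ln (?f t b) - ln (?f (- t) b))"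
    by (simp only: sum_subtractf)
  then have "ln (wt \<Phi> \<theta> (L + Suc i) w t) - ln (wt \<Phi> \<theta> (L + Suc i) w (- t)) \<le> bnd \<Phi> L (Suc i) w t"
    using sum_mono[OF factor] by simp
  ultimately show ?case by blast
qed

text \<open>Both log-odds lie between \<open>- bnd \<Phi> L k [] (-1)\<close> and
  \<open>bnd \<Phi> L k [] 1\<close>, an interval that does not depend on \<tau>.\<close>

lemma marginal_difference:
  assumes n: "1 \<le> n" and tree: "treelike (L + k) \<Phi>" and "L + k > 0"
    and \<tau>: "\<tau> \<in> sat_assignments n \<Phi>"
    and alt0: "\<And>w t. w \<in> walks \<Phi> k \<Longrightarrow> t \<in> {1, -1} \<Longrightarrow> alt \<Phi> L w t = 0"
  shows "\<bar>cond_marginal n \<Phi> (L + k) \<tau> - bp_marginal \<Phi> (L + k) 1 1\<bar> \<le> bnd \<Phi> L k [] 1 + bnd \<Phi> L k [] (-1)"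
proof -
  let ?F = "wt \<Phi> (\<lambda>_ _. 1) (L + k) []" and ?W = "wt \<Phi> (pin \<Phi> \<tau>) (L + k) []"
  have free_pos: "wt \<Phi> (\<lambda>_ _. 1) j w t > 0" for j w t by (rule wt_pos) simp
  have F: "?F t > 0 \<and> ln (?F t) - ln (?F (- t)) \<le> bnd \<Phi> L k [] t" if "t \<in> {1, -1}" for t
    by (rule wt_log_ratio[where k = k]) (use alt0 that free_pos in \<open>auto intro: add_pos_pos\<close>)
  have pin_sum: "wt \<Phi> (pin \<Phi> \<tau>) j w 1 + wt \<Phi> (pin \<Phi> \<tau>) j w (-1) > 0" if "walk \<Phi> w" for j w
  proof -
    have "\<tau> (endv \<Phi> w) \<in> {1, -1}"
      using endv_range[OF valid n that] \<tau> by (auto simp: sat_assignments_def)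
    with wt_pin_pos[OF valid \<tau> n that, of j] wt_nonneg[of "pin \<Phi> \<tau>" \<Phi> j w] pin_nonneg
    show ?thesis by (auto intro: add_pos_nonneg add_nonneg_pos)
  qed
  have W: "?W t > 0 \<and> ln (?W t) - ln (?W (- t)) \<le> bnd \<Phi> L k [] t" if "t \<in> {1, -1}" for t
    by (rule wt_log_ratio[where k = k]) (use alt0 that pin_sum in \<open>auto simp: pin_nonneg\<close>)
  have "bp_marginal \<Phi> (L + k) 1 1 = ?F 1 / (?F 1 + ?F (-1))"
    using bp_marginal_free[OF valid, of 1 "L + k - 1"] \<open>L + k > 0\<close> by (simp del: wt.simps)
  moreover have "cond_marginal n \<Phi> (L + k) \<tau> = ?W 1 / (?W 1 + ?W (-1))"
    by (rule cond_marginal_pinned[OF valid n tree \<tau>])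
  ultimately show ?thesis
    using odds_abs_diff[of "?W 1" "?W (-1)" "?F 1" "?F (-1)"] W[of 1] W[of "-1"] F[of 1] F[of "-1"]
    by simp
qed

end

section \<open>Averaging over the signs\<close>

definition formulas :: "nat \<Rightarrow> nat \<Rightarrow> formula set" where
  "formulas n m = {\<Phi>. set \<Phi> \<subseteq> all_clauses n \<and> length \<Phi> = m}"

definition tree_formulas :: "nat \<Rightarrow> nat \<Rightarrow> nat \<Rightarrow> formula set" where
  "tree_formulas l n m = {\<Phi> \<in> formulas n m. treelike l \<Phi>}"

lemma finite_all_clauses [simp]: "finite (all_clauses n)"
proof (rule finite_subset)
  show "all_clauses n \<subseteq> ({1..n} \<times> {1, -1}) \<times> ({1..n} \<times> {1, -1})"
    by (auto simp: all_clauses_def)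
qed simp

lemma finite_formulas [simp]: "finite (formulas n m)"
  unfolding formulas_def by (rule finite_lists_length_eq) simp

lemma finite_tree_formulas [simp]: "finite (tree_formulas l n m)"
  unfolding tree_formulas_def by simp

text \<open>The formula with its signs erased. Walks, their ends and tree-likeness are functions of
  the skeleton, so flipping signs leaves them alone.\<close>

definition skeleton :: "formula \<Rightarrow> (nat \<times> nat) list" where
  "skeleton = map (\<lambda>c. (fst (fst c), fst (snd c)))"

lemma other_var_eq: "other_var c x = (if x = fst (fst c) then fst (snd c) else fst (fst c))"
  by (cases c) (auto split: prod.splits)

lemma clause_vars_eq: "clause_vars c = {fst (fst c), fst (snd c)}"
  by (cases c) (auto split: prod.splits)

context
  fixes \<Phi> \<Phi>' :: formula
  assumes skel: "skeleton \<Phi> = skeleton \<Phi>'"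
begin

lemma skeleton_length: "length \<Phi> = length \<Phi>'"
  using arg_cong[OF skel, of length] by (simp add: skeleton_def)

lemma skeleton_nth:
  assumes "b < length \<Phi>"
  shows "other_var (\<Phi> ! b) x = other_var (\<Phi>' ! b) x" "clause_vars (\<Phi> ! b) = clause_vars (\<Phi>' ! b)"
proof -
  have "skeleton \<Phi> ! b = skeleton \<Phi>' ! b" by (simp add: skel)
  with assms skeleton_length
  have "fst (fst (\<Phi> ! b)) = fst (fst (\<Phi>' ! b)) \<and> fst (snd (\<Phi> ! b)) = fst (snd (\<Phi>' ! b))"
    by (simp add: skeleton_def)
  then show "other_var (\<Phi> ! b) x = other_var (\<Phi>' ! b) x" "clause_vars (\<Phi> ! b) = clause_vars (\<Phi>' ! b)"
    by (simp_all only: other_var_eq clause_vars_eq)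
qed

lemma skeleton_var_nbrs: "var_nbrs \<Phi> x = var_nbrs \<Phi>' x"
  using skeleton_length skeleton_nth by (auto simp: var_nbrs_iff)

lemma skeleton_walk: "walk \<Phi> w \<Longrightarrow> endv \<Phi> w = endv \<Phi>' w \<and> exts \<Phi> w = exts \<Phi>' w \<and> walk \<Phi>' w"
proof (induction w)
  case Nil
  show ?case by (simp add: exts_def skeleton_var_nbrs)
next
  case (Cons b w)
  then have b: "b < length \<Phi>" by (auto simp: exts_def var_nbrs_iff)
  have "endv \<Phi> (b # w) = endv \<Phi>' (b # w)" using Cons skeleton_nth(1)[OF b] by simp
  with Cons show ?case by (auto simp: exts_def skeleton_var_nbrs)
qed

end

lemma skeleton_walk_iff: "skeleton \<Phi> = skeleton \<Phi>' \<Longrightarrow> walk \<Phi> w \<longleftrightarrow> walk \<Phi>' w"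
  using skeleton_walk by metis

lemma skeleton_treelike:
  assumes "skeleton \<Phi> = skeleton \<Phi>'"
  shows "treelike l \<Phi> \<longleftrightarrow> treelike l \<Phi>'"
proof -
  have "inj_on (endv \<Phi>) {w. walk \<Phi>' w \<and> length w \<le> l} = inj_on (endv \<Phi>') {w. walk \<Phi>' w \<and> length w \<le> l}"
    using skeleton_walk[OF assms[symmetric]] by (intro inj_on_cong) auto
  then show ?thesis unfolding treelike_def skeleton_walk_iff[OF assms] .
qed

text \<open>
  What happens below the end of a walk in a tree does not depend on the signs in its clauses.
\<close>

definition agree_off :: "nat set \<Rightarrow> formula \<Rightarrow> formula \<Rightarrow> bool" where
  "agree_off A \<Phi> \<Phi>' \<longleftrightarrow> skeleton \<Phi> = skeleton \<Phi>' \<and> (\<forall>c. c \<notin> A \<longrightarrow> \<Phi> ! c = \<Phi>' ! c)"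

lemma agree_off_mono: "agree_off A \<Phi> \<Phi>' \<Longrightarrow> A \<subseteq> B \<Longrightarrow> agree_off B \<Phi> \<Phi>'"
  by (auto simp: agree_off_def)

text \<open>By distinctness a clause that extends \<open>w\<close> is not on \<open>w\<close>, so
  both formulas have the same clause there and the comparison can descend one level.\<close>

lemma agree_off_step:
  assumes "set \<Phi> \<subseteq> all_clauses n" "treelike l \<Phi>" "agree_off (set w) \<Phi> \<Phi>'" "walk \<Phi> w" "length w < l"
    and b: "b \<in> exts \<Phi> w"
  shows "endv \<Phi> w = endv \<Phi>' w" "\<Phi> ! b = \<Phi>' ! b" "agree_off (set (b # w)) \<Phi> \<Phi>'" "walk \<Phi> (b # w)"
proof -
  have skel: "skeleton \<Phi> = skeleton \<Phi>'" using assms(3) by (simp add: agree_off_def)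
  show "endv \<Phi> w = endv \<Phi>' w" using skeleton_walk[OF skel assms(4)] by simp
  show v: "walk \<Phi> (b # w)" using assms(4) b by simp
  from walk_distinct[OF assms(1,2) v] assms(5) have "b \<notin> set w" by simp
  with assms(3) show "\<Phi> ! b = \<Phi>' ! b" by (simp add: agree_off_def)
  show "agree_off (set (b # w)) \<Phi> \<Phi>'" using assms(3) by (rule agree_off_mono) auto
qed

lemma alt_cong:
  assumes "set \<Phi> \<subseteq> all_clauses n" "treelike l \<Phi>" "agree_off (set w) \<Phi> \<Phi>'" "walk \<Phi> w" "length w + j \<le> l"
  shows "alt \<Phi> j w t = alt \<Phi>' j w t"
  using assms(3-5)
proof (induction j arbitrary: w t)
  case (Suc j)
  have e: "exts \<Phi> w = exts \<Phi>' w" using Suc.prems skeleton_walk[of \<Phi> \<Phi>' w] by (auto simp: agree_off_def)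
  show ?case unfolding alt.simps e[symmetric]
  proof (intro sum.cong refl)
    fix b assume b: "b \<in> exts \<Phi> w"
    note st = agree_off_step[OF assms(1,2) Suc.prems(1,2) _ b]
    have l: "length w < l" "length (b # w) + j \<le> l" using Suc.prems(3) by auto
    show "(if own_sign (\<Phi> ! b) (endv \<Phi> w) = t then alt \<Phi> j (b # w) (- other_sign (\<Phi> ! b) (endv \<Phi> w)) else 0) =
      (if own_sign (\<Phi>' ! b) (endv \<Phi>' w) = t then alt \<Phi>' j (b # w) (- other_sign (\<Phi>' ! b) (endv \<Phi>' w)) else 0)"
      using Suc.IH[OF st(3,4) l(2)] st(1,2) l(1) by simp
  qed
qed simp

lemma bnd_cong:
  assumes "set \<Phi> \<subseteq> all_clauses n" "treelike l \<Phi>" "agree_off (set w) \<Phi> \<Phi>'" "walk \<Phi> w" "length w + j + L \<le> l"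
  shows "bnd \<Phi> L j w t = bnd \<Phi>' L j w t"
  using assms(3-5)
proof (induction j arbitrary: w t)
  case 0
  show ?case unfolding bnd.simps
    by (intro arg_cong2[where f = "(*)"] refl sum.cong alt_cong[OF assms(1,2)]) (use 0 in auto)
next
  case (Suc j)
  have e: "exts \<Phi> w = exts \<Phi>' w" using Suc.prems skeleton_walk[of \<Phi> \<Phi>' w] by (auto simp: agree_off_def)
  show ?case unfolding bnd.simps e[symmetric]
  proof (intro sum.cong refl)
    fix b assume b: "b \<in> exts \<Phi> w"
    note st = agree_off_step[OF assms(1,2) Suc.prems(1,2) _ b]
    have l: "length w < l" "length (b # w) + j + L \<le> l" using Suc.prems(3) by auto
    show "(if own_sign (\<Phi> ! b) (endv \<Phi> w) = t
         then softplus (bnd \<Phi> L j (b # w) (- other_sign (\<Phi> ! b) (endv \<Phi> w)))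
         else - softplus (- bnd \<Phi> L j (b # w) (other_sign (\<Phi> ! b) (endv \<Phi> w)))) =
        (if own_sign (\<Phi>' ! b) (endv \<Phi>' w) = t
         then softplus (bnd \<Phi>' L j (b # w) (- other_sign (\<Phi>' ! b) (endv \<Phi>' w)))
         else - softplus (- bnd \<Phi>' L j (b # w) (other_sign (\<Phi>' ! b) (endv \<Phi>' w))))"
      using Suc.IH[OF st(3,4) l(2)] st(1,2) l(1) by simp
  qed
qed

fun flip_sign :: "nat \<Rightarrow> clause \<Rightarrow> clause" where
  "flip_sign y ((u, r), (v, s)) = (if y = u then ((u, - r), (v, s)) else ((u, r), (v, - s)))"

lemma flip_sign_props:
  assumes "c \<in> all_clauses n" "x \<in> clause_vars c"
  shows "flip_sign (other_var c x) c \<in> all_clauses n"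
    "other_sign (flip_sign (other_var c x) c) x = - other_sign c x"
    "flip_sign (other_var c x) (flip_sign (other_var c x) c) = c"
  using assms by (auto elim!: clause_cases simp: all_clauses_def)

lemma flip_sign_skeleton:
  "fst (fst (flip_sign y c)) = fst (fst c)" "fst (snd (flip_sign y c)) = fst (snd c)"
  by (cases c; auto split: prod.splits)+

definition flip_last :: "nat list \<Rightarrow> formula \<Rightarrow> formula" where
  "flip_last v \<Phi> = \<Phi>[hd v := flip_sign (endv \<Phi> v) (\<Phi> ! hd v)]"

definition last_sign :: "formula \<Rightarrow> nat list \<Rightarrow> int" where
  "last_sign \<Phi> v = other_sign (\<Phi> ! hd v) (endv \<Phi> (tl v))"

text \<open>Walks carry the latest clause at the head, so \<open>hd v\<close> is the clause whose
  far sign changes. The skeleton stays the same, which makes the flip an involution of the tree-like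
  formulas in which \<open>v\<close> is a walk.\<close>

lemma flip_last_props:
  assumes "\<Phi> \<in> tree_formulas l n m" "walk \<Phi> v" "v \<noteq> []"
  shows "flip_last v \<Phi> \<in> tree_formulas l n m" "walk (flip_last v \<Phi>) v"
    "flip_last v (flip_last v \<Phi>) = \<Phi>" "last_sign (flip_last v \<Phi>) v = - last_sign \<Phi> v"
    "agree_off (set v) \<Phi> (flip_last v \<Phi>)"
proof -
  from assms(3) obtain b w where v: "v = b # w" by (cases v) auto
  have F: "set \<Phi> \<subseteq> all_clauses n" "length \<Phi> = m" "treelike l \<Phi>"
    using assms(1) by (auto simp: tree_formulas_def formulas_def)
  have b: "b \<in> exts \<Phi> w" and w: "walk \<Phi> w" using assms(2) v by auto
  note c = exts_facts(1-3)[OF F(1) b]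
  let ?c = "\<Phi> ! b" and ?x = "endv \<Phi> w"
  have flip: "flip_last v \<Phi> = \<Phi>[b := flip_sign (other_var ?c ?x) ?c]" by (simp add: flip_last_def v)
  have skel: "skeleton \<Phi> = skeleton (flip_last v \<Phi>)"
    unfolding flip skeleton_def using c(1)
    by (intro nth_equalityI) (auto simp: nth_list_update flip_sign_skeleton)
  show "agree_off (set v) \<Phi> (flip_last v \<Phi>)"
    using skel unfolding agree_off_def flip by (auto simp: v)
  show "walk (flip_last v \<Phi>) v" using skeleton_walk_iff[OF skel] assms(2) by simp
  have "set (flip_last v \<Phi>) \<subseteq> all_clauses n"
    unfolding flip using flip_sign_props(1)[OF c(2,3)] F(1)
    by (intro order.trans[OF set_update_subset_insert]) simp
  then show "flip_last v \<Phi> \<in> tree_formulas l n m"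
    using skeleton_treelike[OF skel] F by (auto simp: tree_formulas_def formulas_def flip)
  have ex: "endv \<Phi> w = endv (flip_last v \<Phi>) w" "endv \<Phi> v = endv (flip_last v \<Phi>) v"
    using skeleton_walk[OF skel w] skeleton_walk[OF skel assms(2)] by auto
  have nth: "flip_last v \<Phi> ! b = flip_sign (other_var ?c ?x) ?c" using c(1) by (simp add: flip)
  show "last_sign (flip_last v \<Phi>) v = - last_sign \<Phi> v"
    unfolding last_sign_def v list.sel nth[unfolded v] ex(1)[unfolded v, symmetric]
    by (rule flip_sign_props(2)[OF c(2,3)])
  have "flip_last v (flip_last v \<Phi>) = (flip_last v \<Phi>)[b := flip_sign (endv \<Phi> v) (flip_last v \<Phi> ! b)]"
    unfolding ex(2) by (simp add: flip_last_def v)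
  also have "\<dots> = (flip_last v \<Phi>)[b := ?c]"
    unfolding nth using flip_sign_props(3)[OF c(2,3)] by (simp add: v)
  also have "\<dots> = \<Phi>" unfolding flip by simp
  finally show "flip_last v (flip_last v \<Phi>) = \<Phi>" .
qed

text \<open>
  The sign at the far end of the last clause of a walk is fair and independent of everything
  below.  This is where a factor 1/2 is gained per level.
\<close>

lemma sum_flip:
  fixes G :: "formula \<Rightarrow> nat list \<Rightarrow> int \<Rightarrow> real"
  assumes cong: "\<And>\<Phi> \<Phi>' v s. \<Phi> \<in> tree_formulas l n m \<Longrightarrow> agree_off (set v) \<Phi> \<Phi>' \<Longrightarrow> walk \<Phi> v \<Longrightarrow>
      length v = Suc i \<Longrightarrow> G \<Phi> v s = G \<Phi>' v s"
  shows "(\<Sum>\<Phi>\<in>tree_formulas l n m. \<Sum>w\<in>walks \<Phi> i. \<Sum>b\<in>exts \<Phi> w. G \<Phi> (b # w) (other_sign (\<Phi> ! b) (endv \<Phi> w))) =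
    (\<Sum>\<Phi>\<in>tree_formulas l n m. \<Sum>v\<in>walks \<Phi> (Suc i). G \<Phi> v 1 + G \<Phi> v (-1)) / 2"
proof -
  let ?F = "tree_formulas l n m"
  define V where "V = {v. set v \<subseteq> {..<m} \<and> length v = Suc i}"
  have finV: "finite V" unfolding V_def by (rule finite_lists_length_eq) simp
  have wV: "walks \<Phi> (Suc i) = {v \<in> V. walk \<Phi> v}" if "\<Phi> \<in> ?F" for \<Phi>
    using that walk_set[of \<Phi>] by (auto simp: walks_def V_def tree_formulas_def formulas_def)
  \<comment> \<open>Which walks exist varies with the formula; exchanging the sums fixes the walk,
    so that one involution serves all formulas.\<close>
  have swap: "(\<Sum>\<Phi>\<in>?F. \<Sum>v\<in>walks \<Phi> (Suc i). H \<Phi> v) = (\<Sum>v\<in>V. \<Sum>\<Phi>\<in>{\<Phi>\<in>?F. walk \<Phi> v}. H \<Phi> v)"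
    for H :: "formula \<Rightarrow> nat list \<Rightarrow> real"
  proof -
    have "(\<Sum>\<Phi>\<in>?F. \<Sum>v\<in>walks \<Phi> (Suc i). H \<Phi> v) = (\<Sum>\<Phi>\<in>?F. \<Sum>v\<in>{v \<in> V. walk \<Phi> v}. H \<Phi> v)"
      by (intro sum.cong refl wV)
    then show ?thesis using sum.swap_restrict[OF finite_tree_formulas finV, of H "walk"] by simp
  qed
  have half: "2 * (\<Sum>\<Phi>\<in>{\<Phi>\<in>?F. walk \<Phi> v}. G \<Phi> v (last_sign \<Phi> v)) =
      (\<Sum>\<Phi>\<in>{\<Phi>\<in>?F. walk \<Phi> v}. G \<Phi> v 1 + G \<Phi> v (-1))" if "v \<in> V" for v
  proof -
    have v: "v \<noteq> []" "length v = Suc i" using that by (auto simp: V_def)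
    let ?X = "{\<Phi>\<in>?F. walk \<Phi> v}"
    \<comment> \<open>Flipping negates \<open>last_sign\<close> and, by \<open>cong\<close>, changes
      nothing else in \<open>G\<close>.\<close>
    have "(\<Sum>\<Phi>\<in>?X. G \<Phi> v (last_sign \<Phi> v)) = (\<Sum>\<Phi>\<in>?X. G \<Phi> v (- last_sign \<Phi> v))"
    proof (rule sum.reindex_bij_witness[where i = "flip_last v" and j = "flip_last v"])
      fix \<Phi> assume "\<Phi> \<in> ?X"
      then have \<Phi>: "\<Phi> \<in> ?F" "walk \<Phi> v" by auto
      note fl = flip_last_props[OF \<Phi> v(1)]
      show "flip_last v (flip_last v \<Phi>) = \<Phi>" "flip_last v \<Phi> \<in> ?X" using fl by auto
      show "G (flip_last v \<Phi>) v (- last_sign (flip_last v \<Phi>) v) = G \<Phi> v (last_sign \<Phi> v)"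
        using cong[OF \<Phi>(1) fl(5) \<Phi>(2) v(2)] fl(4) by simp
    next
      fix \<Phi> assume "\<Phi> \<in> ?X"
      then have \<Phi>: "\<Phi> \<in> ?F" "walk \<Phi> v" by auto
      note fl = flip_last_props[OF \<Phi> v(1)]
      show "flip_last v (flip_last v \<Phi>) = \<Phi>" "flip_last v \<Phi> \<in> ?X" using fl by auto
    qed
    then have "2 * (\<Sum>\<Phi>\<in>?X. G \<Phi> v (last_sign \<Phi> v)) =
        (\<Sum>\<Phi>\<in>?X. G \<Phi> v (last_sign \<Phi> v) + G \<Phi> v (- last_sign \<Phi> v))"
      by (simp add: sum.distrib)
    also have "\<dots> = (\<Sum>\<Phi>\<in>?X. G \<Phi> v 1 + G \<Phi> v (-1))"
    proof (intro sum.cong refl)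
      fix \<Phi> assume "\<Phi> \<in> ?X"
      then have \<Phi>: "set \<Phi> \<subseteq> all_clauses n" "walk \<Phi> v" by (auto simp: tree_formulas_def formulas_def)
      have "last_sign \<Phi> v \<in> {1, -1}"
        using v(1) \<Phi> signs(2)[OF \<Phi>(1), of "hd v" "tl v"] by (cases v) (auto simp: last_sign_def)
      then show "G \<Phi> v (last_sign \<Phi> v) + G \<Phi> v (- last_sign \<Phi> v) = G \<Phi> v 1 + G \<Phi> v (-1)" by auto
    qed
    finally show ?thesis .
  qed
  have "(\<Sum>\<Phi>\<in>?F. \<Sum>w\<in>walks \<Phi> i. \<Sum>b\<in>exts \<Phi> w. G \<Phi> (b # w) (other_sign (\<Phi> ! b) (endv \<Phi> w))) =
    (\<Sum>\<Phi>\<in>?F. \<Sum>v\<in>walks \<Phi> (Suc i). G \<Phi> v (last_sign \<Phi> v))"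
    unfolding sum_walks_Suc by (simp add: last_sign_def)
  also have "\<dots> = (\<Sum>v\<in>V. \<Sum>\<Phi>\<in>{\<Phi>\<in>?F. walk \<Phi> v}. G \<Phi> v (last_sign \<Phi> v))"
    by (rule swap)
  also have "\<dots> = (\<Sum>v\<in>V. \<Sum>\<Phi>\<in>{\<Phi>\<in>?F. walk \<Phi> v}. G \<Phi> v 1 + G \<Phi> v (-1)) / 2"
  proof -
    have "2 * (\<Sum>v\<in>V. \<Sum>\<Phi>\<in>{\<Phi>\<in>?F. walk \<Phi> v}. G \<Phi> v (last_sign \<Phi> v)) =
        (\<Sum>v\<in>V. \<Sum>\<Phi>\<in>{\<Phi>\<in>?F. walk \<Phi> v}. G \<Phi> v 1 + G \<Phi> v (-1))"
      by (subst sum_distrib_left, rule sum.cong[OF refl half])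
    then show ?thesis by simp
  qed
  also have "\<dots> = (\<Sum>\<Phi>\<in>?F. \<Sum>v\<in>walks \<Phi> (Suc i). G \<Phi> v 1 + G \<Phi> v (-1)) / 2"
    by (simp only: swap)
  finally show ?thesis .
qed

definition total_walks :: "nat \<Rightarrow> nat \<Rightarrow> nat \<Rightarrow> nat \<Rightarrow> real" where
  "total_walks l n m k = (\<Sum>\<Phi>\<in>tree_formulas l n m. real (card (walks \<Phi> k)))"

definition total_alt :: "nat \<Rightarrow> nat \<Rightarrow> nat \<Rightarrow> nat \<Rightarrow> nat \<Rightarrow> real" where
  "total_alt l n m k j = (\<Sum>\<Phi>\<in>tree_formulas l n m. \<Sum>w\<in>walks \<Phi> k. alt \<Phi> j w 1 + alt \<Phi> j w (-1))"

definition total_bnd :: "nat \<Rightarrow> nat \<Rightarrow> nat \<Rightarrow> nat \<Rightarrow> nat \<Rightarrow> nat \<Rightarrow> real" where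
  "total_bnd l n m L k j = (\<Sum>\<Phi>\<in>tree_formulas l n m. \<Sum>w\<in>walks \<Phi> k. bnd \<Phi> L j w 1 + bnd \<Phi> L j w (-1))"

lemma total_alt_Suc:
  assumes "i + Suc j \<le> l"
  shows "total_alt l n m i (Suc j) = total_alt l n m (Suc i) j / 2"
proof -
  have "total_alt l n m i (Suc j) = (\<Sum>\<Phi>\<in>tree_formulas l n m. \<Sum>w\<in>walks \<Phi> i. \<Sum>b\<in>exts \<Phi> w.
      alt \<Phi> j (b # w) (- other_sign (\<Phi> ! b) (endv \<Phi> w)))"
    unfolding total_alt_def
    by (intro sum.cong refl alt_sum_Suc[of _ n]) (auto simp: tree_formulas_def formulas_def)
  also have "\<dots> = (\<Sum>\<Phi>\<in>tree_formulas l n m. \<Sum>v\<in>walks \<Phi> (Suc i). alt \<Phi> j v (- 1) + alt \<Phi> j v (- (- 1))) / 2"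
    by (rule sum_flip[where G = "\<lambda>\<Phi> v s. alt \<Phi> j v (- s)"], rule alt_cong[of _ n l])
      (use assms in \<open>auto simp: tree_formulas_def formulas_def\<close>)
  finally show ?thesis by (simp add: total_alt_def add.commute)
qed

text \<open>The factor 2 counts both values at depth 0. Every level halves, since a clause passes on
  only one of the two values of its far end.\<close>

lemma total_alt_eq: "i + j \<le> l \<Longrightarrow> total_alt l n m i j = 2 * total_walks l n m (i + j) / 2 ^ j"
proof (induction j arbitrary: i)
  case 0
  show ?case by (simp add: total_alt_def total_walks_def sum_distrib_left mult.commute)
next
  case (Suc j)
  then show ?case using total_alt_Suc[of i j l n m] by simp
qed

lemma total_bnd_Suc:
  assumes "i + Suc j + L \<le> l"
  shows "total_bnd l n m L i (Suc j) = total_bnd l n m L (Suc i) j / 2"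
proof -
  let ?G = "\<lambda>\<Phi> v s. softplus (bnd \<Phi> L j v (- s)) - softplus (- bnd \<Phi> L j v s)"
  have "total_bnd l n m L i (Suc j) = (\<Sum>\<Phi>\<in>tree_formulas l n m. \<Sum>w\<in>walks \<Phi> i. \<Sum>b\<in>exts \<Phi> w.
      ?G \<Phi> (b # w) (other_sign (\<Phi> ! b) (endv \<Phi> w)))"
    unfolding total_bnd_def
    by (intro sum.cong refl bnd_sum_Suc[of _ n]) (auto simp: tree_formulas_def formulas_def)
  also have "\<dots> = (\<Sum>\<Phi>\<in>tree_formulas l n m. \<Sum>v\<in>walks \<Phi> (Suc i). ?G \<Phi> v 1 + ?G \<Phi> v (- 1)) / 2"
  proof (rule sum_flip)
    fix \<Phi> \<Phi>' v s
    assume "\<Phi> \<in> tree_formulas l n m" and a: "agree_off (set v) \<Phi> \<Phi>'" "walk \<Phi> v" "length v = Suc i"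
    then have \<Phi>: "set \<Phi> \<subseteq> all_clauses n" "treelike l \<Phi>" by (auto simp: tree_formulas_def formulas_def)
    have "length v + j + L \<le> l" using a(3) assms by simp
    from bnd_cong[OF \<Phi> a(1,2) this] show "?G \<Phi> v s = ?G \<Phi>' v s" by simp
  qed
  also have "\<dots> = total_bnd l n m L (Suc i) j / 2"
    unfolding total_bnd_def
  proof (intro arg_cong2[where f = "(/)"] sum.cong refl)
    fix \<Phi> v
    show "?G \<Phi> v 1 + ?G \<Phi> v (- 1) = bnd \<Phi> L j v 1 + bnd \<Phi> L j v (- 1)"
      \<comment> \<open>Over both signs the four terms regroup by bound: each \<open>bnd\<close>
        meets its own negative, so that nothing is lost in the estimate.\<close>
      using softplus_minus[of "bnd \<Phi> L j v 1"] softplus_minus[of "bnd \<Phi> L j v (-1)"] by simp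
  qed
  finally show ?thesis .
qed

lemma total_bnd_eq: "i + j + L \<le> l \<Longrightarrow> total_bnd l n m L i j = total_bnd l n m L (i + j) 0 / 2 ^ j"
proof (induction j arbitrary: i)
  case (Suc j)
  then show ?case using total_bnd_Suc[of i j L l n m] by simp
qed simp

lemma total_bnd_0: "total_bnd l n m L k 0 = ln 2 * (\<Sum>j = 1..L. total_alt l n m k j)"
proof -
  have "total_bnd l n m L k 0 = ln 2 * (\<Sum>\<Phi>\<in>tree_formulas l n m. \<Sum>w\<in>walks \<Phi> k. \<Sum>j = 1..L. alt \<Phi> j w 1 + alt \<Phi> j w (-1))"
    by (simp add: total_bnd_def sum_distrib_left sum.distrib distrib_left)
  also have "\<dots> = ln 2 * (\<Sum>j = 1..L. total_alt l n m k j)"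
    unfolding total_alt_def
    by (subst sum.swap, subst (2) sum.swap) (rule refl)
  finally show ?thesis .
qed

text \<open>The \<open>k\<close> halvings of the width combine with the \<open>j\<close> halvings
  along alternating walks below level \<open>k\<close>; walks of length \<open>k + j\<close> remain
  to be counted.\<close>

lemma sum_bnd_root:
  "(\<Sum>\<Phi>\<in>tree_formulas (L + k) n m. bnd \<Phi> L k [] 1 + bnd \<Phi> L k [] (-1)) =
    2 * ln 2 / 2 ^ k * (\<Sum>j = 1..L. total_walks (L + k) n m (k + j) / 2 ^ j)"
proof -
  have "(\<Sum>\<Phi>\<in>tree_formulas (L + k) n m. bnd \<Phi> L k [] 1 + bnd \<Phi> L k [] (-1)) = total_bnd (L + k) n m L 0 k"
    by (simp add: total_bnd_def)
  also have "\<dots> = ln 2 * (\<Sum>j = 1..L. total_alt (L + k) n m k j) / 2 ^ k"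
    by (simp add: total_bnd_eq total_bnd_0)
  also have "(\<Sum>j = 1..L. total_alt (L + k) n m k j) = (\<Sum>j = 1..L. 2 * (total_walks (L + k) n m (k + j) / 2 ^ j))"
    by (intro sum.cong refl) (simp add: total_alt_eq)
  also have "\<dots> = 2 * (\<Sum>j = 1..L. total_walks (L + k) n m (k + j) / 2 ^ j)"
    by (rule sum_distrib_left[symmetric])
  finally show ?thesis by simp
qed

section \<open>First moments\<close>

lemma card_all_clauses: "card (all_clauses n) = 4 * n * (n - 1)"
proof -
  have eq: "all_clauses n = (\<lambda>((x, y), (r, s)). ((x, r), (y, s))) `
      ((SIGMA x:{1..n}. {1..n} - {x}) \<times> ({1, -1} \<times> {1, -1}))"
    by (force simp: all_clauses_def image_iff)
  have "inj_on (\<lambda>((x, y), (r, s)). ((x, r), (y, s)))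
      ((SIGMA x:{1..n}. {1..n} - {x}) \<times> ({1, -1 :: int} \<times> {1, -1 :: int}))"
    by (auto simp: inj_on_def)
  then show ?thesis
    unfolding eq by (simp add: card_image card_cartesian_product)
qed

text \<open>Two positions for \<open>x\<close>, \<open>n - 1\<close> partners and four sign
  patterns.\<close>

lemma card_clauses_at:
  assumes "x \<in> {1..n}"
  shows "card {c \<in> all_clauses n. x \<in> clause_vars c} \<le> 8 * (n - 1)"
proof -
  let ?A = "({1..n} - {x}) \<times> ({1, -1 :: int} \<times> {1, -1 :: int})"
  let ?f = "\<lambda>(y, (r, s)). ((x, r), (y, s))" and ?g = "\<lambda>(y, (r, s)). ((y, r), (x, s))"
  have sub: "{c \<in> all_clauses n. x \<in> clause_vars c} \<subseteq> ?f ` ?A \<union> ?g ` ?A"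
    by (force simp: image_iff elim!: clause_cases)
  have "card (?f ` ?A \<union> ?g ` ?A) \<le> card ?A + card ?A"
    by (intro order.trans[OF card_Un_le] add_mono card_image_le) auto
  also have "\<dots> = 8 * (n - 1)" using assms by (simp add: card_cartesian_product)
  finally show ?thesis using card_mono[OF _ sub] by fastforce
qed

section \<open>Occurrences of clause patterns at distinct positions\<close>

definition index_lists :: "nat \<Rightarrow> nat \<Rightarrow> nat list set" where
  "index_lists m k = {bs. length bs = k \<and> distinct bs \<and> set bs \<subseteq> {..<m}}"

lemma finite_index_lists [simp]: "finite (index_lists m k)"
  by (rule finite_subset[OF _ finite_lists_length_eq[of "{..<m}" k]]) (auto simp: index_lists_def)

lemma card_index_lists:
  "real (card (index_lists m k)) = (if k \<le> m then fact m / fact (m - k) else 0)"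
proof (cases "k \<le> m")
  case True
  then have "card (index_lists m k) = fact m div fact (m - k)"
    unfolding index_lists_def using card_lists_distinct_length_eq[of "{..<m}" k]
    by (simp add: fact_div_fact)
  then show ?thesis using True by (simp add: real_of_nat_div fact_dvd)
next
  case False
  then have "index_lists m k = {}"
    using card_mono[of "{..<m}"] by (fastforce simp: index_lists_def distinct_card[symmetric])
  with False show ?thesis by simp
qed

text \<open>The common random variable of all first moments: \<L> collects the clause sequences that
  a walk, a dense subformula or a bicycle may have, and distinct positions match factorial
  moments.\<close>

definition occurrences :: "clause list set \<Rightarrow> nat \<Rightarrow> formula \<Rightarrow> nat list set" where
  "occurrences \<L> k \<Phi> = {bs \<in> index_lists (length \<Phi>) k. map ((!) \<Phi>) bs \<in> \<L>}"

lemma finite_occurrences [simp]: "finite (occurrences \<L> k \<Phi>)"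
  by (simp add: occurrences_def)

lemma card_formulas: "card (formulas n m) = card (all_clauses n) ^ m"
  unfolding formulas_def by (rule card_lists_length_eq) simp

lemma card_formulas_fixed:
  assumes "bs \<in> index_lists m k"
  shows "card {\<Phi> \<in> formulas n m. map ((!) \<Phi>) bs = cs} \<le> card (all_clauses n) ^ (m - k)"
proof -
  let ?I = "{..<m} - set bs"
  let ?X = "{\<Phi> \<in> formulas n m. map ((!) \<Phi>) bs = cs}"
  have bs: "set bs \<subseteq> {..<m}" "card (set bs) = k"
    using assms by (auto simp: index_lists_def distinct_card)
  have "card ?X \<le> card (?I \<rightarrow>\<^sub>E all_clauses n)"
  proof (rule card_inj_on_le[where f = "\<lambda>\<Phi>. restrict ((!) \<Phi>) ?I"])
    show "inj_on (\<lambda>\<Phi>. restrict ((!) \<Phi>) ?I) ?X"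
    proof (rule inj_onI)
      fix \<Phi> \<Phi>' assume X: "\<Phi> \<in> ?X" "\<Phi>' \<in> ?X" and eq: "restrict ((!) \<Phi>) ?I = restrict ((!) \<Phi>') ?I"
      have "map ((!) \<Phi>) bs = map ((!) \<Phi>') bs" using X by simp
      then have on: "\<Phi> ! i = \<Phi>' ! i" if "i \<in> set bs" for i using that by (simp add: map_eq_conv)
      have off: "\<Phi> ! i = \<Phi>' ! i" if "i \<in> ?I" for i using fun_cong[OF eq, of i] that by simp
      show "\<Phi> = \<Phi>'"
        by (rule nth_equalityI) (use X on off in \<open>auto simp: formulas_def\<close>)
    qed
    show "(\<lambda>\<Phi>. restrict ((!) \<Phi>) ?I) ` ?X \<subseteq> ?I \<rightarrow>\<^sub>E all_clauses n"
      by (auto simp: formulas_def PiE_iff split: if_splits intro: subsetD[OF _ nth_mem])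
  qed (auto intro!: finite_PiE)
  also have "\<dots> = card (all_clauses n) ^ (m - k)"
    using bs by (simp add: card_PiE card_Diff_subset finite_subset[OF bs(1)])
  finally show ?thesis .
qed

lemma sum_occurrences_le:
  assumes "finite \<L>"
  shows "(\<Sum>\<Phi>\<in>formulas n m. card (occurrences \<L> k \<Phi>)) \<le>
    card (index_lists m k) * (card \<L> * card (all_clauses n) ^ (m - k))"
proof -
  have "(\<Sum>\<Phi>\<in>formulas n m. card (occurrences \<L> k \<Phi>)) =
    (\<Sum>\<Phi>\<in>formulas n m. \<Sum>bs\<in>{bs \<in> index_lists m k. map ((!) \<Phi>) bs \<in> \<L>}. 1)"
    by (intro sum.cong) (auto simp: occurrences_def formulas_def)
  also have "\<dots> = (\<Sum>bs\<in>index_lists m k. \<Sum>\<Phi>\<in>{\<Phi> \<in> formulas n m. map ((!) \<Phi>) bs \<in> \<L>}. 1)"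
    by (rule sum.swap_restrict) simp_all
  also have "\<dots> = (\<Sum>bs\<in>index_lists m k. card {\<Phi> \<in> formulas n m. map ((!) \<Phi>) bs \<in> \<L>})" by simp
  also have "\<dots> \<le> (\<Sum>bs\<in>index_lists m k. card \<L> * card (all_clauses n) ^ (m - k))"
  proof (rule sum_mono)
    fix bs assume bs: "bs \<in> index_lists m k"
    have "{\<Phi> \<in> formulas n m. map ((!) \<Phi>) bs \<in> \<L>} = (\<Union>cs\<in>\<L>. {\<Phi> \<in> formulas n m. map ((!) \<Phi>) bs = cs})"
      by auto
    also have "card \<dots> \<le> (\<Sum>cs\<in>\<L>. card {\<Phi> \<in> formulas n m. map ((!) \<Phi>) bs = cs})"
      by (rule card_UN_le[OF assms])
    also have "\<dots> \<le> (\<Sum>cs\<in>\<L>. card (all_clauses n) ^ (m - k))"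
      by (intro sum_mono card_formulas_fixed bs)
    finally show "card {\<Phi> \<in> formulas n m. map ((!) \<Phi>) bs \<in> \<L>} \<le> card \<L> * card (all_clauses n) ^ (m - k)"
      by simp
  qed
  finally show ?thesis by simp
qed

section \<open>The random formula as a Poisson mixture of uniform formulas\<close>

lemma pair_pmf_of_set:
  assumes "finite A" "A \<noteq> {}" "finite B" "B \<noteq> {}"
  shows "pair_pmf (pmf_of_set A) (pmf_of_set B) = pmf_of_set (A \<times> B)"
proof (rule pmf_eqI)
  fix p :: "'a \<times> 'b"
  obtain a b where p: "p = (a, b)" by (cases p)
  have "A \<times> B \<noteq> {}" "finite (A \<times> B)" using assms by auto
  then show "pmf (pair_pmf (pmf_of_set A) (pmf_of_set B)) p = pmf (pmf_of_set (A \<times> B)) p"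
    using assms by (simp add: p pmf_pair indicator_def card_cartesian_product)
qed

lemma replicate_pmf_of_set:
  assumes "finite A" "A \<noteq> {}"
  shows "replicate_pmf m (pmf_of_set A) = pmf_of_set {xs. set xs \<subseteq> A \<and> length xs = m}"
proof (induction m)
  case 0
  have "{xs. set xs \<subseteq> A \<and> length xs = 0} = {[]}" by auto
  then show ?case by (simp add: pmf_of_set_singleton)
next
  case (Suc m)
  let ?X = "{xs. set xs \<subseteq> A \<and> length xs = m}"
  have fin: "finite ?X" by (rule finite_lists_length_eq[OF assms(1)])
  have ne: "?X \<noteq> {}" using assms(2) by (auto intro!: exI[of _ "replicate m (SOME a. a \<in> A)"] some_in_eq[THEN iffD2])
  have "replicate_pmf (Suc m) (pmf_of_set A) = map_pmf (\<lambda>(x, xs). x # xs) (pair_pmf (pmf_of_set A) (pmf_of_set ?X))"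
    by (simp add: Suc pair_pmf_def map_pmf_def bind_assoc_pmf bind_return_pmf)
  also have "pair_pmf (pmf_of_set A) (pmf_of_set ?X) = pmf_of_set (A \<times> ?X)"
    by (rule pair_pmf_of_set[OF assms fin ne])
  also have "map_pmf (\<lambda>(x, xs). x # xs) \<dots> = pmf_of_set ((\<lambda>(x, xs). x # xs) ` (A \<times> ?X))"
    using assms fin ne by (intro map_pmf_of_set_inj) (auto simp: inj_on_def)
  also have "(\<lambda>(x, xs). x # xs) ` (A \<times> ?X) = {xs. set xs \<subseteq> A \<and> length xs = Suc m}"
    by (force simp: length_Suc_conv image_iff)
  finally show ?case .
qed

text \<open>
  \<open>card (index_lists m k)\<close> is the falling factorial \<open>m (m - 1) \<dots> (m - k + 1)\<close>.
\<close>

lemma poisson_factorial_moment: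
  assumes "rate > 0"
  shows "(\<integral>\<^sup>+m. ennreal (real (card (index_lists m k))) \<partial>poisson_pmf rate) = ennreal (rate ^ k)"
proof -
  let ?f = "\<lambda>m. rate ^ m / fact m * exp (- rate) * real (card (index_lists m k))"
  have "(\<lambda>j. ?f (j + k)) = (\<lambda>j. (rate ^ k * exp (- rate)) * (rate ^ j /\<^sub>R fact j))"
    by (auto simp: card_index_lists fun_eq_iff power_add divide_simps)
  moreover have "(\<lambda>j. (rate ^ k * exp (- rate)) * (rate ^ j /\<^sub>R fact j)) sums ((rate ^ k * exp (- rate)) * exp rate)"
    by (intro sums_mult exp_converges)
  moreover have "(rate ^ k * exp (- rate)) * exp rate = rate ^ k"
    by (simp add: mult.assoc flip: exp_add)
  ultimately have "(\<lambda>j. ?f (j + k)) sums (rate ^ k)" by metis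
  \<comment> \<open>Terms with fewer than \<open>k\<close> clauses vanish, so the series may be
    shifted by \<open>k\<close> onto the exponential series.\<close>
  moreover have "(\<Sum>m<k. ?f m) = 0" by (rule sum.neutral) (simp add: card_index_lists)
  ultimately have sums: "?f sums (rate ^ k)" using sums_iff_shift[of ?f k "rate ^ k"] by simp
  have "(\<integral>\<^sup>+m. ennreal (real (card (index_lists m k))) \<partial>poisson_pmf rate) = (\<Sum>m. ennreal (?f m))"
    using assms by (simp add: nn_integral_measure_pmf nn_integral_count_space_nat ennreal_mult'[symmetric])
  also have "\<dots> = ennreal (rate ^ k)"
    using sums assms by (subst suminf_ennreal2) (auto simp: sums_iff)
  finally show ?thesis .
qed

context
  fixes n :: nat and d :: real
  assumes n: "n \<ge> 2" and d: "d > 0"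
begin

lemma all_clauses_nonempty: "all_clauses n \<noteq> {}" "card (all_clauses n) > 0"
proof -
  show "card (all_clauses n) > 0" using n by (simp add: card_all_clauses)
  then show "all_clauses n \<noteq> {}" by auto
qed

lemma nn_integral_random_formula:
  assumes "\<And>\<Phi>. f \<Phi> \<ge> 0"
  shows "(\<integral>\<^sup>+\<Phi>. ennreal (f \<Phi>) \<partial>random_formula d n) =
    (\<integral>\<^sup>+m. ennreal ((\<Sum>\<Phi>\<in>formulas n m. f \<Phi>) / real (card (all_clauses n)) ^ m) \<partial>poisson_pmf (d * real n / 2))"
proof -
  have ne: "formulas n m \<noteq> {}" for m
    using all_clauses_nonempty card_formulas[of n m] by (metis card.empty less_not_refl zero_less_power)
  have rep: "replicate_pmf m (pmf_of_set (all_clauses n)) = pmf_of_set (formulas n m)" for m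
    unfolding formulas_def by (rule replicate_pmf_of_set) (simp_all add: all_clauses_nonempty)
  have "(\<integral>\<^sup>+\<Phi>. ennreal (f \<Phi>) \<partial>pmf_of_set (formulas n m)) =
      ennreal ((\<Sum>\<Phi>\<in>formulas n m. f \<Phi>) / real (card (all_clauses n)) ^ m)" for m
  proof -
    have "(\<integral>\<^sup>+\<Phi>. ennreal (f \<Phi>) \<partial>pmf_of_set (formulas n m)) =
        ennreal (\<Sum>\<Phi>\<in>formulas n m. f \<Phi>) / of_nat (card (all_clauses n) ^ m)"
      using ne[of m] assms by (simp add: nn_integral_pmf_of_set sum_ennreal card_formulas)
    also have "of_nat (card (all_clauses n) ^ m) = ennreal (real (card (all_clauses n)) ^ m)"
      by (simp only: ennreal_of_nat_eq_real_of_nat of_nat_power)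
    also have "ennreal (\<Sum>\<Phi>\<in>formulas n m. f \<Phi>) / \<dots> =
        ennreal ((\<Sum>\<Phi>\<in>formulas n m. f \<Phi>) / real (card (all_clauses n)) ^ m)"
      using all_clauses_nonempty assms by (intro divide_ennreal sum_nonneg) auto
    finally show ?thesis .
  qed
  then show ?thesis unfolding random_formula_def by (simp add: rep)
qed

lemma nn_integral_random_formula_mono:
  assumes "\<And>\<Phi>. f \<Phi> \<ge> 0" "\<And>\<Phi>. g \<Phi> \<ge> 0"
    and "\<And>m. (\<Sum>\<Phi>\<in>formulas n m. f \<Phi>) \<le> (\<Sum>\<Phi>\<in>formulas n m. g \<Phi>)"
  shows "(\<integral>\<^sup>+\<Phi>. ennreal (f \<Phi>) \<partial>random_formula d n) \<le> (\<integral>\<^sup>+\<Phi>. ennreal (g \<Phi>) \<partial>random_formula d n)"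
  unfolding nn_integral_random_formula[OF assms(1)] nn_integral_random_formula[OF assms(2)]
  by (intro nn_integral_mono ennreal_leI divide_right_mono assms) simp

text \<open>A prescribed clause has probability \<open>1 / (4 * n * (n - 1))\<close> at a given
  position, and the factorial moment supplies a factor \<open>d * n / 2\<close> per clause; the
  product is the constant \<open>d / (8 * (n - 1))\<close>.\<close>

lemma expected_occurrences:
  assumes "finite \<L>"
  shows "(\<integral>\<^sup>+\<Phi>. ennreal (real (card (occurrences \<L> k \<Phi>))) \<partial>random_formula d n) \<le>
    ennreal (real (card \<L>) * (d / (8 * (real n - 1))) ^ k)"
proof -
  let ?N = "card (all_clauses n)"
  have N: "real ?N > 0" using all_clauses_nonempty by simp
  have "real (\<Sum>\<Phi>\<in>formulas n m. card (occurrences \<L> k \<Phi>)) / real ?N ^ m \<le>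
     real (card (index_lists m k)) * (real (card \<L>) / real ?N ^ k)" for m
  proof (cases "k \<le> m")
    case True
    have "real (\<Sum>\<Phi>\<in>formulas n m. card (occurrences \<L> k \<Phi>)) / real ?N ^ m \<le>
        real (card (index_lists m k) * (card \<L> * ?N ^ (m - k))) / real ?N ^ m"
      by (intro divide_right_mono of_nat_mono sum_occurrences_le assms) simp
    also have "\<dots> = real (card (index_lists m k)) * (real (card \<L>) / real ?N ^ k)"
    proof -
      have "real ?N ^ m = real ?N ^ k * real ?N ^ (m - k)" using True by (simp flip: power_add)
      moreover have "real ?N ^ (m - k) \<noteq> 0" using N by (metis less_irrefl power_not_zero)
      ultimately show ?thesis by (simp del: power_eq_0_iff)
    qed
    finally show ?thesis .
  next
    case False
    then have "card (index_lists m k) = 0" using card_index_lists[of m k] by simp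
    with sum_occurrences_le[OF assms, where n = n and m = m and k = k]
    have "(\<Sum>\<Phi>\<in>formulas n m. card (occurrences \<L> k \<Phi>)) = 0" by simp
    then show ?thesis by (simp only: of_nat_0) simp
  qed
  then have "(\<integral>\<^sup>+\<Phi>. ennreal (real (card (occurrences \<L> k \<Phi>))) \<partial>random_formula d n) \<le>
    (\<integral>\<^sup>+m. ennreal (real (card (index_lists m k)) * (real (card \<L>) / real ?N ^ k)) \<partial>poisson_pmf (d * real n / 2))"
    by (subst nn_integral_random_formula) (auto intro!: nn_integral_mono ennreal_leI)
  also have "\<dots> = (\<integral>\<^sup>+m. ennreal (real (card (index_lists m k))) * ennreal (real (card \<L>) / real ?N ^ k) \<partial>poisson_pmf (d * real n / 2))"
    by (intro nn_integral_cong ennreal_mult) simp_all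
  also have "\<dots> = ennreal ((d * real n / 2) ^ k) * ennreal (real (card \<L>) / real ?N ^ k)"
    using n d by (subst nn_integral_multc) (simp_all add: poisson_factorial_moment)
  also have "\<dots> = ennreal (real (card \<L>) * ((d * real n / 2) / real ?N) ^ k)"
    using n d by (simp add: ennreal_mult'[symmetric] power_divide)
  also have "(d * real n / 2) / real ?N = d / (8 * (real n - 1))"
    using n by (simp add: card_all_clauses of_nat_diff field_simps)
  finally show ?thesis .
qed

end

section \<open>Expected number of walks\<close>

fun end_var :: "clause list \<Rightarrow> nat" where
  "end_var [] = 1"
| "end_var (c # cs) = other_var c (end_var cs)"

text \<open>Clause sequences of walks with the positions forgotten. A clause may follow itself here,
  since only an upper bound is counted.\<close>

fun clause_paths :: "nat \<Rightarrow> nat \<Rightarrow> clause list set" where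
  "clause_paths n 0 = {[]}"
| "clause_paths n (Suc k) =
     (\<lambda>(cs, c). c # cs) ` (SIGMA cs:clause_paths n k. {c \<in> all_clauses n. end_var cs \<in> clause_vars c})"

lemma clause_paths_props:
  assumes "1 \<le> n"
  shows "finite (clause_paths n k)" "cs \<in> clause_paths n k \<Longrightarrow> end_var cs \<in> {1..n}"
    "card (clause_paths n k) \<le> (8 * (n - 1)) ^ k"
proof -
  show fin: "finite (clause_paths n k)" for k by (induction k) auto
  show ev: "cs \<in> clause_paths n k \<Longrightarrow> end_var cs \<in> {1..n}" for cs k
  proof (induction k arbitrary: cs)
    case (Suc k)
    then obtain c cs' where "cs = c # cs'" "c \<in> all_clauses n" "end_var cs' \<in> clause_vars c" by auto
    then show ?case using clause_facts(9) by simp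
  qed (use assms in simp)
  show "card (clause_paths n k) \<le> (8 * (n - 1)) ^ k"
  proof (induction k)
    case (Suc k)
    have "card (clause_paths n (Suc k)) \<le>
        card (SIGMA cs:clause_paths n k. {c \<in> all_clauses n. end_var cs \<in> clause_vars c})"
      unfolding clause_paths.simps using fin by (intro card_image_le) auto
    also have "\<dots> = (\<Sum>cs\<in>clause_paths n k. card {c \<in> all_clauses n. end_var cs \<in> clause_vars c})"
      using fin by (intro card_SigmaI) auto
    also have "\<dots> \<le> (\<Sum>cs\<in>clause_paths n k. 8 * (n - 1))"
      by (intro sum_mono card_clauses_at ev)
    also have "\<dots> \<le> (8 * (n - 1)) ^ Suc k" using mult_le_mono1[OF Suc, of "8 * (n - 1)"] by (simp add: mult_ac)
    finally show ?case .
  qed simp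
qed

lemma walk_clause_path:
  assumes "set \<Phi> \<subseteq> all_clauses n"
  shows "walk \<Phi> w \<Longrightarrow> map ((!) \<Phi>) w \<in> clause_paths n (length w) \<and> end_var (map ((!) \<Phi>) w) = endv \<Phi> w"
proof (induction w)
  case (Cons b w)
  then have "b \<in> exts \<Phi> w" by simp
  note exts_facts(2,3)[OF assms this]
  with Cons show ?case by (auto simp: image_iff)
qed simp

text \<open>The \<open>8 * (n - 1)\<close> choices per step cancel the cost
  \<open>d / (8 * (n - 1))\<close> per clause up to \<open>d\<close>, so the bound carries no error
  term in \<open>n\<close>.\<close>

lemma expected_walks:
  assumes n: "n \<ge> 2" and d: "d > 0" and "k \<le> l"
  shows "(\<integral>\<^sup>+\<Phi>. ennreal (of_bool (set \<Phi> \<subseteq> all_clauses n \<and> treelike l \<Phi>) * real (card (walks \<Phi> k))) \<partial>random_formula d n)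
    \<le> ennreal (d ^ k)"
proof -
  have n1: "1 \<le> n" using n by simp
  have "of_bool (set \<Phi> \<subseteq> all_clauses n \<and> treelike l \<Phi>) * real (card (walks \<Phi> k)) \<le>
     real (card (occurrences (clause_paths n k) k \<Phi>))" for \<Phi>
  proof (cases "set \<Phi> \<subseteq> all_clauses n \<and> treelike l \<Phi>")
    case True
    have "walks \<Phi> k \<subseteq> occurrences (clause_paths n k) k \<Phi>"
    proof
      fix w assume "w \<in> walks \<Phi> k"
      then have w: "walk \<Phi> w" "length w = k" by (auto simp: walks_def)
      with walk_distinct[of \<Phi> n l w] walk_clause_path[of \<Phi> n w] walk_set[of \<Phi> w] True assms(3)
      show "w \<in> occurrences (clause_paths n k) k \<Phi>" by (auto simp: occurrences_def index_lists_def)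
    qed
    then show ?thesis using True by (simp add: card_mono)
  qed auto
  then have "(\<integral>\<^sup>+\<Phi>. ennreal (of_bool (set \<Phi> \<subseteq> all_clauses n \<and> treelike l \<Phi>) * real (card (walks \<Phi> k))) \<partial>random_formula d n)
    \<le> (\<integral>\<^sup>+\<Phi>. ennreal (real (card (occurrences (clause_paths n k) k \<Phi>))) \<partial>random_formula d n)"
    by (intro nn_integral_mono ennreal_leI) simp
  also have "\<dots> \<le> ennreal (real (card (clause_paths n k)) * (d / (8 * (real n - 1))) ^ k)"
    by (rule expected_occurrences[OF n d clause_paths_props(1)[OF n1]])
  also have "\<dots> \<le> ennreal (real ((8 * (n - 1)) ^ k) * (d / (8 * (real n - 1))) ^ k)"
    using n d by (intro ennreal_leI mult_right_mono of_nat_mono clause_paths_props(3)) auto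
  also have "real ((8 * (n - 1)) ^ k) * (d / (8 * (real n - 1))) ^ k = d ^ k"
  proof -
    define x where "x = 8 * (real n - 1)"
    have "real (8 * (n - 1)) = x" using n by (simp add: x_def of_nat_diff)
    then have "real ((8 * (n - 1)) ^ k) = x ^ k" by (simp only: of_nat_power)
    moreover have "x > 0" using n by (simp add: x_def)
    ultimately have "real ((8 * (n - 1)) ^ k) * (d / x) ^ k = d ^ k"
      by (simp only:) (simp add: power_divide)
    then show ?thesis by (simp only: x_def)
  qed
  finally show ?thesis .
qed

section \<open>Probability that the ball is not tree-like\<close>

definition dense_lists :: "nat \<Rightarrow> nat \<Rightarrow> clause list set" where
  "dense_lists n k = (\<Union>V\<in>{V. V \<subseteq> {1..n} \<and> 1 \<in> V \<and> card V = k}.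
     {cs. set cs \<subseteq> {c \<in> all_clauses n. clause_vars c \<subseteq> V} \<and> length cs = k})"

text \<open>Variable 1 is prescribed, so only \<open>k - 1\<close> variables are chosen;
  \<open>4 * k\<^sup>2\<close> is the number of ordered pairs of literals over
  \<open>V\<close>.\<close>

lemma card_dense_lists:
  assumes "k \<ge> 1"
  shows "finite (dense_lists n k)" "card (dense_lists n k) \<le> n ^ (k - 1) * (4 * k\<^sup>2) ^ k"
proof -
  let ?\<V> = "{V. V \<subseteq> {1..n} \<and> 1 \<in> V \<and> card V = k}"
  let ?C = "\<lambda>V. {c \<in> all_clauses n. clause_vars c \<subseteq> V}"
  have fin\<V>: "finite ?\<V>" by (rule finite_subset[of _ "Pow {1..n}"]) auto
  have finC: "finite {cs. set cs \<subseteq> ?C V \<and> length cs = k}" for V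
    by (rule finite_lists_length_eq) simp
  show "finite (dense_lists n k)" unfolding dense_lists_def using fin\<V> finC by blast
  have "?\<V> \<subseteq> (\<lambda>xs. insert 1 (set xs)) ` {xs. set xs \<subseteq> {1..n} \<and> length xs = k - 1}"
  proof
    fix V assume V: "V \<in> ?\<V>"
    then have finV: "finite V" using finite_subset by blast
    then obtain xs where xs: "set xs = V - {1}" "distinct xs" using finite_distinct_list[of "V - {1}"] by auto
    then have "length xs = k - 1" using V finV by (metis (mono_tags, lifting) card_Diff_singleton distinct_card mem_Collect_eq)
    moreover have "V = insert 1 (set xs)" using xs V by auto
    ultimately show "V \<in> (\<lambda>xs. insert 1 (set xs)) ` {xs. set xs \<subseteq> {1..n} \<and> length xs = k - 1}"
      using V by blast
  qed
  then have "card ?\<V> \<le> card {xs. set xs \<subseteq> {1..n} \<and> length xs = k - 1}"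
    by (rule surj_card_le[OF finite_lists_length_eq, OF finite_atLeastAtMost])
  then have card\<V>: "card ?\<V> \<le> n ^ (k - 1)" by (simp add: card_lists_length_eq)
  have cardC: "card (?C V) \<le> 4 * k\<^sup>2" if V: "V \<in> ?\<V>" for V
  proof -
    have finV: "finite V" using V finite_subset by blast
    let ?D = "(V \<times> {1, -1 :: int}) \<times> (V \<times> {1, -1 :: int})"
    have "?C V \<subseteq> ?D" by (auto elim!: clause_cases)
    then have "card (?C V) \<le> card ?D" using finV by (intro card_mono) auto
    also have "\<dots> = 4 * k\<^sup>2" using V by (simp add: card_cartesian_product power2_eq_square algebra_simps)
    finally show ?thesis .
  qed
  have "card (dense_lists n k) \<le> (\<Sum>V\<in>?\<V>. card {cs. set cs \<subseteq> ?C V \<and> length cs = k})"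
    unfolding dense_lists_def by (rule card_UN_le[OF fin\<V>])
  also have "\<dots> \<le> (\<Sum>V\<in>?\<V>. (4 * k\<^sup>2) ^ k)"
  proof (rule sum_mono)
    fix V assume "V \<in> ?\<V>"
    from power_mono[OF cardC[OF this], of k] show "card {cs. set cs \<subseteq> ?C V \<and> length cs = k} \<le> (4 * k\<^sup>2) ^ k"
      by (simp add: card_lists_length_eq)
  qed
  also have "\<dots> = card ?\<V> * (4 * k\<^sup>2) ^ k" by simp
  also have "\<dots> \<le> n ^ (k - 1) * (4 * k\<^sup>2) ^ k" by (rule mult_le_mono1[OF card\<V>])
  finally show "card (dense_lists n k) \<le> n ^ (k - 1) * (4 * k\<^sup>2) ^ k" .
qed

lemma prob_not_treelike:
  assumes n: "n \<ge> 2" and d: "d > 0"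
  shows "(\<integral>\<^sup>+\<Phi>. ennreal (of_bool (set \<Phi> \<subseteq> all_clauses n \<and> \<not> treelike l \<Phi>)) \<partial>random_formula d n)
    \<le> ennreal ((\<Sum>k = 1..2 * l + 1. (real k ^ 2 * d) ^ k) / real n)"
proof -
  have n1: "1 \<le> n" using n by simp
  have le: "of_bool (set \<Phi> \<subseteq> all_clauses n \<and> \<not> treelike l \<Phi>) \<le>
      (\<Sum>k = 1..2 * l + 1. real (card (occurrences (dense_lists n k) k \<Phi>)))" (is "_ \<le> ?S") for \<Phi>
  proof (cases "set \<Phi> \<subseteq> all_clauses n \<and> \<not> treelike l \<Phi>")
    case True
    obtain V bs where V: "V \<subseteq> {1..n}" "1 \<in> V" "card V \<le> 2 * l + 1" "distinct bs"
      "length bs = card V" "set bs \<subseteq> {..<length \<Phi>}" "\<forall>b\<in>set bs. clause_vars (\<Phi> ! b) \<subseteq> V"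
      by (rule not_treelike_dense[OF conjunct1[OF True] n1 conjunct2[OF True]])
    have "card V \<ge> 1" using V(1,2) finite_subset[OF V(1)] by (metis One_nat_def Suc_leI card_gt_0_iff empty_iff finite_atLeastAtMost)
    then have k: "card V \<in> {1..2 * l + 1}" using V(3) by simp
    have "set (map ((!) \<Phi>) bs) \<subseteq> {c \<in> all_clauses n. clause_vars c \<subseteq> V}"
    proof
      fix c assume "c \<in> set (map ((!) \<Phi>) bs)"
      then obtain b where b: "b \<in> set bs" "c = \<Phi> ! b" by auto
      then have "c \<in> set \<Phi>" using V(6) by auto
      then show "c \<in> {c \<in> all_clauses n. clause_vars c \<subseteq> V}" using True b V(7) by auto
    qed
    then have "bs \<in> occurrences (dense_lists n (card V)) (card V) \<Phi>"
      using V by (auto simp: occurrences_def index_lists_def dense_lists_def)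
    then have "card (occurrences (dense_lists n (card V)) (card V) \<Phi>) \<ge> 1"
      by (metis One_nat_def Suc_leI card_gt_0_iff empty_iff finite_occurrences)
    then have "1 \<le> real (card (occurrences (dense_lists n (card V)) (card V) \<Phi>))" by simp
    also have "\<dots> \<le> ?S" by (rule member_le_sum[OF k]) auto
    finally show ?thesis using True by simp
  next
    case False
    then have "of_bool (set \<Phi> \<subseteq> all_clauses n \<and> \<not> treelike l \<Phi>) = (0 :: real)" by auto
    also have "0 \<le> ?S" by (rule sum_nonneg) simp
    finally show ?thesis .
  qed
  have "(\<integral>\<^sup>+\<Phi>. ennreal (of_bool (set \<Phi> \<subseteq> all_clauses n \<and> \<not> treelike l \<Phi>)) \<partial>random_formula d n)
    \<le> (\<integral>\<^sup>+\<Phi>. (\<Sum>k = 1..2 * l + 1. ennreal (real (card (occurrences (dense_lists n k) k \<Phi>)))) \<partial>random_formula d n)"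
    by (subst sum_ennreal, simp) (intro nn_integral_mono ennreal_leI[OF le])
  also have "\<dots> = (\<Sum>k = 1..2 * l + 1. \<integral>\<^sup>+\<Phi>. ennreal (real (card (occurrences (dense_lists n k) k \<Phi>))) \<partial>random_formula d n)"
    by (rule nn_integral_sum) simp
  also have "\<dots> \<le> (\<Sum>k = 1..2 * l + 1. ennreal ((real k ^ 2 * d) ^ k / real n))"
  proof (rule sum_mono)
    fix k assume "k \<in> {1..2 * l + 1}"
    then have k: "k \<ge> 1" by simp
    have "(\<integral>\<^sup>+\<Phi>. ennreal (real (card (occurrences (dense_lists n k) k \<Phi>))) \<partial>random_formula d n)
        \<le> ennreal (real (card (dense_lists n k)) * (d / (8 * (real n - 1))) ^ k)"
      by (rule expected_occurrences[OF n d card_dense_lists(1)[OF k]])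
    also have "\<dots> \<le> ennreal ((real k ^ 2 * d) ^ k / real n)"
    proof (rule ennreal_leI)
      have "real (card (dense_lists n k)) * (d / (8 * (real n - 1))) ^ k \<le>
          real (n ^ (k - 1) * (4 * k\<^sup>2) ^ k) * (d / (8 * (real n - 1))) ^ k"
        using n d by (intro mult_right_mono of_nat_mono card_dense_lists(2)[OF k]) auto
      also have "\<dots> = (real n ^ k / real n) * (4 * real k ^ 2 * (d / (8 * (real n - 1)))) ^ k"
      proof -
        obtain j where j: "k = Suc j" using k by (cases k) auto
        have "real (n ^ (k - 1)) = real n ^ k / real n" using n by (simp add: j)
        then show ?thesis
          unfolding power_mult_distrib[of _ "d / (8 * (real n - 1))"] of_nat_mult by simp
      qed
      also have "\<dots> = (real n * (4 * real k ^ 2 * (d / (8 * (real n - 1))))) ^ k / real n"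
        unfolding power_mult_distrib[of "real n"] by simp
      also have "real n * (4 * real k ^ 2 * (d / (8 * (real n - 1)))) = real k ^ 2 * d * (real n / (2 * (real n - 1)))"
        using n by (simp add: field_simps)
      \<comment> \<open>\<open>n / (2 * (n - 1))\<close> is at most 1 because
        \<open>n \<ge> 2\<close>.\<close>
      also have "(real k ^ 2 * d * (real n / (2 * (real n - 1)))) ^ k / real n \<le> (real k ^ 2 * d) ^ k / real n"
        using n d by (intro divide_right_mono power_mono mult_left_le) (auto simp: field_simps)
      finally show "real (card (dense_lists n k)) * (d / (8 * (real n - 1))) ^ k \<le> (real k ^ 2 * d) ^ k / real n" .
    qed
    finally show "(\<integral>\<^sup>+\<Phi>. ennreal (real (card (occurrences (dense_lists n k) k \<Phi>))) \<partial>random_formula d n)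
        \<le> ennreal ((real k ^ 2 * d) ^ k / real n)" .
  qed
  also have "\<dots> = ennreal ((\<Sum>k = 1..2 * l + 1. (real k ^ 2 * d) ^ k) / real n)"
    unfolding sum_divide_distrib by (rule sum_ennreal) (use d in simp)
  finally show ?thesis .
qed

section \<open>Bicycles and satisfiability\<close>

definition neg :: "literal \<Rightarrow> literal" where
  "neg l = (fst l, - snd l)"

definition literals :: "nat \<Rightarrow> literal set" where
  "literals n = {1..n} \<times> {1, -1}"

text \<open>The arcs of the implication digraph; the disjuncts are the two orders in which a clause
  may list its literals.\<close>

definition implies :: "clause set \<Rightarrow> literal \<Rightarrow> literal \<Rightarrow> bool" where
  "implies S u v \<longleftrightarrow> (neg u, v) \<in> S \<or> (v, neg u) \<in> S"

lemma neg_neg [simp]: "neg (neg l) = l"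
  by (simp add: neg_def)

lemma fst_neg [simp]: "fst (neg l) = fst l"
  by (simp add: neg_def)

lemma neg_in_literals [simp]: "neg l \<in> literals n \<longleftrightarrow> l \<in> literals n"
  by (cases l) (auto simp: neg_def literals_def)

lemma neg_neq: "l \<in> literals n \<Longrightarrow> neg l \<noteq> l"
  by (auto simp: neg_def literals_def prod_eq_iff)

lemma literals_same_var: "a \<in> literals n \<Longrightarrow> b \<in> literals n \<Longrightarrow> fst a = fst b \<longleftrightarrow> a = b \<or> a = neg b"
  by (cases a; cases b) (auto simp: neg_def literals_def)

lemma finite_literals [simp]: "finite (literals n)"
  by (simp add: literals_def)

lemma implies_neg: "implies S u v \<Longrightarrow> implies S (neg v) (neg u)"
  by (auto simp: implies_def)

lemma implies_star_neg: "(implies S)\<^sup>*\<^sup>* u v \<Longrightarrow> (implies S)\<^sup>*\<^sup>* (neg v) (neg u)"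
  by (induction rule: rtranclp_induct) (auto intro: implies_neg converse_rtranclp_into_rtranclp)

context
  fixes n :: nat and S :: "clause set"
  assumes S: "S \<subseteq> all_clauses n"
begin

lemma implies_literals:
  assumes "implies S u v"
  shows "u \<in> literals n" "v \<in> literals n"
proof -
  have "u \<in> literals n \<and> v \<in> literals n"
    using assms S by (cases u; cases v) (auto simp: implies_def literals_def neg_def all_clauses_def)
  then show "u \<in> literals n" "v \<in> literals n" by simp_all
qed

lemma implies_star_literals: "(implies S)\<^sup>*\<^sup>* u v \<Longrightarrow> u \<in> literals n \<Longrightarrow> v \<in> literals n"
  by (induction rule: rtranclp_induct) (auto dest: implies_literals)

text \<open>A maximal consistent set of literals closed under implication decides every variable:
  otherwise an undecided literal that does not imply its own negation could be added together with
  all its consequences.\<close>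

lemma satisfiable_if_no_contradiction:
  assumes "\<And>x. x \<in> literals n \<Longrightarrow> \<not> ((implies S)\<^sup>*\<^sup>* x (neg x) \<and> (implies S)\<^sup>*\<^sup>* (neg x) x)"
  obtains \<sigma> where "\<sigma> \<in> {1..n} \<rightarrow>\<^sub>E {1, -1}" "\<forall>c\<in>S. sat_clause \<sigma> c"
proof -
  define P where "P = (\<lambda>M. M \<subseteq> literals n \<and> (\<forall>l\<in>M. neg l \<notin> M) \<and> (\<forall>u v. u \<in> M \<longrightarrow> implies S u v \<longrightarrow> v \<in> M))"
  have "finite (Collect P)" by (rule finite_subset[of _ "Pow (literals n)"]) (auto simp: P_def)
  moreover have "P {}" by (simp add: P_def)
  ultimately obtain M where M: "P M" and max: "\<And>M'. P M' \<Longrightarrow> M \<subseteq> M' \<Longrightarrow> M' = M"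
    using finite_has_maximal2[of "Collect P" "{}"] by auto
  have Mlit: "M \<subseteq> literals n" and cons: "\<And>l. l \<in> M \<Longrightarrow> neg l \<notin> M" 
    and closed: "\<And>u v. u \<in> M \<Longrightarrow> implies S u v \<Longrightarrow> v \<in> M"
    using M unfolding P_def by blast+
  have closed_star: "(implies S)\<^sup>*\<^sup>* u v \<Longrightarrow> u \<in> M \<Longrightarrow> v \<in> M" for u v
    by (induction rule: rtranclp_induct) (auto intro: closed)
  have covered: "l \<in> M \<or> neg l \<in> M" if l: "l \<in> literals n" for l
  proof (rule ccontr)
    assume un: "\<not> (l \<in> M \<or> neg l \<in> M)"
    obtain x where x: "x = l \<or> x = neg l" "\<not> (implies S)\<^sup>*\<^sup>* x (neg x)"
      using assms[OF l] by (metis neg_neg)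
    have xL: "x \<in> literals n" using x(1) l by auto
    have xM: "x \<notin> M" "neg x \<notin> M" using un x(1) by auto
    define R where "R = {v. (implies S)\<^sup>*\<^sup>* x v}"
    have "P (M \<union> R)" unfolding P_def
    proof (intro conjI ballI allI impI)
      show "M \<union> R \<subseteq> literals n" using Mlit implies_star_literals xL unfolding R_def by blast
    next
      fix u v assume "u \<in> M \<union> R" "implies S u v"
      then show "v \<in> M \<union> R" using closed unfolding R_def by (blast intro: rtranclp.rtrancl_into_rtrancl)
    next
      fix u assume u: "u \<in> M \<union> R"
      \<comment> \<open>If \<open>a\<close> and its negation both follow from \<open>x\<close>,
        contraposition of the second chain leads from \<open>a\<close> to \<open>neg x\<close>,
        against the choice of \<open>x\<close>.\<close>
      have RR: "\<not> (a \<in> R \<and> neg a \<in> R)" for a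
      proof
        assume a: "a \<in> R \<and> neg a \<in> R"
        then have "(implies S)\<^sup>*\<^sup>* a (neg x)"
          using implies_star_neg[of S x "neg a"] by (simp add: R_def)
        with a x(2) rtranclp_trans[of "implies S" x a "neg x"] show False by (simp add: R_def)
      qed
      \<comment> \<open>By contraposition such an \<open>a\<close> would imply \<open>neg x\<close>
        and put it into the closed set \<open>M\<close>.\<close>
      have MR: "\<not> (a \<in> M \<and> neg a \<in> R)" for a
      proof
        assume a: "a \<in> M \<and> neg a \<in> R"
        then have "(implies S)\<^sup>*\<^sup>* a (neg x)"
          using implies_star_neg[of S x "neg a"] by (simp add: R_def)
        with a closed_star xM show False by blast
      qed
      show "neg u \<notin> M \<union> R" using u cons RR MR by (metis Un_iff neg_neg)
    qed
    from max[OF this] have "x \<in> M" by (auto simp: R_def)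
    with xM show False by simp
  qed
  define \<sigma> :: "nat \<Rightarrow> int" where "\<sigma> = (\<lambda>x\<in>{1..n}. if (x, 1) \<in> M then 1 else -1)"
  have \<sigma>M: "\<sigma> (fst l) = snd l" if "l \<in> M" for l
  proof -
    from that Mlit have "l \<in> literals n" by auto
    then show ?thesis using that cons[OF that] by (cases l) (auto simp: \<sigma>_def literals_def neg_def)
  qed
  show thesis
  proof (rule that)
    show "\<sigma> \<in> {1..n} \<rightarrow>\<^sub>E {1, -1}" by (auto simp: \<sigma>_def)
    show "\<forall>c\<in>S. sat_clause \<sigma> c"
    proof
      fix c assume c: "c \<in> S"
      obtain a b where ab: "c = (a, b)" by (cases c)
      have "implies S (neg a) b" using c ab by (simp add: implies_def)
      then have "a \<in> M \<or> b \<in> M" using covered[of a] closed[of "neg a" b] implies_literals(1)[of "neg a" b] by auto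
      with \<sigma>M show "sat_clause \<sigma> c" by (cases a; cases b) (auto simp: ab)
    qed
  qed
qed

text \<open>
  A shortest path from \<open>u\<close> to its negation, cut at the first complement of an earlier literal.
\<close>

lemma lasso:
  assumes u: "u \<in> literals n" and "(implies S)\<^sup>*\<^sup>* u (neg u)"
  obtains ys z where "ys \<noteq> []" "hd ys = u" "successively (implies S) (ys @ [z])"
    "distinct (map fst ys)" "neg z \<in> set ys"
proof -
  obtain xs where xs: "rtrancl_path (implies S) u xs (neg u)" "distinct (u # xs)"
    using assms(2) unfolding rtranclp_eq_rtrancl_path by (metis rtrancl_path_distinct)
  define p where "p = u # xs"
  have "xs \<noteq> []"
  proof
    assume "xs = []"
    with xs(1) have "neg u = u" by (auto elim: rtrancl_path.cases)
    with neg_neq[OF u] show False by simp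
  qed
  then have last: "last p = neg u" using rtrancl_path_last[OF xs(1)] by (simp add: p_def)
  have succ: "successively (implies S) p"
    unfolding successively_conv_nth p_def using rtrancl_path_nth[OF xs(1)] by auto
  have lit: "p ! i \<in> literals n" if "i < length p" for i
  proof (cases i)
    case (Suc j)
    with that rtrancl_path_nth[OF xs(1), of j] implies_literals(2) show ?thesis by (auto simp: p_def)
  qed (use u in \<open>simp add: p_def\<close>)
  define Q where "Q = (\<lambda>j. j < length p \<and> (\<exists>i<j. p ! j = neg (p ! i)))"
  have "Q (length p - 1)"
    using last \<open>xs \<noteq> []\<close> unfolding Q_def by (auto simp: p_def last_conv_nth intro!: exI[of _ 0])
  define j where "j = (LEAST j. Q j)"
  have Qj: "Q j" and least: "\<And>i. i < j \<Longrightarrow> \<not> Q i"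
    unfolding j_def using LeastI[of Q, OF \<open>Q (length p - 1)\<close>] not_less_Least by blast+
  then obtain i where ij: "i < j" "j < length p" "p ! j = neg (p ! i)" unfolding Q_def by blast
  show thesis
  proof (rule that[of "take j p" "p ! j"])
    show "take j p \<noteq> []" "hd (take j p) = u" using ij by (auto simp: p_def)
    have "take j p @ [p ! j] = take (Suc j) p" using ij by (simp add: take_Suc_conv_app_nth)
    then show "successively (implies S) (take j p @ [p ! j])"
      using succ ij by (auto simp: successively_conv_nth)
    show "neg (p ! j) \<in> set (take j p)" using ij by (auto simp: in_set_conv_nth)
    show "distinct (map fst (take j p))"
      unfolding distinct_conv_nth
    proof (intro allI impI)
      \<comment> \<open>Literals on one variable are equal or complementary; the path is simple,
        which excludes the former, and \<open>j\<close> is least, which excludes the latter.\<close>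
      have ne: "fst (p ! a) \<noteq> fst (p ! b)" if "a < b" "b < j" for a b
      proof
        assume "fst (p ! a) = fst (p ! b)"
        then have "p ! b = p ! a \<or> p ! b = neg (p ! a)"
          using literals_same_var[of "p ! b" n "p ! a"] lit that ij by auto
        then show False
        proof
          assume "p ! b = p ! a"
          moreover have "distinct p" using xs(2) by (simp add: p_def)
          ultimately have "a = b" using nth_eq_iff_index_eq[of p a b] that ij by simp
          with that show False by simp
        next
          assume "p ! b = neg (p ! a)"
          with that ij have "Q b" by (auto simp: Q_def)
          with least that show False by blast
        qed
      qed
      fix a b assume "a < length (map fst (take j p))" "b < length (map fst (take j p))" "a \<noteq> b"
      with ne[of a b] ne[of b a] ij show "map fst (take j p) ! a \<noteq> map fst (take j p) ! b"
        by (cases "a < b") auto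
    qed
  qed
qed

lemma successively_glue:
  "successively P (xs @ [u]) \<Longrightarrow> successively P (u # ys) \<Longrightarrow> successively P (xs @ u # ys)"
  by (auto simp: successively_append_iff)

lemma successively_rev_neg: "successively (implies S) xs \<Longrightarrow> successively (implies S) (rev (map neg xs))"
  unfolding successively_rev successively_map by (rule successively_mono[of "implies S"]) (auto intro: implies_neg)

text \<open>
  The lasso at \<open>neg u\<close> is reversed by contraposition and glued in front of the lasso at \<open>u\<close>; it is
  cut where it first meets a variable that has occurred before.
\<close>

lemma bicycle:
  assumes u: "u \<in> literals n" and "(implies S)\<^sup>*\<^sup>* u (neg u)" "(implies S)\<^sup>*\<^sup>* (neg u) u"
  obtains f C z where "C \<noteq> []" "set C \<subseteq> literals n" "successively (implies S) (f # C @ [z])"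
    "distinct (map fst C)" "fst f \<in> fst ` set C" "neg z \<in> set C"
proof -
  obtain ys z where ys: "ys \<noteq> []" "hd ys = u" "successively (implies S) (ys @ [z])"
    "distinct (map fst ys)" "neg z \<in> set ys" using lasso[OF assms(1,2)] by blast
  obtain ms w where ms: "ms \<noteq> []" "hd ms = neg u" "successively (implies S) (ms @ [w])"
    "distinct (map fst ms)" "neg w \<in> set ms" using lasso[of "neg u"] assms by auto
  define q where "q = ms @ [w]"
  \<comment> \<open>Position 0 is left out because \<open>neg u\<close> shares its variable with the
    head of \<open>ys\<close>. The last position qualifies, as \<open>w\<close> complements an
    earlier literal.\<close>
  define Q where "Q = (\<lambda>t. 0 < t \<and> t < length q \<and> fst (q ! t) \<in> fst ` (set ys \<union> set (take t q)))"
  have "Q (length ms)"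
    unfolding Q_def q_def using ms(1,5) by (auto intro: image_eqI[of _ _ "neg w"])
  define t where "t = (LEAST t. Q t)"
  have Qt: "Q t" and least: "\<And>i. i < t \<Longrightarrow> \<not> Q i"
    unfolding t_def using LeastI[of Q, OF \<open>Q (length ms)\<close>] not_less_Least by blast+
  have t: "0 < t" "t \<le> length ms" "fst (q ! t) \<in> fst ` (set ys \<union> set (take t q))"
    using Qt by (auto simp: Q_def q_def)
  define m where "m = tl (take t q)"
  have q0: "q ! 0 = neg u" using ms by (simp add: q_def hd_conv_nth nth_append)
  have takeq: "take t q = neg u # m"
  proof -
    have "take t q \<noteq> []" using t(1) by (simp add: q_def)
    moreover have "hd (take t q) = hd q" using t(1) by (rule hd_take)
    moreover have "hd q = neg u" using ms(1,2) by (simp add: q_def)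
    ultimately show ?thesis unfolding m_def by (metis list.collapse)
  qed
  have taketq: "take (Suc t) q = neg u # m @ [q ! t]"
  proof -
    have "t < length q" using t by (simp add: q_def)
    from take_Suc_conv_app_nth[OF this] show ?thesis by (simp add: takeq)
  qed
  have succq: "successively (implies S) (neg u # m @ [q ! t])"
  proof -
    have "successively (implies S) (take (Suc t) q @ drop (Suc t) q)" using ms(3) unfolding q_def[symmetric] by simp
    then have "successively (implies S) (take (Suc t) q)" by (simp only: successively_append_iff)
    then show ?thesis unfolding taketq .
  qed
  \<comment> \<open>Reversal turns the head \<open>neg u\<close> of the cut lasso into
    \<open>u\<close>; it is dropped because \<open>ys\<close> already starts with
    \<open>u\<close>.\<close>
  define C where "C = rev (map neg m) @ ys"
  obtain y' where yu: "ys = u # y'" using ys(1,2) by (cases ys) auto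
  have chain: "successively (implies S) (neg (q ! t) # C @ [z])"
  proof -
    have "successively (implies S) (neg (q ! t) # rev (map neg m) @ [u])"
      using successively_rev_neg[OF succq] by simp
    moreover have "successively (implies S) ((u # y') @ [z])" using ys(3) yu by simp
    ultimately have "successively (implies S) ((neg (q ! t) # rev (map neg m)) @ (u # y' @ [z]))"
      using successively_glue[of _ "neg (q ! t) # rev (map neg m)" u "y' @ [z]"] by simp
    then show ?thesis unfolding C_def using yu by simp
  qed
  show thesis
  proof (rule that[of C "neg (q ! t)" z])
    show "C \<noteq> []" using ys(1) by (simp add: C_def)
    show "successively (implies S) (neg (q ! t) # C @ [z])" by (rule chain)
    show "neg z \<in> set C" using ys(5) by (simp add: C_def)
    show "fst (neg (q ! t)) \<in> fst ` set C"
      using t(3) yu unfolding takeq by (auto simp: C_def image_Un image_image)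
    show "set C \<subseteq> literals n"
    proof
      fix c assume "c \<in> set C"
      then obtain i where i: "i < length C" "c = C ! i" by (auto simp: in_set_conv_nth)
      have "implies S ((neg (q ! t) # C @ [z]) ! i) ((neg (q ! t) # C @ [z]) ! Suc i)"
        using chain i unfolding successively_conv_nth by auto
      then show "c \<in> literals n" using implies_literals(2) i by (simp add: nth_append)
    qed
    show "distinct (map fst C)"
    proof -
      have take_ms: "take t q = take t ms" using t(2) by (simp add: q_def)
      have "distinct (map fst (take t ms))" using ms(4) by (simp add: distinct_take flip: take_map)
      then have "distinct (map fst m)" using takeq take_ms by simp
      moreover have "fst a \<notin> fst ` set ys" if "a \<in> set m" for a
      proof -
        from that obtain i where i: "i < length m" "a = m ! i" by (auto simp: in_set_conv_nth)
        have len: "length (take t q) = t" using t(2) by (simp add: q_def)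
        then have "Suc i < t" using takeq i by simp
        moreover have "q ! Suc i = a"
          using \<open>Suc i < t\<close> i takeq by (metis nth_Cons_Suc nth_take)
        ultimately show ?thesis using least[of "Suc i"] t(2) by (auto simp: Q_def q_def)
      qed
      ultimately show ?thesis using ys(4) by (auto simp: C_def comp_def simp flip: rev_map)
    qed
  qed
qed

end

section \<open>Counting bicycles\<close>

definition implication_clause :: "bool \<Rightarrow> literal \<Rightarrow> literal \<Rightarrow> clause" where
  "implication_clause o' a b = (if o' then (neg a, b) else (b, neg a))"

text \<open>Each end literal lies over a variable of \<open>C\<close>, so it is encoded by a
  position in \<open>C\<close> and a sign. Thus only \<open>k\<close> literals are free for
  \<open>k + 1\<close> clauses, which leaves a factor of order \<open>1 / n\<close>. The list
  \<open>os\<close> records the order in which each clause lists its literals.\<close>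

definition bicycle_clauses :: "nat \<Rightarrow> (literal list \<times> bool list) \<times> ((nat \<times> int) \<times> (nat \<times> int)) \<Rightarrow> clause list" where
  "bicycle_clauses k = (\<lambda>((C, os), ((i, r), (j, s))).
     let D = (fst (C ! i), r) # C @ [(fst (C ! j), s)]
     in map (\<lambda>h. implication_clause (os ! h) (D ! h) (D ! Suc h)) [0..<Suc k])"

definition bicycles :: "nat \<Rightarrow> nat \<Rightarrow> clause list set" where
  "bicycles n k = bicycle_clauses k ` (({C. set C \<subseteq> literals n \<and> length C = k} \<times>
     {os. set os \<subseteq> UNIV \<and> length os = Suc k}) \<times> (({..<k} \<times> {1, -1}) \<times> ({..<k} \<times> {1, -1})))"

lemma card_bicycles: "finite (bicycles n k)" "card (bicycles n k) \<le> (2 * n) ^ k * 2 ^ Suc k * (2 * k)\<^sup>2"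
proof -
  let ?A = "({C. set C \<subseteq> literals n \<and> length C = k} \<times>
     {os :: bool list. set os \<subseteq> UNIV \<and> length os = Suc k}) \<times> (({..<k} \<times> {1, -1 :: int}) \<times> ({..<k} \<times> {1, -1 :: int}))"
  have fin: "finite {C. set C \<subseteq> literals n \<and> length C = k}" "finite {os :: bool list. set os \<subseteq> UNIV \<and> length os = Suc k}"
    by (intro finite_lists_length_eq; simp)+
  then have finA: "finite ?A" by (intro finite_cartesian_product) auto
  then show "finite (bicycles n k)" unfolding bicycles_def by (rule finite_imageI)
  have "card (bicycles n k) \<le> card ?A" unfolding bicycles_def by (rule card_image_le[OF finA])
  also have "\<dots> = card {C. set C \<subseteq> literals n \<and> length C = k} * card {os :: bool list. set os \<subseteq> UNIV \<and> length os = Suc k} * (2 * k)\<^sup>2"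
    by (simp add: card_cartesian_product power2_eq_square algebra_simps)
  also have "card {C. set C \<subseteq> literals n \<and> length C = k} = (2 * n) ^ k"
  proof -
    have "card (literals n) = 2 * n" by (simp add: literals_def card_cartesian_product)
    then show ?thesis using card_lists_length_eq[OF finite_literals, of n k] by simp
  qed
  also have "card {os :: bool list. set os \<subseteq> UNIV \<and> length os = Suc k} = 2 ^ Suc k"
    by (subst card_lists_length_eq) (simp_all add: card_UNIV_bool)
  finally show "card (bicycles n k) \<le> (2 * n) ^ k * 2 ^ Suc k * (2 * k)\<^sup>2" .
qed

text \<open>Occurrences ask for distinct positions, so beyond \<open>bicycle\<close> it must be
  shown that the \<open>k + 1\<close> implications come from pairwise different clauses.\<close>

lemma unsat_bicycle:
  assumes valid: "set \<Phi> \<subseteq> all_clauses n" and unsat: "num_sat n \<Phi> = 0"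
  shows "\<exists>k\<in>{1..n}. occurrences (bicycles n k) (Suc k) \<Phi> \<noteq> {}"
proof -
  have "\<exists>u\<in>literals n. (implies (set \<Phi>))\<^sup>*\<^sup>* u (neg u) \<and> (implies (set \<Phi>))\<^sup>*\<^sup>* (neg u) u"
  proof (rule ccontr)
    assume "\<not> ?thesis"
    then have "\<not> ((implies (set \<Phi>))\<^sup>*\<^sup>* x (neg x) \<and> (implies (set \<Phi>))\<^sup>*\<^sup>* (neg x) x)" if "x \<in> literals n" for x
      using that by blast
    from satisfiable_if_no_contradiction[OF valid this]
    obtain \<sigma> where "\<sigma> \<in> {1..n} \<rightarrow>\<^sub>E {1, -1}" "\<forall>c\<in>set \<Phi>. sat_clause \<sigma> c"
      by metis
    then have "\<sigma> \<in> sat_assignments n \<Phi>" by (simp add: sat_assignments_def)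
    with unsat finite_sat_assignments show False by (auto simp: num_sat_def)
  qed
  then obtain u where u: "u \<in> literals n" "(implies (set \<Phi>))\<^sup>*\<^sup>* u (neg u)" "(implies (set \<Phi>))\<^sup>*\<^sup>* (neg u) u"
    by blast
  obtain f C z where C: "C \<noteq> []" "set C \<subseteq> literals n" "successively (implies (set \<Phi>)) (f # C @ [z])"
    "distinct (map fst C)" "fst f \<in> fst ` set C" "neg z \<in> set C"
    by (rule bicycle[OF valid u])
  define k where "k = length C"
  define D where "D = f # C @ [z]"
  have lenD: "length D = Suc (Suc k)" by (simp add: D_def k_def)
  have DC: "D ! Suc i = C ! i" if "i < k" for i using that by (simp add: D_def k_def nth_append)
  have Dz: "D ! Suc k = z" by (simp add: D_def k_def nth_append)
  have imp: "implies (set \<Phi>) (D ! h) (D ! Suc h)" if "h < Suc k" for h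
    using C(3) that lenD unfolding D_def successively_conv_nth by (simp add: k_def)
  have k1: "1 \<le> k" using C(1) by (simp add: k_def Suc_le_eq)
  have "card (fst ` set C) \<le> card {1..n}"
    using C(2) by (intro card_mono) (auto simp: literals_def)
  then have kn: "k \<le> n" using distinct_card[OF C(4)] by (simp add: k_def)
  define os where "os = map (\<lambda>h. (neg (D ! h), D ! Suc h) \<in> set \<Phi>) [0..<Suc k]"
  define cl where "cl = (\<lambda>h. implication_clause (os ! h) (D ! h) (D ! Suc h))"
  have cl_in: "cl h \<in> set \<Phi>" if "h < Suc k" for h
    using imp[OF that] nth_map[of h "[0..<Suc k]" "\<lambda>h. (neg (D ! h), D ! Suc h) \<in> set \<Phi>"] that
    by (auto simp: cl_def os_def implication_clause_def implies_def simp del: upt_Suc)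
  have cl_set: "{fst (cl h), snd (cl h)} = {neg (D ! h), D ! Suc h}" for h
    by (auto simp: cl_def implication_clause_def)
  have C_same: "i = j" if "i < k" "j < k" "fst (C ! i) = fst (C ! j)" for i j
    using C(4) that by (simp add: distinct_conv_nth k_def) blast
  have C_lit: "C ! i \<in> literals n" if "i < k" for i using C(2) that by (auto simp: k_def)
  \<comment> \<open>A coincidence would equate \<open>D ! Suc i\<close> with
    \<open>neg (D ! j)\<close> or \<open>D ! Suc j\<close>. The distinct variables of
    \<open>C\<close> rule this out; when \<open>D ! Suc j\<close> is \<open>z\<close>, the presence
    of \<open>neg z\<close> in \<open>C\<close> does.\<close>
  have cl_ne: "cl i \<noteq> cl j" if ij: "i < j" "j < Suc k" for i j
  proof
    assume eq: "cl i = cl j"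
    have "D ! Suc i \<in> {neg (D ! j), D ! Suc j}" using cl_set[of i] cl_set[of j] eq by auto
    then have "D ! Suc i = neg (D ! j) \<or> D ! Suc i = D ! Suc j" by simp
    then show False
    proof
      assume *: "D ! Suc i = neg (D ! j)"
      obtain j' where j': "j = Suc j'" using ij by (cases j) auto
      then have "C ! i = neg (C ! j')" using * DC[of i] DC[of j'] ij by simp
      then have "i = j'" using C_same[of i j'] ij j' by simp
      with \<open>C ! i = neg (C ! j')\<close> neg_neq[OF C_lit[of i]] ij j' show False by simp
    next
      assume *: "D ! Suc i = D ! Suc j"
      show False
      proof (cases "j < k")
        case True
        with * DC[of i] DC[of j] C_same[of i j] ij show False by simp
      next
        case False
        with ij have "j = k" by simp
        with * Dz DC[of i] ij have z: "z = C ! i" by simp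
        from C(6) obtain h where h: "h < k" "neg z = C ! h" by (auto simp: in_set_conv_nth k_def)
        then have "fst (C ! h) = fst (C ! i)" using z by (metis fst_neg)
        then have "h = i" using C_same[of h i] h ij \<open>j = k\<close> by simp
        with h z neg_neq[OF C_lit[of i]] ij \<open>j = k\<close> show False by simp
      qed
    qed
  qed
  have "\<forall>h<Suc k. \<exists>b<length \<Phi>. \<Phi> ! b = cl h" using cl_in by (simp add: in_set_conv_nth)
  then obtain ix where ix: "\<And>h. h < Suc k \<Longrightarrow> ix h < length \<Phi> \<and> \<Phi> ! ix h = cl h" by metis
  define bs where "bs = map ix [0..<Suc k]"
  have "ix i \<noteq> ix j" if "i < j" "j < Suc k" for i j
    using cl_ne[OF that] ix[of i] ix[of j] that by auto
  then have "inj_on ix {0..<Suc k}"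
    unfolding inj_on_def by (metis atLeastLessThan_iff linorder_neqE_nat)
  then have bs: "bs \<in> index_lists (length \<Phi>) (Suc k)"
    using ix by (auto simp: index_lists_def bs_def distinct_map simp del: upt_Suc)
  have map_bs: "map ((!) \<Phi>) bs = map cl [0..<Suc k]"
    using ix by (auto simp: bs_def simp del: upt_Suc)
  obtain i where i: "i < k" "fst f = fst (C ! i)" using C(5) by (auto simp: in_set_conv_nth k_def)
  obtain j where j: "j < k" "fst z = fst (C ! j)"
    using C(6) by (metis fst_neg in_set_conv_nth k_def)
  have signs: "snd f \<in> {1, -1}" "snd z \<in> {1, -1}"
  proof -
    have "f \<in> literals n" using implies_literals(1)[OF valid imp[of 0]] by (simp add: D_def)
    moreover have "z \<in> literals n" using implies_literals(2)[OF valid imp[of k]] Dz by simp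
    ultimately show "snd f \<in> {1, -1}" "snd z \<in> {1, -1}" by (auto simp: literals_def)
  qed
  have "(fst (C ! i), snd f) = f" "(fst (C ! j), snd z) = z" using i j by (simp_all add: prod_eq_iff)
  then have "map cl [0..<Suc k] = bicycle_clauses k ((C, os), ((i, snd f), (j, snd z)))"
    unfolding bicycle_clauses_def cl_def D_def by (simp add: Let_def del: upt_Suc)
  moreover have "((C, os), ((i, snd f), (j, snd z))) \<in> (({C. set C \<subseteq> literals n \<and> length C = k} \<times>
     {os. set os \<subseteq> UNIV \<and> length os = Suc k}) \<times> (({..<k} \<times> {1, -1}) \<times> ({..<k} \<times> {1, -1})))"
    using C(2) i j signs by (simp add: k_def os_def)
  ultimately have "map cl [0..<Suc k] \<in> bicycles n k" unfolding bicycles_def by (rule image_eqI)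
  with bs map_bs have "bs \<in> occurrences (bicycles n k) (Suc k) \<Phi>" by (simp add: occurrences_def)
  with k1 kn show ?thesis by (intro bexI[of _ k]) auto
qed

lemma summable_square_power:
  fixes \<rho> :: real
  assumes "0 \<le> \<rho>" "\<rho> < 1"
  shows "summable (\<lambda>k. real k ^ 2 * \<rho> ^ k)"
proof (rule root_test_convergence[of _ \<rho>])
  have "(\<lambda>k. root k (real k) ^ 2 * \<rho>) \<longlonglongrightarrow> 1 ^ 2 * \<rho>"
    by (intro tendsto_intros LIMSEQ_root)
  moreover have "eventually (\<lambda>k. root k (real k) ^ 2 * \<rho> = root k (norm (real k ^ 2 * \<rho> ^ k))) sequentially"
    using eventually_gt_at_top[of 0]
    by eventually_elim (use assms in \<open>simp add: real_root_mult real_root_power real_root_power_cancel abs_mult\<close>)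
  ultimately show "(\<lambda>k. root k (norm (real k ^ 2 * \<rho> ^ k))) \<longlonglongrightarrow> \<rho>"
    using Lim_transform_eventually by fastforce
qed (use assms in simp)

text \<open>There are at most \<open>(4 * n) ^ k * 8 * k\<^sup>2\<close> bicycles. Against this,
  \<open>k\<close> clauses give the ratio \<open>d * n / (2 * (n - 1))\<close> each, and the last
  one turns the 8 into \<open>d / (n - 1)\<close>. The ratio exceeds \<open>d / 2\<close>, so a
  bound \<rho> below 1 is needed to sum over all \<open>k\<close>.\<close>

lemma prob_unsat:
  assumes n: "n \<ge> 2" and d: "d > 0" and \<rho>: "d * real n / (2 * (real n - 1)) \<le> \<rho>" "\<rho> < 1"
  shows "(\<integral>\<^sup>+\<Phi>. ennreal (of_bool (set \<Phi> \<subseteq> all_clauses n \<and> num_sat n \<Phi> = 0)) \<partial>random_formula d n)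
    \<le> ennreal ((\<Sum>k. real k ^ 2 * \<rho> ^ k) * d / (real n - 1))"
proof -
  let ?q = "d * real n / (2 * (real n - 1))"
  have q0: "?q \<ge> 0" using n d by simp
  then have \<rho>0: "\<rho> \<ge> 0" using \<rho>(1) by simp
  have summable: "summable (\<lambda>k. real k ^ 2 * \<rho> ^ k)" by (rule summable_square_power[OF \<rho>0 \<rho>(2)])
  have le: "of_bool (set \<Phi> \<subseteq> all_clauses n \<and> num_sat n \<Phi> = 0) \<le>
      (\<Sum>k = 1..n. real (card (occurrences (bicycles n k) (Suc k) \<Phi>)))" (is "_ \<le> ?S") for \<Phi>
  proof (cases "set \<Phi> \<subseteq> all_clauses n \<and> num_sat n \<Phi> = 0")
    case True
    then obtain k where k: "k \<in> {1..n}" "occurrences (bicycles n k) (Suc k) \<Phi> \<noteq> {}"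
      using unsat_bicycle by blast
    then have "card (occurrences (bicycles n k) (Suc k) \<Phi>) \<ge> 1"
      by (simp add: Suc_le_eq card_gt_0_iff)
    then have "1 \<le> real (card (occurrences (bicycles n k) (Suc k) \<Phi>))" by simp
    also have "\<dots> \<le> ?S" by (rule member_le_sum[OF k(1)]) auto
    finally show ?thesis using True by simp
  next
    case False
    then have "of_bool (set \<Phi> \<subseteq> all_clauses n \<and> num_sat n \<Phi> = 0) = (0 :: real)" by auto
    also have "0 \<le> ?S" by (rule sum_nonneg) simp
    finally show ?thesis .
  qed
  have "(\<integral>\<^sup>+\<Phi>. ennreal (of_bool (set \<Phi> \<subseteq> all_clauses n \<and> num_sat n \<Phi> = 0)) \<partial>random_formula d n)
    \<le> (\<integral>\<^sup>+\<Phi>. (\<Sum>k = 1..n. ennreal (real (card (occurrences (bicycles n k) (Suc k) \<Phi>)))) \<partial>random_formula d n)"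
    by (subst sum_ennreal, simp) (intro nn_integral_mono ennreal_leI[OF le])
  also have "\<dots> = (\<Sum>k = 1..n. \<integral>\<^sup>+\<Phi>. ennreal (real (card (occurrences (bicycles n k) (Suc k) \<Phi>))) \<partial>random_formula d n)"
    by (rule nn_integral_sum) simp
  also have "\<dots> \<le> (\<Sum>k = 1..n. ennreal (real k ^ 2 * \<rho> ^ k * (d / (real n - 1))))"
  proof (rule sum_mono)
    fix k assume "k \<in> {1..n}"
    have "(\<integral>\<^sup>+\<Phi>. ennreal (real (card (occurrences (bicycles n k) (Suc k) \<Phi>))) \<partial>random_formula d n)
        \<le> ennreal (real (card (bicycles n k)) * (d / (8 * (real n - 1))) ^ Suc k)"
      by (rule expected_occurrences[OF n d card_bicycles(1)])
    also have "\<dots> \<le> ennreal (real k ^ 2 * \<rho> ^ k * (d / (real n - 1)))"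
    proof (rule ennreal_leI)
      have "real (card (bicycles n k)) * (d / (8 * (real n - 1))) ^ Suc k \<le>
          real ((2 * n) ^ k * 2 ^ Suc k * (2 * k)\<^sup>2) * (d / (8 * (real n - 1))) ^ Suc k"
        using n d by (intro mult_right_mono of_nat_mono card_bicycles(2)) auto
      also have "\<dots> = real k ^ 2 * (2 * real n * 2 * (d / (8 * (real n - 1)))) ^ k * (d / (real n - 1))"
      proof -
        define y where "y = d / (8 * (real n - 1))"
        have "d / v = 8 * (d / (8 * v))" for v :: real by simp
        then have "d / (real n - 1) = 8 * y" unfolding y_def .
        moreover have "real ((2 * n) ^ k * 2 ^ Suc k * (2 * k)\<^sup>2) = (2 * real n) ^ k * 2 ^ k * (8 * real k ^ 2)"
          by (simp add: power2_eq_square)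
        moreover have "(2 :: real) ^ k * 2 ^ k = 4 ^ k" by (simp flip: power_mult_distrib)
        ultimately show ?thesis unfolding y_def[symmetric] by (simp add: power_mult_distrib)
      qed
      also have "2 * real n * 2 * (d / (8 * (real n - 1))) = ?q"
        using n by (simp add: field_simps)
      also have "real k ^ 2 * ?q ^ k * (d / (real n - 1)) \<le> real k ^ 2 * \<rho> ^ k * (d / (real n - 1))"
        using n d q0 \<rho> by (intro mult_right_mono mult_left_mono power_mono) auto
      finally show "real (card (bicycles n k)) * (d / (8 * (real n - 1))) ^ Suc k \<le> real k ^ 2 * \<rho> ^ k * (d / (real n - 1))" .
    qed
    finally show "(\<integral>\<^sup>+\<Phi>. ennreal (real (card (occurrences (bicycles n k) (Suc k) \<Phi>))) \<partial>random_formula d n)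
        \<le> ennreal (real k ^ 2 * \<rho> ^ k * (d / (real n - 1)))" .
  qed
  also have "\<dots> = ennreal ((\<Sum>k = 1..n. real k ^ 2 * \<rho> ^ k) * (d / (real n - 1)))"
    unfolding sum_distrib_right by (rule sum_ennreal) (use d n \<rho>0 in simp)
  also have "\<dots> \<le> ennreal ((\<Sum>k. real k ^ 2 * \<rho> ^ k) * (d / (real n - 1)))"
    using n d \<rho>0 by (intro ennreal_leI mult_right_mono sum_le_suminf summable) auto
  finally show ?thesis by simp
qed

section \<open>The limit\<close>

text \<open>\<open>alt\<close> is a count with real values. Being at least 1 when nonzero, it
  dominates the indicator of a bad walk, as in Markov's inequality.\<close>

lemma alt_zero_or_ge_1: "alt \<Phi> j w t = 0 \<or> alt \<Phi> j w t \<ge> 1"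
proof (induction j arbitrary: w t)
  case (Suc j)
  let ?g = "\<lambda>b. if own_sign (\<Phi> ! b) (endv \<Phi> w) = t
        then alt \<Phi> j (b # w) (- other_sign (\<Phi> ! b) (endv \<Phi> w)) else 0"
  have nonneg: "?g b \<ge> 0" for b by (simp add: alt_nonneg)
  show ?case
  proof (cases "\<exists>b\<in>exts \<Phi> w. ?g b \<noteq> 0")
    case True
    then obtain b where b: "b \<in> exts \<Phi> w" "?g b \<noteq> 0" by blast
    with Suc have "?g b \<ge> 1" by (auto split: if_splits)
    also have "?g b \<le> alt \<Phi> (Suc j) w t"
      unfolding alt.simps by (rule member_le_sum[OF b(1)]) (use nonneg in auto)
    finally show ?thesis by simp
  qed simp
qed simp

definition max_error :: "nat \<Rightarrow> nat \<Rightarrow> formula \<Rightarrow> real" where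
  "max_error n l \<Phi> = (MAX \<tau>\<in>sat_assignments n \<Phi>. \<bar>cond_marginal n \<Phi> l \<tau> - bp_marginal \<Phi> l 1 1\<bar>)"

text \<open>On unsatisfiable formulas \<open>MAX\<close> ranges over the empty set and is
  unspecified; the indicator removes them, so that bounds can be shown before conditioning.\<close>

definition sat_error :: "nat \<Rightarrow> nat \<Rightarrow> formula \<Rightarrow> real" where
  "sat_error n l \<Phi> = of_bool (num_sat n \<Phi> > 0) * max_error n l \<Phi>"

lemma sat_assignments_nonempty: "num_sat n \<Phi> > 0 \<longleftrightarrow> sat_assignments n \<Phi> \<noteq> {}"
  by (simp add: num_sat_def card_gt_0_iff finite_sat_assignments)

lemma max_error_nonneg:
  assumes "num_sat n \<Phi> > 0"
  shows "max_error n l \<Phi> \<ge> 0"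
proof -
  obtain \<tau> where "\<tau> \<in> sat_assignments n \<Phi>" using assms by (auto simp: sat_assignments_nonempty)
  then show ?thesis unfolding max_error_def
    by (subst Max_ge_iff) (auto simp: finite_sat_assignments)
qed

lemma sat_error_nonneg: "sat_error n l \<Phi> \<ge> 0"
  using max_error_nonneg by (simp add: sat_error_def)

lemma sat_error_le:
  assumes "\<And>\<tau>. \<tau> \<in> sat_assignments n \<Phi> \<Longrightarrow> \<bar>cond_marginal n \<Phi> l \<tau> - bp_marginal \<Phi> l 1 1\<bar> \<le> c" "c \<ge> 0"
  shows "sat_error n l \<Phi> \<le> c"
proof (cases "num_sat n \<Phi> > 0")
  case True
  then have "max_error n l \<Phi> \<le> c" unfolding max_error_def
    by (subst Max_le_iff) (use assms in \<open>auto simp: finite_sat_assignments sat_assignments_nonempty\<close>)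
  with True show ?thesis by (simp add: sat_error_def)
qed (simp add: sat_error_def assms)

lemma sat_error_le_1:
  assumes "set \<Phi> \<subseteq> all_clauses n" "l > 0"
  shows "sat_error n l \<Phi> \<le> 1"
proof (rule sat_error_le)
  fix \<tau>
  let ?F = "wt \<Phi> (\<lambda>_ _. 1) l []"
  have "?F 1 > 0" "?F (-1) > 0" by (rule wt_pos, simp)+
  moreover have "bp_marginal \<Phi> l 1 1 = ?F 1 / (?F 1 + ?F (-1))"
    using bp_marginal_free[OF assms(1), of 1 "l - 1"] assms(2) by (simp del: wt.simps)
  ultimately have "0 \<le> bp_marginal \<Phi> l 1 1" "bp_marginal \<Phi> l 1 1 \<le> 1" by simp_all
  moreover have "0 \<le> cond_marginal n \<Phi> l \<tau>" "cond_marginal n \<Phi> l \<tau> \<le> 1"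
  proof -
    have ratio: "0 \<le> x / y \<and> x / y \<le> 1" if "0 \<le> x" "x \<le> y" for x y :: real
      using that by (auto simp: divide_le_eq_1)
    have "0 \<le> cond_marginal n \<Phi> l \<tau> \<and> cond_marginal n \<Phi> l \<tau> \<le> 1"
      unfolding cond_marginal_def cond_prob_def
      by (intro ratio measure_nonneg measure_pmf.finite_measure_mono) auto
    then show "0 \<le> cond_marginal n \<Phi> l \<tau>" "cond_marginal n \<Phi> l \<tau> \<le> 1" by simp_all
  qed
  ultimately show "\<bar>cond_marginal n \<Phi> l \<tau> - bp_marginal \<Phi> l 1 1\<bar> \<le> 1" by linarith
qed simp

section \<open>The averaged error bound\<close>

context
  fixes n L k :: nat
  assumes n: "1 \<le> n" and pos: "L + k > 0"
begin

text \<open>If an alternating walk joins level \<open>k\<close> to the boundary, the log-odds may be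
  infinite; but then the sum over \<open>alt\<close> is at least 1 and covers the trivial bound on
  the error.\<close>

lemma sat_error_tree:
  assumes valid: "set \<Phi> \<subseteq> all_clauses n" and tree: "treelike (L + k) \<Phi>"
  shows "sat_error n (L + k) \<Phi> \<le> (\<Sum>w\<in>walks \<Phi> k. alt \<Phi> L w 1 + alt \<Phi> L w (-1)) +
    (bnd \<Phi> L k [] 1 + bnd \<Phi> L k [] (-1))"
proof (cases "\<forall>w\<in>walks \<Phi> k. \<forall>t\<in>{1, -1}. alt \<Phi> L w t = 0")
  case True
  then have "(\<Sum>w\<in>walks \<Phi> k. alt \<Phi> L w 1 + alt \<Phi> L w (-1)) = 0" by simp
  moreover have "sat_error n (L + k) \<Phi> \<le> bnd \<Phi> L k [] 1 + bnd \<Phi> L k [] (-1)"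
    by (rule sat_error_le[OF marginal_difference[OF valid n tree pos] bnd_sum_nonneg[OF valid]])
      (use True in auto)
  ultimately show ?thesis by simp
next
  case False
  then obtain w t where w: "w \<in> walks \<Phi> k" "t \<in> {1, -1}" "alt \<Phi> L w t \<noteq> 0" by blast
  then have "1 \<le> alt \<Phi> L w t" using alt_zero_or_ge_1[of \<Phi> L w t] by simp
  also have "\<dots> \<le> alt \<Phi> L w 1 + alt \<Phi> L w (-1)" using w(2) alt_nonneg by auto
  also have "\<dots> \<le> (\<Sum>w\<in>walks \<Phi> k. alt \<Phi> L w 1 + alt \<Phi> L w (-1))"
    by (rule member_le_sum[OF w(1)]) (auto simp: alt_nonneg)
  finally show ?thesis
    using sat_error_le_1[OF valid pos] bnd_sum_nonneg[OF valid, of L k "[]"] by linarith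
qed

definition tree_walks :: "nat \<Rightarrow> formula \<Rightarrow> real" where
  "tree_walks r \<Phi> = of_bool (set \<Phi> \<subseteq> all_clauses n \<and> treelike (L + k) \<Phi>) * real (card (walks \<Phi> r))"

lemma tree_walks_nonneg: "tree_walks r \<Phi> \<ge> 0"
  by (simp add: tree_walks_def)

lemma sum_tree_walks: "(\<Sum>\<Phi>\<in>formulas n m. tree_walks r \<Phi>) = total_walks (L + k) n m r"
proof -
  have "(\<Sum>\<Phi>\<in>formulas n m. tree_walks r \<Phi>) =
      (\<Sum>\<Phi>\<in>formulas n m. if treelike (L + k) \<Phi> then real (card (walks \<Phi> r)) else 0)"
    by (intro sum.cong) (auto simp: tree_walks_def formulas_def)
  then show ?thesis by (simp add: total_walks_def tree_formulas_def sum.inter_filter)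
qed

text \<open>The terms \<open>alt\<close> and \<open>bnd\<close> are replaced by the walk counts with
  the same sums over tree-like formulas. The comparison with the error is made for these sums, not
  formula by formula.\<close>

definition envelope :: "formula \<Rightarrow> real" where
  "envelope \<Phi> = of_bool (set \<Phi> \<subseteq> all_clauses n \<and> \<not> treelike (L + k) \<Phi>) +
     (2 / 2 ^ L * tree_walks (k + L) \<Phi> + (\<Sum>j = 1..L. 2 * ln 2 / 2 ^ (k + j) * tree_walks (k + j) \<Phi>))"

lemma envelope_nonneg: "envelope \<Phi> \<ge> 0"
  unfolding envelope_def by (intro add_nonneg_nonneg sum_nonneg mult_nonneg_nonneg tree_walks_nonneg) auto

lemma sum_sat_error_le:
  "(\<Sum>\<Phi>\<in>formulas n m. sat_error n (L + k) \<Phi>) \<le> (\<Sum>\<Phi>\<in>formulas n m. envelope \<Phi>)"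
proof -
  let ?T = "treelike (L + k)"
  let ?X = "\<lambda>\<Phi>. (\<Sum>w\<in>walks \<Phi> k. alt \<Phi> L w 1 + alt \<Phi> L w (-1)) + (bnd \<Phi> L k [] 1 + bnd \<Phi> L k [] (-1))"
  have "(\<Sum>\<Phi>\<in>formulas n m. sat_error n (L + k) \<Phi>) \<le>
     (\<Sum>\<Phi>\<in>formulas n m. of_bool (set \<Phi> \<subseteq> all_clauses n \<and> \<not> ?T \<Phi>) + (if ?T \<Phi> then ?X \<Phi> else 0))"
  proof (rule sum_mono)
    fix \<Phi> assume "\<Phi> \<in> formulas n m"
    then have valid: "set \<Phi> \<subseteq> all_clauses n" by (simp add: formulas_def)
    show "sat_error n (L + k) \<Phi> \<le> of_bool (set \<Phi> \<subseteq> all_clauses n \<and> \<not> ?T \<Phi>) + (if ?T \<Phi> then ?X \<Phi> else 0)"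
      using sat_error_tree[OF valid] sat_error_le_1[OF valid pos] valid by auto
  qed
  also have "\<dots> = (\<Sum>\<Phi>\<in>formulas n m. of_bool (set \<Phi> \<subseteq> all_clauses n \<and> \<not> ?T \<Phi>)) +
      (\<Sum>\<Phi>\<in>tree_formulas (L + k) n m. ?X \<Phi>)"
    unfolding tree_formulas_def sum.inter_filter[OF finite_formulas] by (rule sum.distrib)
  also have "(\<Sum>\<Phi>\<in>tree_formulas (L + k) n m. ?X \<Phi>) =
      total_alt (L + k) n m k L + (\<Sum>\<Phi>\<in>tree_formulas (L + k) n m. bnd \<Phi> L k [] 1 + bnd \<Phi> L k [] (-1))"
    unfolding total_alt_def by (rule sum.distrib)
  also have "\<dots> = 2 / 2 ^ L * total_walks (L + k) n m (k + L) +
      (\<Sum>j = 1..L. 2 * ln 2 / 2 ^ (k + j) * total_walks (L + k) n m (k + j))"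
    unfolding sum_bnd_root by (simp add: total_alt_eq sum_distrib_left power_add mult_ac)
  also have "(\<Sum>\<Phi>\<in>formulas n m. of_bool (set \<Phi> \<subseteq> all_clauses n \<and> \<not> ?T \<Phi>)) + \<dots> = (\<Sum>\<Phi>\<in>formulas n m. envelope \<Phi>)"
  proof -
    have "(\<Sum>\<Phi>\<in>formulas n m. \<Sum>j = 1..L. 2 * ln 2 / 2 ^ (k + j) * tree_walks (k + j) \<Phi>) =
        (\<Sum>j = 1..L. 2 * ln 2 / 2 ^ (k + j) * total_walks (L + k) n m (k + j))"
      unfolding sum_tree_walks[symmetric] sum_distrib_left by (rule sum.swap)
    then show ?thesis
      unfolding envelope_def sum.distrib sum_distrib_left[symmetric] sum_tree_walks by simp
  qed
  finally show ?thesis .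
qed

lemma expected_envelope:
  assumes n2: "n \<ge> 2" and d: "d > 0"
  shows "(\<integral>\<^sup>+\<Phi>. ennreal (envelope \<Phi>) \<partial>random_formula d n) \<le>
    ennreal ((\<Sum>i = 1..2 * (L + k) + 1. (real i ^ 2 * d) ^ i) / real n +
      (2 / 2 ^ L * d ^ (k + L) + (\<Sum>j = 1..L. 2 * ln 2 / 2 ^ (k + j) * d ^ (k + j))))"
proof -
  let ?M = "measure_pmf (random_formula d n)"
  have walks_le: "(\<integral>\<^sup>+\<Phi>. ennreal (tree_walks r \<Phi>) \<partial>?M) \<le> ennreal (d ^ r)" if "r \<le> L + k" for r
    unfolding tree_walks_def by (rule expected_walks[OF n2 d that])
  have scaled: "(\<integral>\<^sup>+\<Phi>. ennreal (c * tree_walks r \<Phi>) \<partial>?M) \<le> ennreal (c * d ^ r)" if "r \<le> L + k" "c \<ge> 0" for r c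
  proof -
    have "(\<integral>\<^sup>+\<Phi>. ennreal (c * tree_walks r \<Phi>) \<partial>?M) = ennreal c * (\<integral>\<^sup>+\<Phi>. ennreal (tree_walks r \<Phi>) \<partial>?M)"
      using that(2) tree_walks_nonneg by (simp add: ennreal_mult nn_integral_cmult)
    also have "\<dots> \<le> ennreal c * ennreal (d ^ r)" by (intro mult_left_mono walks_le that) simp
    also have "\<dots> = ennreal (c * d ^ r)" using that(2) d by (simp add: ennreal_mult)
    finally show ?thesis .
  qed
  let ?c = "\<lambda>j. 2 * ln 2 / 2 ^ (k + j) :: real"
  have c0: "?c j \<ge> 0" for j by simp
  have sums: "(\<integral>\<^sup>+\<Phi>. ennreal (\<Sum>j = 1..L. ?c j * tree_walks (k + j) \<Phi>) \<partial>?M) \<le> ennreal (\<Sum>j = 1..L. ?c j * d ^ (k + j))"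
  proof -
    have "(\<integral>\<^sup>+\<Phi>. ennreal (\<Sum>j = 1..L. ?c j * tree_walks (k + j) \<Phi>) \<partial>?M) =
        (\<integral>\<^sup>+\<Phi>. (\<Sum>j = 1..L. ennreal (?c j * tree_walks (k + j) \<Phi>)) \<partial>?M)"
      by (intro nn_integral_cong sum_ennreal[symmetric] mult_nonneg_nonneg c0 tree_walks_nonneg)
    also have "\<dots> = (\<Sum>j = 1..L. \<integral>\<^sup>+\<Phi>. ennreal (?c j * tree_walks (k + j) \<Phi>) \<partial>?M)"
      by (rule nn_integral_sum) simp
    also have "\<dots> \<le> (\<Sum>j = 1..L. ennreal (?c j * d ^ (k + j)))"
      by (intro sum_mono scaled c0) simp
    also have "\<dots> = ennreal (\<Sum>j = 1..L. ?c j * d ^ (k + j))"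
      by (rule sum_ennreal) (use d in simp)
    finally show ?thesis .
  qed
  have "(\<integral>\<^sup>+\<Phi>. ennreal (envelope \<Phi>) \<partial>?M) =
      (\<integral>\<^sup>+\<Phi>. ennreal (of_bool (set \<Phi> \<subseteq> all_clauses n \<and> \<not> treelike (L + k) \<Phi>)) +
       (ennreal (2 / 2 ^ L * tree_walks (k + L) \<Phi>) + ennreal (\<Sum>j = 1..L. ?c j * tree_walks (k + j) \<Phi>)) \<partial>?M)"
    unfolding envelope_def
    by (intro nn_integral_cong, subst ennreal_plus, simp,
        intro add_nonneg_nonneg sum_nonneg mult_nonneg_nonneg c0 tree_walks_nonneg, simp,
        subst ennreal_plus, intro mult_nonneg_nonneg tree_walks_nonneg, simp,
        intro sum_nonneg mult_nonneg_nonneg c0 tree_walks_nonneg, rule refl)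
  also have "\<dots> = (\<integral>\<^sup>+\<Phi>. ennreal (of_bool (set \<Phi> \<subseteq> all_clauses n \<and> \<not> treelike (L + k) \<Phi>)) \<partial>?M) +
      ((\<integral>\<^sup>+\<Phi>. ennreal (2 / 2 ^ L * tree_walks (k + L) \<Phi>) \<partial>?M) +
       (\<integral>\<^sup>+\<Phi>. ennreal (\<Sum>j = 1..L. ?c j * tree_walks (k + j) \<Phi>) \<partial>?M))"
    by (subst nn_integral_add, simp, simp, subst nn_integral_add) simp_all
  also have "\<dots> \<le> ennreal ((\<Sum>i = 1..2 * (L + k) + 1. (real i ^ 2 * d) ^ i) / real n) +
      (ennreal (2 / 2 ^ L * d ^ (k + L)) + ennreal (\<Sum>j = 1..L. ?c j * d ^ (k + j)))"
    by (rule add_mono[OF prob_not_treelike[OF n2 d] add_mono[OF scaled sums]]) simp_all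
  also have "\<dots> = ennreal ((\<Sum>i = 1..2 * (L + k) + 1. (real i ^ 2 * d) ^ i) / real n +
      (2 / 2 ^ L * d ^ (k + L) + (\<Sum>j = 1..L. ?c j * d ^ (k + j))))"
    using d by (subst ennreal_plus[symmetric], simp, intro sum_nonneg, simp, subst ennreal_plus[symmetric])
      (auto intro!: sum_nonneg divide_nonneg_nonneg add_nonneg_nonneg)
  finally show ?thesis .
qed

end

text \<open>Conditioning costs only the factor \<open>1 / q\<close>. The function \<open>g\<close>
  copies \<open>f\<close> on \<open>A\<close> and is controlled elsewhere, where \<open>f\<close>
  may be unspecified.\<close>

lemma cond_expectation_le:
  fixes p :: "'a pmf" and f :: "'a \<Rightarrow> real"
  assumes f: "\<And>x. x \<in> A \<Longrightarrow> f x = g x" and le: "(\<integral>\<^sup>+x. ennreal (g x) \<partial>p) \<le> ennreal e" and "e \<ge> 0"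
    and prob: "measure_pmf.prob p A \<ge> q" "q > 0"
  shows "measure_pmf.expectation (cond_pmf p A) f \<le> e / q"
proof -
  have ne: "set_pmf p \<inter> A \<noteq> {}" using prob by (metis measure_pmf_zero_iff not_less order.strict_trans2)
  let ?P = "measure_pmf.prob p A"
  have P: "?P > 0" using prob by simp
  have "(\<integral>\<^sup>+x. ennreal (f x) \<partial>cond_pmf p A) = (\<integral>\<^sup>+x. ennreal (f x) * indicator A x \<partial>p) / emeasure p A"
    unfolding cond_pmf.rep_eq[OF ne] by (rule nn_integral_uniform_measure) simp_all
  also have "(\<integral>\<^sup>+x. ennreal (f x) * indicator A x \<partial>p) \<le> (\<integral>\<^sup>+x. ennreal (g x) \<partial>p)"
    using f by (intro nn_integral_mono) (auto simp: indicator_def)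
  also have "\<dots> \<le> ennreal e" by (rule le)
  finally have "(\<integral>\<^sup>+x. ennreal (f x) \<partial>cond_pmf p A) \<le> ennreal e / emeasure p A"
    by (simp add: divide_right_mono_ennreal)
  also have "\<dots> = ennreal (e / ?P)"
    using P assms(3) by (simp add: measure_pmf.emeasure_eq_measure divide_ennreal)
  finally have "measure_pmf.expectation (cond_pmf p A) f \<le> e / ?P"
    using P assms(3) by (intro integral_real_bounded) auto
  also have "\<dots> \<le> e / q" using prob assms(3) P by (intro divide_left_mono) auto
  finally show ?thesis .
qed

lemma set_random_formula:
  assumes "n \<ge> 2" "d > 0" "\<Phi> \<in> set_pmf (random_formula d n)"
  shows "set \<Phi> \<subseteq> all_clauses n"
  using assms(3) all_clauses_nonempty[OF assms(1,2)]
  by (auto simp: random_formula_def set_replicate_pmf in_lists_conv_set)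

lemma prob_sat:
  assumes n: "n \<ge> 2" and d: "d > 0" and \<rho>: "d * real n / (2 * (real n - 1)) \<le> \<rho>" "\<rho> < 1"
  shows "measure_pmf.prob (random_formula d n) {\<Phi>. num_sat n \<Phi> > 0} \<ge>
    1 - (\<Sum>k. real k ^ 2 * \<rho> ^ k) * d / (real n - 1)"
proof -
  let ?p = "random_formula d n"
  let ?B = "(\<Sum>k. real k ^ 2 * \<rho> ^ k) * d / (real n - 1)"
  have "emeasure ?p {\<Phi>. num_sat n \<Phi> = 0} = (\<integral>\<^sup>+\<Phi>. indicator {\<Phi>. num_sat n \<Phi> = 0} \<Phi> \<partial>?p)"
    by simp
  also have "\<dots> = (\<integral>\<^sup>+\<Phi>. ennreal (of_bool (set \<Phi> \<subseteq> all_clauses n \<and> num_sat n \<Phi> = 0)) \<partial>?p)"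
    by (intro nn_integral_cong_AE) (auto simp: AE_measure_pmf_iff indicator_def dest: set_random_formula[OF n d])
  also have "\<dots> \<le> ennreal ?B" by (rule prob_unsat[OF n d \<rho>])
  finally have "ennreal (measure_pmf.prob ?p {\<Phi>. num_sat n \<Phi> = 0}) \<le> ennreal ?B"
    by (simp add: measure_pmf.emeasure_eq_measure)
  \<comment> \<open>\<open>ennreal\<close> truncates negative numbers to 0, so the case
    \<open>?B < 0\<close> is carried along until it is excluded.\<close>
  then have le: "measure_pmf.prob ?p {\<Phi>. num_sat n \<Phi> = 0} \<le> ?B \<or> ?B < 0"
    by (cases "?B < 0") (auto simp: ennreal_le_iff)
  have \<rho>0: "\<rho> \<ge> 0"
  proof -
    have "0 \<le> d * real n / (2 * (real n - 1))" using n d by simp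
    with \<rho> show ?thesis by simp
  qed
  have "?B \<ge> 0"
    using n d \<rho>0 by (intro divide_nonneg_nonneg mult_nonneg_nonneg suminf_nonneg summable_square_power \<rho>) auto
  have "measure_pmf.prob ?p {\<Phi>. num_sat n \<Phi> > 0} = 1 - measure_pmf.prob ?p {\<Phi>. num_sat n \<Phi> = 0}"
  proof -
    have "{\<Phi>. num_sat n \<Phi> > 0} = space ?p - {\<Phi>. num_sat n \<Phi> = 0}" by auto
    then show ?thesis using measure_pmf.prob_compl[of "{\<Phi>. num_sat n \<Phi> = 0}" ?p] by simp
  qed
  with le \<open>?B \<ge> 0\<close> show ?thesis by linarith
qed

text \<open>Cycles and unsatisfiability contribute order \<open>1 / n\<close>, with constants that
  depend on the depth and on \<open>d\<close>; only the walk counts survive the limit in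
  \<open>n\<close>.\<close>

lemma limsup_max_error:
  assumes d: "0 < d" "d < 2" and pos: "L + k > 0"
  defines "E \<equiv> \<lambda>n. measure_pmf.expectation (cond_pmf (random_formula d n) {\<Phi>. num_sat n \<Phi> > 0}) (max_error n (L + k))"
  shows "0 \<le> limsup (\<lambda>n. ereal (E n))"
    "limsup (\<lambda>n. ereal (E n)) \<le> ereal (2 / 2 ^ L * d ^ (k + L) + (\<Sum>j = 1..L. 2 * ln 2 / 2 ^ (k + j) * d ^ (k + j)))"
proof -
  define K where "K = 2 / 2 ^ L * d ^ (k + L) + (\<Sum>j = 1..L. 2 * ln 2 / 2 ^ (k + j) * d ^ (k + j))"
  have K0: "K \<ge> 0" using d by (auto simp: K_def intro!: add_nonneg_nonneg sum_nonneg)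
  define c where "c = (\<Sum>i = 1..2 * (L + k) + 1. (real i ^ 2 * d) ^ i)"
  have c0: "c \<ge> 0" unfolding c_def by (rule sum_nonneg) (use d in simp)
  \<comment> \<open>The midpoint of \<open>d / 2\<close> and 1: the ratio in
    \<open>prob_unsat\<close> tends to \<open>d / 2\<close> and is eventually below it.\<close>
  define \<rho> where "\<rho> = (1 + d / 2) / 2"
  have \<rho>: "d / 2 < \<rho>" "\<rho> < 1" using d by (simp_all add: \<rho>_def)
  define b where "b = (\<Sum>k. real k ^ 2 * \<rho> ^ k) * d"
  have "(\<lambda>n. d * real n / (2 * (real n - 1))) \<longlonglongrightarrow> d / 2" by real_asymp
  then have ev1: "eventually (\<lambda>n. d * real n / (2 * (real n - 1)) < \<rho>) sequentially"
    using \<rho>(1) by (rule order_tendstoD)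
  have lim2: "(\<lambda>n. 1 - b / (real n - 1)) \<longlonglongrightarrow> 1" by real_asymp
  then have ev2: "eventually (\<lambda>n. 1 - b / (real n - 1) > 0) sequentially"
    by (rule order_tendstoD) simp
  have ev: "eventually (\<lambda>n. E n \<ge> 0 \<and> E n \<le> (c / real n + K) / (1 - b / (real n - 1))) sequentially"
    using ev1 ev2 eventually_ge_at_top[of 2]
  proof eventually_elim
    case (elim n)
    let ?p = "random_formula d n" and ?A = "{\<Phi>. num_sat n \<Phi> > 0}"
    have n1: "1 \<le> n" using elim by simp
    have P: "measure_pmf.prob ?p ?A \<ge> 1 - b / (real n - 1)"
      using prob_sat[OF elim(3) d(1) less_imp_le[OF elim(1)] \<rho>(2)] by (simp add: b_def)
    then have "measure_pmf.prob ?p ?A > 0" using elim(2) by linarith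
    then have ne: "set_pmf ?p \<inter> ?A \<noteq> {}" by (metis measure_pmf_zero_iff less_irrefl)
    have "E n \<ge> 0" unfolding E_def
      by (rule integral_nonneg_AE) (auto simp: AE_measure_pmf_iff ne intro: max_error_nonneg)
    moreover have "(\<integral>\<^sup>+\<Phi>. ennreal (sat_error n (L + k) \<Phi>) \<partial>?p) \<le> ennreal (c / real n + K)"
    proof -
      have "(\<integral>\<^sup>+\<Phi>. ennreal (sat_error n (L + k) \<Phi>) \<partial>?p) \<le> (\<integral>\<^sup>+\<Phi>. ennreal (envelope n L k \<Phi>) \<partial>?p)"
        by (rule nn_integral_random_formula_mono[OF elim(3) d(1)])
          (auto intro: sat_error_nonneg envelope_nonneg[OF n1 pos] sum_sat_error_le[OF n1 pos])
      also have "\<dots> \<le> ennreal (c / real n + K)"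
        unfolding c_def K_def by (rule expected_envelope[OF n1 pos elim(3) d(1)])
      finally show ?thesis .
    qed
    then have "E n \<le> (c / real n + K) / (1 - b / (real n - 1))" unfolding E_def
      by (intro cond_expectation_le[where g = "sat_error n (L + k)"] P)
        (use c0 K0 elim in \<open>auto simp: sat_error_def\<close>)
    ultimately show ?case by simp
  qed
  show "0 \<le> limsup (\<lambda>n. ereal (E n))"
    by (rule le_Limsup) (use ev in \<open>auto elim!: eventually_mono\<close>)
  have "(\<lambda>n. (c / real n + K) / (1 - b / (real n - 1))) \<longlonglongrightarrow> (0 + K) / 1"
    by (intro tendsto_divide tendsto_add lim2 tendsto_const) (real_asymp, simp)
  then have "(\<lambda>n. ereal ((c / real n + K) / (1 - b / (real n - 1)))) \<longlonglongrightarrow> ereal K" by simp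
  then have "limsup (\<lambda>n. ereal ((c / real n + K) / (1 - b / (real n - 1)))) = ereal K"
    by (intro lim_imp_Limsup) simp_all
  moreover have "limsup (\<lambda>n. ereal (E n)) \<le> limsup (\<lambda>n. ereal ((c / real n + K) / (1 - b / (real n - 1))))"
    by (rule Limsup_mono) (use ev in \<open>auto elim!: eventually_mono\<close>)
  ultimately show "limsup (\<lambda>n. ereal (E n)) \<le> ereal (2 / 2 ^ L * d ^ (k + L) + (\<Sum>j = 1..L. 2 * ln 2 / 2 ^ (k + j) * d ^ (k + j)))"
    unfolding K_def by simp
qed

text \<open>Completing the geometric series over \<open>j\<close> makes the second term uniform in
  \<open>L\<close>.\<close>

lemma geometric_bound:
  fixes d :: real
  assumes d: "0 < d" "d < 2"
  shows "2 / 2 ^ L * d ^ (k + L) + (\<Sum>j = 1..L. 2 * ln 2 / 2 ^ (k + j) * d ^ (k + j)) \<le>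
    2 * d ^ k * (d / 2) ^ L + 2 * ln 2 / (1 - d / 2) * (d / 2) ^ k"
proof -
  define x where "x = d / 2"
  have x: "0 < x" "x < 1" using d by (simp_all add: x_def)
  have "2 / 2 ^ L * d ^ (k + L) = 2 * d ^ k * x ^ L" by (simp add: x_def power_divide power_add)
  moreover have "(\<Sum>j = 1..L. 2 * ln 2 / 2 ^ (k + j) * d ^ (k + j)) = 2 * ln 2 * x ^ k * (\<Sum>j = 1..L. x ^ j)"
    unfolding sum_distrib_left by (intro sum.cong refl) (simp add: x_def power_divide power_add)
  moreover have "(\<Sum>j = 1..L. x ^ j) \<le> 1 / (1 - x)"
  proof -
    have "(\<Sum>j = 1..L. x ^ j) \<le> (\<Sum>j. x ^ j)"
      using x by (intro sum_le_suminf summable_geometric) auto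
    then show ?thesis using x by (simp add: suminf_geometric)
  qed
  then have "2 * ln 2 * x ^ k * (\<Sum>j = 1..L. x ^ j) \<le> 2 * ln 2 * x ^ k * (1 / (1 - x))"
    using x by (intro mult_left_mono) auto
  ultimately show ?thesis by (simp add: x_def)
qed

theorem theorem1p2:
  fixes d :: real
  assumes "0 < d" and "d < 2"
  shows "(\<lambda>l. limsup (\<lambda>n. ereal (measure_pmf.expectation
             (cond_pmf (random_formula d n) {\<Phi>. num_sat n \<Phi> > 0})
             (\<lambda>\<Phi>. MAX \<tau>\<in>sat_assignments n \<Phi>.
                \<bar>cond_marginal n \<Phi> l \<tau> - bp_marginal \<Phi> l 1 1\<bar>))))
         \<longlonglongrightarrow> 0"
proof -
  define X where "X = (\<lambda>l. limsup (\<lambda>n. ereal (measure_pmf.expectation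
             (cond_pmf (random_formula d n) {\<Phi>. num_sat n \<Phi> > 0}) (max_error n l))))"
  define B where "B = (\<lambda>k L. 2 * d ^ k * (d / 2) ^ L + 2 * ln 2 / (1 - d / 2) * (d / 2) ^ k)"
  have X: "0 \<le> X (L + k) \<and> X (L + k) \<le> ereal (B k L)" if "L + k > 0" for L k
  proof -
    have "X (L + k) \<le> ereal (2 / 2 ^ L * d ^ (k + L) + (\<Sum>j = 1..L. 2 * ln 2 / 2 ^ (k + j) * d ^ (k + j)))"
      unfolding X_def by (rule limsup_max_error(2)[OF assms that])
    also have "\<dots> \<le> ereal (B k L)" using geometric_bound[OF assms] by (simp add: B_def)
    finally show ?thesis using limsup_max_error(1)[OF assms that] by (simp add: X_def)
  qed
  have "X \<longlonglongrightarrow> 0"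
  proof (rule order_tendstoI)
    fix a :: ereal assume "a < 0"
    \<comment> \<open>The split with \<open>k = 0\<close> reaches every positive depth.\<close>
    then have "a < X l" if "l > 0" for l using X[of l 0] that by (auto intro: less_le_trans)
    then show "eventually (\<lambda>l. a < X l) sequentially"
      by (rule eventually_mono[OF eventually_gt_at_top[of 0]])
  next
    fix a :: ereal assume "0 < a"
    then obtain e where e: "0 < e" "ereal e < a" using ereal_dense2[of 0 a] by auto
    have "(\<lambda>k. 2 * ln 2 / (1 - d / 2) * (d / 2) ^ k) \<longlonglongrightarrow> 2 * ln 2 / (1 - d / 2) * 0"
      using assms by (intro tendsto_mult tendsto_const LIMSEQ_power_zero) auto
    then have "eventually (\<lambda>k. 2 * ln 2 / (1 - d / 2) * (d / 2) ^ k < e / 2) sequentially"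
      using e(1) by (intro order_tendstoD(2)) auto
    then obtain k where k: "2 * ln 2 / (1 - d / 2) * (d / 2) ^ k < e / 2"
      using eventually_happens'[OF sequentially_bot] by blast
    \<comment> \<open>With \<open>k\<close> already fixed, \<open>d ^ k\<close> is a constant,
      however large, and \<open>(d / 2) ^ L\<close> beats it.\<close>
    have "(\<lambda>L. 2 * d ^ k * (d / 2) ^ L) \<longlonglongrightarrow> 2 * d ^ k * 0"
      using assms by (intro tendsto_mult tendsto_const LIMSEQ_power_zero) auto
    then have "eventually (\<lambda>L. 2 * d ^ k * (d / 2) ^ L < e / 2) sequentially"
      using e(1) by (intro order_tendstoD(2)) auto
    then have "eventually (\<lambda>L. X (L + k) < a) sequentially"
      using eventually_gt_at_top[of 0]
    proof eventually_elim
      case (elim L)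
      then have "X (L + k) \<le> ereal (B k L)" using X by simp
      moreover have "B k L < e" using elim k by (simp add: B_def)
      then have "ereal (B k L) < a" using e(2) less_trans[of "ereal (B k L)" "ereal e" a] by simp
      ultimately show ?case by (rule le_less_trans)
    qed
    then show "eventually (\<lambda>l. X l < a) sequentially" by (rule eventually_sequentially_seg[THEN iffD1])
  qed
  then show ?thesis unfolding X_def max_error_def .
qed

end
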